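(* Let $\mathbb K$ be a field of characteristic $0$, $I$ a finite set, $P=\bigsqcup_{i\in I}P_i$ a set with weights $w_p\in\mathbb Z_{\ge1}$ (finitely many elements of each weight), and $\mathcal E=\{E_p\}_{p\in P}$ a family of finite sets. Let $\mathbf s=(s_i)_{i\in I}\in\mathbb K^I$, and for each $p\in P$ and $e\in E_p$ let $u_e\in\mathbb K$ and $\alpha_e\in\mathbb Z_{\ge0}$ be such that $\sum_{e\in E_p}u_e=1$ and $\sum_{e\in E_p}\alpha_e=w_p$ for every $p$. Let $\mathbf T(x)=(T_i(x))_{i\in I}\in\widetilde{\mathcal H}_{P,\mathcal E}[[x]]^I$ be the solution of the combinatorial Dyson--Schwinger system $$T_i(x)=1+\sum_{p\in P_i}\tilde B_+^{(p)}\Big(\bigotimes_{e\in E_p}T_i(x)^{u_e}Q(x)^{\alpha_e}\Big)\quad(i\in I),\qquad Q(x)=x\prod_{j\in I}T_j(x)^{s_j}.$$ Then for any $i\in I$ the algebra morphism $\phi_i:\mathsf{Rio}\to\widetilde{\mathcal H}_{P,\mathcal E}$ defined by $\phi_i(Y(x))=T_i(x)$ and $\phi_i(\Pi(x))=Q(x)$ is a bialgebra morphism. As a consequence, for any 1-cocycles $\Lambda_p:\mathbb K[\mathbf L_p]\to\mathbb K[L]$ ($p\in P$, $\mathbf L_p=(L_e)_{e\in E_p}$), the solution $\mathbf G(x,L)=(G_i(x,L))_{i\in I}$ of the corresponding Dyson--Schwinger system $$G_i(x,L)=1+\sum_{p\in P_i}x^{w_p}\Lambda_p\Big(\prod_{e\in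 E_p}\Big(G_i(x,L_e)^{u_e}\prod_{j\in I}G_j(x,L_e)^{\alpha_es_j}\Big)\Big)\quad(i\in I)$$ satisfies the renormalization group equations $$\Big(\frac{\partial}{\partial L}-\beta(x)\frac{\partial}{\partial x}-\gamma_i(x)\Big)G_i(x,L)=0\quad(i\in I),$$ where $\gamma_i(x)$ is the coefficient of $L^1$ in $G_i(x,L)$ and $\beta(x)=\sum_{i\in I}s_i\,x\,\gamma_i(x)$.
   Context: **Conventions.** Linear maps are applied to power series in $x$ coefficientwise, and tensor products of power series in $x$ are regarded as power series in $x$ with coefficients in the tensor product. Arbitrary powers of series with constant term $1$ are defined by the binomial series. **Riordan Hopf algebra.** $\mathsf{Rio}=\mathbb K[\pi_1,\pi_2,\dots,y_1,y_2,\dots]$ as an algebra; put $\pi_0=y_0=1$, $\Pi(x)=x+\sum_{n\ge1}\pi_nx^{n+1}$, $Y(x)=1+\sum_{n\ge1}y_nx^n$. The coproduct is the algebra morphism with $\Delta\pi_n=\sum_{k=0}^n[x^{n+1}]\Pi(x)^{k+1}\otimes\pi_k$ and $\Delta y_n=\sum_{j=0}^n[x^n]Y(x)\Pi(x)^j\otimes y_j$; the counit kills all $\pi_n,y_n$ with $n\ge1$. **Trees.** A rooted forest is a finite poset in which each element is covered by at most one element; a rooted tree is a connected nonempty rooted forest. A $(P,\mathcal E)$-forest is a rooted forest with each vertex decorated by an element of $P$ and each edge from a parent decorated $p$ to a child decorated by an element of $E_p$. $\widetilde{\mathcal H}_{P,\mathcal E}$ is the vector space with basis the isomorphism classes of $(P,\mathcal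 E)$-forests, a bialgebra with disjoint union as product and $\Delta(F)=\sum_{D\text{ downset of }F}D\otimes(F\setminus D)$ (keeping decorations on vertices and remaining edges). $\tilde B_+^{(p)}:\widetilde{\mathcal H}_{P,\mathcal E}^{\otimes E_p}\to\widetilde{\mathcal H}_{P,\mathcal E}$ sends $\bigotimes_{e\in E_p}f_e$ to the tree obtained from the disjoint union of the $f_e$ by adding a new root decorated $p$, joined to the root of each component of $f_e$ by an edge decorated $e$. **1-cocycles.** $\mathbb K[L]$ is the Hopf algebra with $\Delta L=L\otimes1+1\otimes L$; $\mathbb K[\mathbf L_p]$ is a left $\mathbb K[L]$-comodule via $\delta(\mathbf L^\alpha)=\sum_{\beta\le\alpha}\binom\alpha\beta L^{|\alpha|-|\beta|}\otimes\mathbf L^\beta$; a 1-cocycle is a linear map $\Lambda:\mathbb K[\mathbf L_p]\to\mathbb K[L]$ with $\Delta\Lambda=\Lambda\otimes1+(\mathrm{id}\otimes\Lambda)\delta$. *)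

theory Defs
  imports
    "HOL-Analysis.Infinite_Sum"
    "HOL-Library.Poly_Mapping"
    "HOL-Library.Product_Plus"
    "HOL-Library.Disjoint_Sets"
begin

unbundle fps_syntax

section \<open>Free vector spaces and monoid algebras\<close>

text \<open>
  A vector space over \<open>'k\<close> with basis \<open>'a\<close> is the type \<open>'a \<Rightarrow>\<^sub>0 'k\<close>; if \<open>'a\<close> is a commutative monoid
  (written additively) this is the monoid algebra, with the library's convolution product.  The tensor
  product of \<open>'a \<Rightarrow>\<^sub>0 'k\<close> and \<open>'b \<Rightarrow>\<^sub>0 'k\<close> is \<open>('a \<times> 'b) \<Rightarrow>\<^sub>0 'k\<close>, the basis vector \<open>(a, b)\<close> being
  \<open>a \<otimes> b\<close>.  The tensor power of \<open>'m \<Rightarrow>\<^sub>0 'k\<close> indexed by a finite set \<open>E\<close> is the part of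
  \<open>('e \<Rightarrow>\<^sub>0 'm) \<Rightarrow>\<^sub>0 'k\<close> whose basis vectors are supported in \<open>E\<close>; the basis vector \<open>F\<close> is
  the tensor product over \<open>e\<close> of the \<open>Poly_Mapping.lookup F e\<close>.  For \<open>'m = nat\<close> this is also the polynomial algebra in the
  variables \<open>L\<^sub>e\<close>.
\<close>

definition smul :: "'k::comm_ring_1 \<Rightarrow> ('a \<Rightarrow>\<^sub>0 'k) \<Rightarrow> ('a \<Rightarrow>\<^sub>0 'k)" where
  "smul c f = Poly_Mapping.map ((*) c) f"

definition lin_ext :: "('a \<Rightarrow> ('b \<Rightarrow>\<^sub>0 'k::comm_ring_1)) \<Rightarrow> ('a \<Rightarrow>\<^sub>0 'k) \<Rightarrow> ('b \<Rightarrow>\<^sub>0 'k)" where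
  "lin_ext g f = (\<Sum>a\<in>Poly_Mapping.keys f. smul (Poly_Mapping.lookup f a) (g a))"

definition tensor :: "('a \<Rightarrow>\<^sub>0 'k::comm_ring_1) \<Rightarrow> ('b \<Rightarrow>\<^sub>0 'k) \<Rightarrow> (('a \<times> 'b) \<Rightarrow>\<^sub>0 'k)" where
  "tensor f g = (\<Sum>a\<in>Poly_Mapping.keys f. \<Sum>b\<in>Poly_Mapping.keys g.
     Poly_Mapping.single (a, b) (Poly_Mapping.lookup f a * Poly_Mapping.lookup g b))"

text \<open>Tensor product of two linear maps (only their values on basis vectors matter).\<close>

definition tensor_map ::
  "(('a \<Rightarrow>\<^sub>0 'k) \<Rightarrow> ('c \<Rightarrow>\<^sub>0 'k)) \<Rightarrow> (('b \<Rightarrow>\<^sub>0 'k) \<Rightarrow> ('d \<Rightarrow>\<^sub>0 'k))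
     \<Rightarrow> (('a \<times> 'b) \<Rightarrow>\<^sub>0 'k::comm_ring_1) \<Rightarrow> (('c \<times> 'd) \<Rightarrow>\<^sub>0 'k)" where
  "tensor_map \<phi> \<psi> =
     lin_ext (\<lambda>(a, b). tensor (\<phi> (Poly_Mapping.single a 1)) (\<psi> (Poly_Mapping.single b 1)))"

text \<open>The inclusion of an algebra as the \<open>e\<close>-th factor of its tensor power; for \<open>'m = nat\<close> it is
  the substitution of \<open>L\<^sub>e\<close> for \<open>L\<close>.  Thus \<open>\<Prod>e\<in>E. incl e (f e)\<close> is the tensor product of
  the \<open>f e\<close>.\<close>

definition incl :: "'e \<Rightarrow> ('m::comm_monoid_add \<Rightarrow>\<^sub>0 'k::comm_ring_1) \<Rightarrow> (('e \<Rightarrow>\<^sub>0 'm) \<Rightarrow>\<^sub>0 'k)" where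
  "incl e = lin_ext (\<lambda>m. Poly_Mapping.single (Poly_Mapping.single e m) 1)"

definition alg_hom ::
  "(('a::comm_monoid_add \<Rightarrow>\<^sub>0 'k::comm_ring_1) \<Rightarrow> ('b::comm_monoid_add \<Rightarrow>\<^sub>0 'k)) \<Rightarrow> bool" where
  "alg_hom \<phi> \<longleftrightarrow>
     (\<forall>f g. \<phi> (f + g) = \<phi> f + \<phi> g) \<and> (\<forall>c f. \<phi> (smul c f) = smul c (\<phi> f)) \<and>
     \<phi> 1 = 1 \<and> (\<forall>f g. \<phi> (f * g) = \<phi> f * \<phi> g)"

definition bialg_hom ::
  "(('a::comm_monoid_add \<Rightarrow>\<^sub>0 'k::comm_ring_1) \<Rightarrow> (('a \<times> 'a) \<Rightarrow>\<^sub>0 'k)) \<Rightarrow> (('a \<Rightarrow>\<^sub>0 'k) \<Rightarrow> 'k) \<Rightarrow>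
   (('b::comm_monoid_add \<Rightarrow>\<^sub>0 'k) \<Rightarrow> (('b \<times> 'b) \<Rightarrow>\<^sub>0 'k)) \<Rightarrow> (('b \<Rightarrow>\<^sub>0 'k) \<Rightarrow> 'k) \<Rightarrow>
   (('a \<Rightarrow>\<^sub>0 'k) \<Rightarrow> ('b \<Rightarrow>\<^sub>0 'k)) \<Rightarrow> bool" where
  "bialg_hom \<Delta>\<^sub>A \<epsilon>\<^sub>A \<Delta>\<^sub>B \<epsilon>\<^sub>B \<phi> \<longleftrightarrow>
     alg_hom \<phi> \<and> (\<forall>f. \<Delta>\<^sub>B (\<phi> f) = tensor_map \<phi> \<phi> (\<Delta>\<^sub>A f)) \<and> (\<forall>f. \<epsilon>\<^sub>B (\<phi> f) = \<epsilon>\<^sub>A f)"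

text \<open>Evaluation of polynomials in the variables \<open>'v\<close>: the algebra morphism with \<open>v \<mapsto> g v\<close>.\<close>

definition poly_eval ::
  "('v \<Rightarrow> ('b::comm_monoid_add \<Rightarrow>\<^sub>0 'k::comm_ring_1)) \<Rightarrow> (('v \<Rightarrow>\<^sub>0 nat) \<Rightarrow>\<^sub>0 'k) \<Rightarrow> ('b \<Rightarrow>\<^sub>0 'k)" where
  "poly_eval g = lin_ext (\<lambda>m. \<Prod>v\<in>Poly_Mapping.keys m. g v ^ Poly_Mapping.lookup m v)"


section \<open>Power series over monoid algebras\<close>

definition fps_map :: "('a \<Rightarrow> 'b) \<Rightarrow> 'a fps \<Rightarrow> 'b fps" where
  "fps_map h f = Abs_fps (\<lambda>n. h (f $ n))"

text \<open>The binomial series \<open>f\<^sup>a = (\<Sum>n. (a choose n) (f - 1)\<^sup>n)\<close>; meaningful if \<open>f $ 0 = 1\<close>.\<close>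

definition fps_pow ::
  "('m::comm_monoid_add \<Rightarrow>\<^sub>0 'k::field_char_0) fps \<Rightarrow> 'k \<Rightarrow> ('m \<Rightarrow>\<^sub>0 'k) fps" where
  "fps_pow f a = Abs_fps (\<lambda>n. Poly_Mapping.single 0 (a gchoose n)) oo (f - 1)"


section \<open>The Riordan Hopf algebra\<close>

text \<open>The variable \<open>VPi n\<close> stands for \<open>\<pi>\<close> with index \<open>Suc n\<close>, and likewise for \<open>VY n\<close>.\<close>

datatype rio_var = VPi nat | VY nat

type_synonym 'k rio = "(rio_var \<Rightarrow>\<^sub>0 nat) \<Rightarrow>\<^sub>0 'k"

definition rio_gen :: "rio_var \<Rightarrow> 'k::comm_ring_1 rio" where
  "rio_gen v = Poly_Mapping.single (Poly_Mapping.single v 1) 1"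

definition rio_pi :: "nat \<Rightarrow> 'k::comm_ring_1 rio" where
  "rio_pi n = (case n of 0 \<Rightarrow> 1 | Suc m \<Rightarrow> rio_gen (VPi m))"

definition rio_y :: "nat \<Rightarrow> 'k::comm_ring_1 rio" where
  "rio_y n = (case n of 0 \<Rightarrow> 1 | Suc m \<Rightarrow> rio_gen (VY m))"

definition rio_Pi :: "'k::comm_ring_1 rio fps" where
  "rio_Pi = Abs_fps (\<lambda>n. case n of 0 \<Rightarrow> 0 | Suc m \<Rightarrow> rio_pi m)"

definition rio_Y :: "'k::comm_ring_1 rio fps" where
  "rio_Y = Abs_fps rio_y"

definition rio_coprod_pi :: "nat \<Rightarrow> ((rio_var \<Rightarrow>\<^sub>0 nat) \<times> (rio_var \<Rightarrow>\<^sub>0 nat)) \<Rightarrow>\<^sub>0 'k::comm_ring_1" where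
  "rio_coprod_pi n = (\<Sum>k\<le>n. tensor ((rio_Pi ^ (k + 1)) $ (n + 1)) (rio_pi k))"

definition rio_coprod_y :: "nat \<Rightarrow> ((rio_var \<Rightarrow>\<^sub>0 nat) \<times> (rio_var \<Rightarrow>\<^sub>0 nat)) \<Rightarrow>\<^sub>0 'k::comm_ring_1" where
  "rio_coprod_y n = (\<Sum>j\<le>n. tensor ((rio_Y * rio_Pi ^ j) $ n) (rio_y j))"

definition rio_coprod :: "'k::comm_ring_1 rio \<Rightarrow> ((rio_var \<Rightarrow>\<^sub>0 nat) \<times> (rio_var \<Rightarrow>\<^sub>0 nat)) \<Rightarrow>\<^sub>0 'k" where
  "rio_coprod = poly_eval
     (\<lambda>v. case v of VPi n \<Rightarrow> rio_coprod_pi (Suc n) | VY n \<Rightarrow> rio_coprod_y (Suc n))"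

text \<open>The constant coefficient, i.e. the algebra morphism that kills all variables.\<close>

definition rio_counit :: "'k::comm_ring_1 rio \<Rightarrow> 'k" where
  "rio_counit f = Poly_Mapping.lookup f 0"


section \<open>Decorated rooted forests\<close>

text \<open>\<open>below\<close> is the order of the poset, with \<open>(a, b) \<in> below X\<close> for \<open>a \<le> b\<close>; roots are maximal.  The
  decoration of the edge from the parent \<open>b\<close> to the child \<open>a\<close> is \<open>edec X b a\<close>; all other values
  of \<open>edec\<close>, and the values of \<open>vdec\<close> outside \<open>verts X\<close>, are irrelevant.\<close>

record ('v, 'p, 'e) dforest =
  verts :: "'v set"
  below :: "('v \<times> 'v) set"
  vdec :: "'v \<Rightarrow> 'p"
  edec :: "'v \<Rightarrow> 'v \<Rightarrow> 'e"

definition covered_by :: "('v, 'p, 'e) dforest \<Rightarrow> 'v \<Rightarrow> 'v \<Rightarrow> bool" where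
  "covered_by X a b \<longleftrightarrow> (a, b) \<in> below X \<and> a \<noteq> b \<and>
     (\<forall>c. (a, c) \<in> below X \<and> (c, b) \<in> below X \<longrightarrow> c = a \<or> c = b)"

definition is_forest :: "('v, 'p, 'e) dforest \<Rightarrow> bool" where
  "is_forest X \<longleftrightarrow> finite (verts X) \<and> partial_order_on (verts X) (below X) \<and>
     (\<forall>a b c. covered_by X a b \<and> covered_by X a c \<longrightarrow> b = c)"

definition is_forest_iso ::
  "('v \<Rightarrow> 'w) \<Rightarrow> ('v, 'p, 'e) dforest \<Rightarrow> ('w, 'p, 'e) dforest \<Rightarrow> bool" where
  "is_forest_iso f X Y \<longleftrightarrow> bij_betw f (verts X) (verts Y) \<and>
     (\<forall>a\<in>verts X. \<forall>b\<in>verts X. (f a, f b) \<in> below Y \<longleftrightarrow> (a, b) \<in> below X) \<and>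
     (\<forall>a\<in>verts X. vdec Y (f a) = vdec X a) \<and>
     (\<forall>a b. covered_by X a b \<longrightarrow> edec Y (f b) (f a) = edec X b a)"

definition forest_iso :: "('v, 'p, 'e) dforest \<Rightarrow> ('w, 'p, 'e) dforest \<Rightarrow> bool" where
  "forest_iso X Y \<longleftrightarrow> (\<exists>f. is_forest_iso f X Y)"

text \<open>Isomorphism classes; every finite poset has a copy on a set of natural numbers, so we only
  collect the forests with such vertices.\<close>

definition iso_class :: "('v, 'p, 'e) dforest \<Rightarrow> (nat, 'p, 'e) dforest set" where
  "iso_class X = {Y. is_forest Y \<and> forest_iso X Y}"

definition empty_dforest :: "(nat, 'p, 'e) dforest" where
  "empty_dforest = \<lparr>verts = {}, below = {}, vdec = (\<lambda>_. undefined), edec = (\<lambda>_ _. undefined)\<rparr>"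

lemma is_forest_empty: "is_forest empty_dforest"
  by (simp add: is_forest_def empty_dforest_def covered_by_def)

typedef ('p, 'e) forest = "{iso_class X | X :: (nat, 'p, 'e) dforest. is_forest X}"
  using is_forest_empty by blast

definition forest_of :: "('v, 'p, 'e) dforest \<Rightarrow> ('p, 'e) forest" where
  "forest_of X = Abs_forest (iso_class X)"

definition rep_of :: "('p, 'e) forest \<Rightarrow> (nat, 'p, 'e) dforest" where
  "rep_of F = (SOME X. X \<in> Rep_forest F)"

definition disj_union ::
  "('v, 'p, 'e) dforest \<Rightarrow> ('w, 'p, 'e) dforest \<Rightarrow> ('v + 'w, 'p, 'e) dforest" where
  "disj_union X Y = \<lparr>
     verts = Inl ` verts X \<union> Inr ` verts Y,
     below = {(Inl a, Inl b) | a b. (a, b) \<in> below X} \<union> {(Inr a, Inr b) | a b. (a, b) \<in> below Y},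
     vdec = case_sum (vdec X) (vdec Y),
     edec = (\<lambda>b a. case (b, a) of
        (Inl b', Inl a') \<Rightarrow> edec X b' a' | (Inr b', Inr a') \<Rightarrow> edec Y b' a' | _ \<Rightarrow> undefined)\<rparr>"

definition restrict_forest :: "('v, 'p, 'e) dforest \<Rightarrow> 'v set \<Rightarrow> ('v, 'p, 'e) dforest" where
  "restrict_forest X D = X\<lparr>verts := D, below := below X \<inter> D \<times> D\<rparr>"

definition downset :: "('v, 'p, 'e) dforest \<Rightarrow> 'v set \<Rightarrow> bool" where
  "downset X D \<longleftrightarrow> D \<subseteq> verts X \<and> (\<forall>b\<in>D. \<forall>a. (a, b) \<in> below X \<longrightarrow> a \<in> D)"

text \<open>The new root is \<open>None\<close>; the vertex \<open>v\<close> of the forest \<open>R e\<close> becomes \<open>Some (e, v)\<close>.\<close>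

definition add_root :: "'p \<Rightarrow> ('e \<Rightarrow> ('v, 'p, 'e) dforest) \<Rightarrow> (('e \<times> 'v) option, 'p, 'e) dforest" where
  "add_root p R = (let V = insert None {Some (e, v) | e v. v \<in> verts (R e)} in \<lparr>
     verts = V,
     below = {(a, None) | a. a \<in> V} \<union> {(Some (e, a), Some (e, b)) | e a b. (a, b) \<in> below (R e)},
     vdec = (\<lambda>a. case a of None \<Rightarrow> p | Some (e, v) \<Rightarrow> vdec (R e) v),
     edec = (\<lambda>b a. case (b, a) of
        (None, Some (e, v)) \<Rightarrow> e
      | (Some (_, b'), Some (e, a')) \<Rightarrow> edec (R e) b' a'
      | _ \<Rightarrow> undefined)\<rparr>)"

lemma is_forestD:
  assumes "is_forest X"
  shows "finite (verts X)" "below X \<subseteq> verts X \<times> verts X"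
    "\<And>a. a \<in> verts X \<Longrightarrow> (a, a) \<in> below X"
    "\<And>a b c. (a, b) \<in> below X \<Longrightarrow> (b, c) \<in> below X \<Longrightarrow> (a, c) \<in> below X"
    "\<And>a b. (a, b) \<in> below X \<Longrightarrow> (b, a) \<in> below X \<Longrightarrow> a = b"
    "\<And>a b c. covered_by X a b \<Longrightarrow> covered_by X a c \<Longrightarrow> b = c"
proof -
  have po: "refl_on (verts X) (below X)" "trans (below X)" "antisym (below X)"
    and "finite (verts X)" "below X \<subseteq> verts X \<times> verts X"
    and cov: "\<forall>a b c. covered_by X a b \<and> covered_by X a c \<longrightarrow> b = c"
    using assms by (simp_all add: is_forest_def partial_order_on_def preorder_on_def)
  then show "finite (verts X)" "below X \<subseteq> verts X \<times> verts X" by simp_all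
  show "(a, a) \<in> below X" if "a \<in> verts X" for a
    using po(1) that by (rule refl_onD)
  show "(a, c) \<in> below X" if "(a, b) \<in> below X" "(b, c) \<in> below X" for a b c
    using po(2) that by (rule transD)
  show "a = b" if "(a, b) \<in> below X" "(b, a) \<in> below X" for a b
    using po(3) that by (rule antisymD)
  show "b = c" if "covered_by X a b" "covered_by X a c" for a b c
    using cov that by blast
qed

lemma is_forestI:
  assumes "finite (verts X)" "below X \<subseteq> verts X \<times> verts X"
    "\<And>a. a \<in> verts X \<Longrightarrow> (a, a) \<in> below X"
    "\<And>a b c. (a, b) \<in> below X \<Longrightarrow> (b, c) \<in> below X \<Longrightarrow> (a, c) \<in> below X"
    "\<And>a b. (a, b) \<in> below X \<Longrightarrow> (b, a) \<in> below X \<Longrightarrow> a = b"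
    "\<And>a b c. covered_by X a b \<Longrightarrow> covered_by X a c \<Longrightarrow> b = c"
  shows "is_forest X"
  unfolding is_forest_def partial_order_on_def preorder_on_def refl_on_def
  using assms by (auto intro!: transI antisymI)

lemma covered_byD: "covered_by X a b \<Longrightarrow> (a, b) \<in> below X"
  by (simp add: covered_by_def)

lemma covered_by_transport:
  assumes "below X \<subseteq> verts X \<times> verts X" "below Y \<subseteq> verts Y \<times> verts Y"
    and f: "bij_betw f (verts X) (verts Y)"
    and le: "\<And>a b. a \<in> verts X \<Longrightarrow> b \<in> verts X \<Longrightarrow> (f a, f b) \<in> below Y \<longleftrightarrow> (a, b) \<in> below X"
    and a: "a \<in> verts X" and b: "b \<in> verts X"
  shows "covered_by Y (f a) (f b) \<longleftrightarrow> covered_by X a b"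
proof -
  have inj: "f x = f y \<longleftrightarrow> x = y" if "x \<in> verts X" "y \<in> verts X" for x y
    using f that by (auto simp: bij_betw_def inj_on_def)
  have "(\<forall>c. (f a, c) \<in> below Y \<and> (c, f b) \<in> below Y \<longrightarrow> c = f a \<or> c = f b) \<longleftrightarrow>
        (\<forall>c\<in>verts Y. (f a, c) \<in> below Y \<and> (c, f b) \<in> below Y \<longrightarrow> c = f a \<or> c = f b)"
    using assms(2) by blast
  also have "\<dots> \<longleftrightarrow> (\<forall>c\<in>verts X. (f a, f c) \<in> below Y \<and> (f c, f b) \<in> below Y \<longrightarrow> f c = f a \<or> f c = f b)"
    unfolding bij_betw_imp_surj_on[OF f, symmetric] by simp
  also have "\<dots> \<longleftrightarrow> (\<forall>c\<in>verts X. (a, c) \<in> below X \<and> (c, b) \<in> below X \<longrightarrow> c = a \<or> c = b)"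
    using a b le inj by auto
  also have "\<dots> \<longleftrightarrow> (\<forall>c. (a, c) \<in> below X \<and> (c, b) \<in> below X \<longrightarrow> c = a \<or> c = b)"
    using assms(1) by blast
  finally show ?thesis
    unfolding covered_by_def using le[OF a b] inj[OF a b] by simp
qed

lemma is_forest_iso_covered:
  assumes "is_forest X" "is_forest Y" "is_forest_iso f X Y" "a \<in> verts X" "b \<in> verts X"
  shows "covered_by Y (f a) (f b) \<longleftrightarrow> covered_by X a b"
  using assms by (intro covered_by_transport) (auto simp: is_forest_iso_def dest: is_forestD(2))

lemma forest_iso_refl: "forest_iso X X"
  unfolding forest_iso_def is_forest_iso_def by (intro exI[of _ id]) auto

lemma forest_iso_sym:
  assumes X: "is_forest X" and Y: "is_forest Y" and "forest_iso X Y"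
  shows "forest_iso Y X"
proof -
  obtain f where f: "is_forest_iso f X Y"
    using assms(3) by (auto simp: forest_iso_def)
  define g where "g = inv_into (verts X) f"
  have bij: "bij_betw f (verts X) (verts Y)"
    using f by (simp add: is_forest_iso_def)
  have g: "g b \<in> verts X" "f (g b) = b" if "b \<in> verts Y" for b
    using bij that unfolding g_def
    by (auto simp: bij_betw_def inv_into_into f_inv_into_f)
  have "is_forest_iso g Y X"
    unfolding is_forest_iso_def
  proof (intro conjI ballI allI impI)
    show "bij_betw g (verts Y) (verts X)"
      unfolding g_def by (rule bij_betw_inv_into[OF bij])
    show "(g a, g b) \<in> below X \<longleftrightarrow> (a, b) \<in> below Y" if "a \<in> verts Y" "b \<in> verts Y" for a b
      using f g that unfolding is_forest_iso_def by metis
    show "vdec X (g a) = vdec Y a" if "a \<in> verts Y" for a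
      using f g that unfolding is_forest_iso_def by metis
    show "edec X (g b) (g a) = edec Y b a" if c: "covered_by Y a b" for a b
    proof -
      have ab: "a \<in> verts Y" "b \<in> verts Y"
        using covered_byD[OF c] is_forestD(2)[OF Y] by auto
      have "covered_by X (g a) (g b)"
        using is_forest_iso_covered[OF X Y f g(1)[OF ab(1)] g(1)[OF ab(2)]] c ab g(2) by simp
      then show ?thesis
        using f g(2) ab unfolding is_forest_iso_def by metis
    qed
  qed
  then show ?thesis by (auto simp: forest_iso_def)
qed

lemma forest_iso_trans:
  assumes X: "is_forest X" and Y: "is_forest Y" and "forest_iso X Y" "forest_iso Y Z"
  shows "forest_iso X Z"
proof -
  obtain f g where f: "is_forest_iso f X Y" and g: "is_forest_iso g Y Z"
    using assms(3,4) by (auto simp: forest_iso_def)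
  have fv: "f a \<in> verts Y" if "a \<in> verts X" for a
    using f that by (auto simp: is_forest_iso_def bij_betw_def)
  have "is_forest_iso (g \<circ> f) X Z"
    unfolding is_forest_iso_def
  proof (intro conjI ballI allI impI)
    show "bij_betw (g \<circ> f) (verts X) (verts Z)"
      using f g by (auto simp: is_forest_iso_def intro: bij_betw_trans)
    show "((g \<circ> f) a, (g \<circ> f) b) \<in> below Z \<longleftrightarrow> (a, b) \<in> below X"
      if "a \<in> verts X" "b \<in> verts X" for a b
      using f g fv that by (simp add: is_forest_iso_def)
    show "vdec Z ((g \<circ> f) a) = vdec X a" if "a \<in> verts X" for a
      using f g fv that by (simp add: is_forest_iso_def)
    show "edec Z ((g \<circ> f) b) ((g \<circ> f) a) = edec X b a" if c: "covered_by X a b" for a b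
    proof -
      have ab: "a \<in> verts X" "b \<in> verts X"
        using covered_byD[OF c] is_forestD(2)[OF X] by auto
      have "covered_by Y (f a) (f b)"
        using is_forest_iso_covered[OF X Y f ab] c by simp
      then show ?thesis
        using f g c by (simp add: is_forest_iso_def)
    qed
  qed
  then show ?thesis by (auto simp: forest_iso_def)
qed

lemma nat_copy_exists:
  fixes X :: "('v, 'p, 'e) dforest"
  assumes X: "is_forest X"
  shows "\<exists>Y :: (nat, 'p, 'e) dforest. is_forest Y \<and> forest_iso X Y"
proof -
  obtain f :: "'v \<Rightarrow> nat" where inj: "inj_on f (verts X)"
    using finite_imp_inj_to_nat_seg[OF is_forestD(1)[OF X]] by blast
  define g where "g = inv_into (verts X) f"
  have g: "g (f a) = a" if "a \<in> verts X" for a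
    using inj that by (simp add: g_def)
  define Y :: "(nat, 'p, 'e) dforest" where
    "Y = \<lparr>verts = f ` verts X, below = map_prod f f ` below X, vdec = vdec X \<circ> g,
          edec = (\<lambda>b a. edec X (g b) (g a))\<rparr>"
  note XD = is_forestD[OF X]
  have le: "(f a, f b) \<in> below Y \<longleftrightarrow> (a, b) \<in> below X" if "a \<in> verts X" "b \<in> verts X" for a b
  proof
    assume "(f a, f b) \<in> below Y"
    then obtain a' b' where ab: "(a', b') \<in> below X" "f a = f a'" "f b = f b'"
      by (auto simp: Y_def)
    moreover have "a' \<in> verts X" "b' \<in> verts X" using ab(1) XD(2) by blast+
    ultimately show "(a, b) \<in> below X" using inj_onD[OF inj] that by metis
  next
    assume "(a, b) \<in> below X"
    then show "(f a, f b) \<in> below Y" by (force simp: Y_def)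
  qed
  have bY: "below Y \<subseteq> verts Y \<times> verts Y"
    using XD(2) by (auto simp: Y_def)
  have bij: "bij_betw f (verts X) (verts Y)"
    using inj by (auto simp: Y_def bij_betw_def)
  have cov: "covered_by Y (f a) (f b) \<longleftrightarrow> covered_by X a b" if "a \<in> verts X" "b \<in> verts X" for a b
    by (rule covered_by_transport[OF XD(2) bY bij le that])
  have vY: "\<exists>a'\<in>verts X. a = f a'" if "a \<in> verts Y" for a
    using that by (auto simp: Y_def)
  have "is_forest Y"
  proof (rule is_forestI)
    show "finite (verts Y)" using XD(1) by (simp add: Y_def)
    show "(a, a) \<in> below Y" if "a \<in> verts Y" for a
      using vY[OF that] le XD(3) by auto
    show "(a, c) \<in> below Y" if h: "(a, b) \<in> below Y" "(b, c) \<in> below Y" for a b c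
    proof -
      have "a \<in> verts Y" "b \<in> verts Y" "c \<in> verts Y" using h bY by auto
      then obtain a' b' c' where v: "a' \<in> verts X" "b' \<in> verts X" "c' \<in> verts X"
        and eq: "a = f a'" "b = f b'" "c = f c'"
        using vY by meson
      have "(a', b') \<in> below X" "(b', c') \<in> below X"
        using h le v unfolding eq by simp_all
      then have "(a', c') \<in> below X" by (rule XD(4))
      then show ?thesis using le v unfolding eq by simp
    qed
    show "a = b" if h: "(a, b) \<in> below Y" "(b, a) \<in> below Y" for a b
    proof -
      have "a \<in> verts Y" "b \<in> verts Y" using h bY by auto
      then obtain a' b' where v: "a' \<in> verts X" "b' \<in> verts X" and eq: "a = f a'" "b = f b'"
        using vY by meson
      have "(a', b') \<in> below X" "(b', a') \<in> below X"
        using h le v unfolding eq by simp_all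
      then have "a' = b'" by (rule XD(5))
      then show ?thesis unfolding eq by simp
    qed
    show "b = c" if h: "covered_by Y a b" "covered_by Y a c" for a b c
    proof -
      have "a \<in> verts Y" "b \<in> verts Y" "c \<in> verts Y"
        using h[THEN covered_byD] bY by auto
      then obtain a' b' c' where v: "a' \<in> verts X" "b' \<in> verts X" "c' \<in> verts X"
        and eq: "a = f a'" "b = f b'" "c = f c'"
        using vY by meson
      have "covered_by X a' b'" "covered_by X a' c'"
        using h cov v unfolding eq by simp_all
      then have "b' = c'" by (rule XD(6))
      then show ?thesis unfolding eq by simp
    qed
  qed (rule bY)
  moreover have "is_forest_iso f X Y"
    unfolding is_forest_iso_def
  proof (intro conjI ballI allI impI)
    show "edec Y (f b) (f a) = edec X b a" if "covered_by X a b" for a b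
      using covered_byD[OF that] XD(2) g by (auto simp: Y_def)
  qed (use bij le g in \<open>auto simp: Y_def\<close>)
  ultimately show ?thesis by (auto simp: forest_iso_def)
qed

lemma iso_class_eq_iff:
  assumes X: "is_forest X" and Y: "is_forest Y"
  shows "iso_class X = iso_class Y \<longleftrightarrow> forest_iso X Y"
proof
  assume eq: "iso_class X = iso_class Y"
  obtain Z :: "(nat, 'b, 'c) dforest" where Z: "is_forest Z" "forest_iso X Z"
    using nat_copy_exists[OF X] by blast
  then have "forest_iso Y Z" using eq by (auto simp: iso_class_def)
  then have "forest_iso Z Y" by (rule forest_iso_sym[OF Y Z(1)])
  with Z X show "forest_iso X Y" using forest_iso_trans by blast
next
  assume XY: "forest_iso X Y"
  then have YX: "forest_iso Y X" by (rule forest_iso_sym[OF X Y])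
  have "forest_iso X Z \<longleftrightarrow> forest_iso Y Z" for Z :: "(nat, 'b, 'c) dforest"
    using forest_iso_trans[OF X Y XY, of Z] forest_iso_trans[OF Y X YX, of Z] by (rule iffI[rotated])
  then show "iso_class X = iso_class Y"
    by (simp add: iso_class_def)
qed

lemma iso_class_in_forest:
  assumes X: "is_forest X"
  shows "iso_class X \<in> {iso_class X | X :: (nat, 'p, 'e) dforest. is_forest X}"
proof -
  obtain Z :: "(nat, 'p, 'e) dforest" where Z: "is_forest Z" "forest_iso X Z"
    using nat_copy_exists[OF X] by blast
  then have "iso_class X = iso_class Z" using iso_class_eq_iff[OF X Z(1)] by simp
  with Z(1) show ?thesis by (intro CollectI exI[of _ Z] conjI)
qed

lemma forest_of_eq_iff:
  assumes "is_forest X" "is_forest Y"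
  shows "forest_of X = forest_of Y \<longleftrightarrow> forest_iso X Y"
  unfolding forest_of_def
  by (rule trans[OF Abs_forest_inject[OF iso_class_in_forest[OF assms(1)]
        iso_class_in_forest[OF assms(2)]] iso_class_eq_iff[OF assms]])

lemma rep_of_in:
  fixes F :: "('p, 'e) forest"
  shows "rep_of F \<in> Rep_forest F"
proof -
  obtain X :: "(nat, 'p, 'e) dforest" where X: "is_forest X" "Rep_forest F = iso_class X"
    using Rep_forest[of F] by blast
  then have "X \<in> Rep_forest F"
    by (simp add: iso_class_def forest_iso_refl)
  then show ?thesis unfolding rep_of_def by (rule someI)
qed

lemma is_forest_rep_of: "is_forest (rep_of F)"
  using rep_of_in[of F] Rep_forest[of F] by (auto simp: iso_class_def)

lemma forest_of_rep_of:
  fixes F :: "('p, 'e) forest"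
  shows "forest_of (rep_of F) = F"
proof -
  obtain X :: "(nat, 'p, 'e) dforest" where X: "is_forest X" "Rep_forest F = iso_class X"
    using Rep_forest[of F] by blast
  then have "forest_iso X (rep_of F)"
    using rep_of_in[of F] by (simp add: iso_class_def)
  then have "iso_class (rep_of F) = Rep_forest F"
    using iso_class_eq_iff[OF X(1) is_forest_rep_of] X(2) by metis
  then show ?thesis by (simp add: forest_of_def Rep_forest_inverse)
qed

lemma forest_iso_rep_of:
  assumes "is_forest X"
  shows "forest_iso X (rep_of (forest_of X))" "forest_iso (rep_of (forest_of X)) X"
proof -
  have "forest_of X = forest_of (rep_of (forest_of X))"
    by (simp add: forest_of_rep_of)
  then show 1: "forest_iso X (rep_of (forest_of X))"
    using forest_of_eq_iff[OF assms is_forest_rep_of] by blast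
  show "forest_iso (rep_of (forest_of X)) X"
    by (rule forest_iso_sym[OF assms is_forest_rep_of 1])
qed

lemma verts_disj_union [simp]: "verts (disj_union X Y) = Inl ` verts X \<union> Inr ` verts Y"
  by (simp add: disj_union_def)

lemma below_disj_union [simp]:
  "(Inl a, Inl b) \<in> below (disj_union X Y) \<longleftrightarrow> (a, b) \<in> below X"
  "(Inr c, Inr d) \<in> below (disj_union X Y) \<longleftrightarrow> (c, d) \<in> below Y"
  "(Inl a, Inr d) \<notin> below (disj_union X Y)"
  "(Inr c, Inl b) \<notin> below (disj_union X Y)"
  by (auto simp: disj_union_def)

lemma dec_disj_union [simp]:
  "vdec (disj_union X Y) (Inl a) = vdec X a" "vdec (disj_union X Y) (Inr c) = vdec Y c"
  "edec (disj_union X Y) (Inl b) (Inl a) = edec X b a"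
  "edec (disj_union X Y) (Inr d) (Inr c) = edec Y d c"
  by (auto simp: disj_union_def)

lemma all_sum: "(\<forall>x :: 'a + 'b. Q x) \<longleftrightarrow> (\<forall>a. Q (Inl a)) \<and> (\<forall>b. Q (Inr b))"
  by (metis sum.exhaust)

lemma covered_by_disj_union [simp]:
  "covered_by (disj_union X Y) (Inl a) (Inl b) \<longleftrightarrow> covered_by X a b"
  "covered_by (disj_union X Y) (Inr c) (Inr d) \<longleftrightarrow> covered_by Y c d"
  "\<not> covered_by (disj_union X Y) (Inl a) (Inr d)"
  "\<not> covered_by (disj_union X Y) (Inr c) (Inl b)"
  by (auto simp: covered_by_def all_sum)

lemma is_forest_disj_union:
  assumes X: "is_forest X" and Y: "is_forest Y"
  shows "is_forest (disj_union X Y)"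
proof -
  note XD = is_forestD[OF X] and YD = is_forestD[OF Y]
  show ?thesis
  proof (rule is_forestI)
    show "finite (verts (disj_union X Y))" using XD(1) YD(1) by simp
    show "below (disj_union X Y) \<subseteq> verts (disj_union X Y) \<times> verts (disj_union X Y)"
      using XD(2) YD(2) by (auto simp: disj_union_def)
    show "(a, a) \<in> below (disj_union X Y)" if "a \<in> verts (disj_union X Y)" for a
      using that XD(3) YD(3) by auto
    show "(a, c) \<in> below (disj_union X Y)"
      if "(a, b) \<in> below (disj_union X Y)" "(b, c) \<in> below (disj_union X Y)" for a b c
      using that by (cases a; cases b; cases c) (auto intro: XD(4) YD(4))
    show "a = b" if "(a, b) \<in> below (disj_union X Y)" "(b, a) \<in> below (disj_union X Y)" for a b
      using that by (cases a; cases b) (auto intro: XD(5) YD(5))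
    show "b = c" if "covered_by (disj_union X Y) a b" "covered_by (disj_union X Y) a c" for a b c
      using that by (cases a; cases b; cases c) (auto dest: XD(6) YD(6))
  qed
qed

lemma forest_iso_disj_union:
  assumes "forest_iso X X'" "forest_iso Y Y'"
  shows "forest_iso (disj_union X Y) (disj_union X' Y')"
proof -
  obtain f g where f: "is_forest_iso f X X'" and g: "is_forest_iso g Y Y'"
    using assms by (auto simp: forest_iso_def)
  have bij: "bij_betw f (verts X) (verts X')" "bij_betw g (verts Y) (verts Y')"
    using f g by (auto simp: is_forest_iso_def)
  have "inj_on (map_sum f g) (verts (disj_union X Y))"
    using bij[THEN bij_betw_imp_inj_on] by (intro inj_onI) (auto dest: inj_onD)
  moreover have "map_sum f g ` verts (disj_union X Y) = Inl ` f ` verts X \<union> Inr ` g ` verts Y"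
    by (simp add: image_Un image_image)
  then have "map_sum f g ` verts (disj_union X Y) = verts (disj_union X' Y')"
    using bij[THEN bij_betw_imp_surj_on] by simp
  ultimately have "bij_betw (map_sum f g) (verts (disj_union X Y)) (verts (disj_union X' Y'))"
    by (rule bij_betw_imageI)
  then have "is_forest_iso (map_sum f g) (disj_union X Y) (disj_union X' Y')"
    using f g unfolding is_forest_iso_def all_sum by (simp add: ball_Un)
  then show ?thesis by (auto simp: forest_iso_def)
qed

lemma forest_iso_disj_union_commute: "forest_iso (disj_union X Y) (disj_union Y X)"
proof -
  let ?f = "case_sum Inr Inl"
  have "bij_betw ?f (verts (disj_union X Y)) (verts (disj_union Y X))"
  proof (rule bij_betw_imageI)
    show "inj_on ?f (verts (disj_union X Y))"
      by (intro inj_onI) auto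
    show "?f ` verts (disj_union X Y) = verts (disj_union Y X)"
      by (simp add: image_Un image_image Un_commute)
  qed
  then have "is_forest_iso ?f (disj_union X Y) (disj_union Y X)"
    unfolding is_forest_iso_def all_sum by (simp add: ball_Un)
  then show ?thesis by (auto simp: forest_iso_def)
qed

lemma forest_iso_disj_union_assoc:
  "forest_iso (disj_union (disj_union X Y) Z) (disj_union X (disj_union Y Z))"
    (is "forest_iso ?A ?B")
proof -
  let ?f = "case_sum (case_sum Inl (Inr \<circ> Inl)) (Inr \<circ> Inr)"
  have "bij_betw ?f (verts ?A) (verts ?B)"
  proof (rule bij_betw_imageI)
    show "inj_on ?f (verts ?A)"
      by (intro inj_onI) auto
    show "?f ` verts ?A = verts ?B"
      by (simp add: image_Un image_image Un_assoc)
  qed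
  then have "is_forest_iso ?f ?A ?B"
    unfolding is_forest_iso_def all_sum by (simp add: ball_Un)
  then show ?thesis by (auto simp: forest_iso_def)
qed

lemma forest_iso_disj_union_empty: "forest_iso (disj_union empty_dforest X) X"
proof -
  let ?f = "case_sum undefined id"
  have [simp]: "verts empty_dforest = {}" "below empty_dforest = {}"
    by (simp_all add: empty_dforest_def)
  have [simp]: "\<not> covered_by empty_dforest a b" for a b
    by (simp add: covered_by_def)
  have "bij_betw ?f (verts (disj_union empty_dforest X)) (verts X)"
  proof (rule bij_betw_imageI)
    show "inj_on ?f (verts (disj_union empty_dforest X))"
      by (intro inj_onI) auto
    show "?f ` verts (disj_union empty_dforest X) = verts X"
      by (simp add: image_image)
  qed
  then have "is_forest_iso ?f (disj_union empty_dforest X) X"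
    unfolding is_forest_iso_def all_sum by simp
  then show ?thesis by (auto simp: forest_iso_def)
qed

instantiation forest :: (type, type) comm_monoid_add
begin

definition zero_forest :: "('a, 'b) forest" where
  "0 = forest_of empty_dforest"

definition plus_forest :: "('a, 'b) forest \<Rightarrow> ('a, 'b) forest \<Rightarrow> ('a, 'b) forest" where
  "F + G = forest_of (disj_union (rep_of F) (rep_of G))"

lemma forest_of_disj_union:
  assumes X: "is_forest X" and Y: "is_forest Y"
  shows "forest_of X + forest_of Y = forest_of (disj_union X Y)"
  unfolding plus_forest_def
  using X Y
  by (subst forest_of_eq_iff)
    (auto intro!: is_forest_disj_union is_forest_rep_of forest_iso_disj_union forest_iso_rep_of)

instance
proof
  fix F G H :: "('a, 'b) forest"
  note f = is_forest_rep_of is_forest_disj_union is_forest_empty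
  have "forest_of (rep_of F) + forest_of (rep_of G) + forest_of (rep_of H) =
        forest_of (rep_of F) + (forest_of (rep_of G) + forest_of (rep_of H))"
    by (simp add: forest_of_disj_union f forest_of_eq_iff forest_iso_disj_union_assoc)
  then show "F + G + H = F + (G + H)" by (simp add: forest_of_rep_of)
  have "forest_of (rep_of F) + forest_of (rep_of G) = forest_of (rep_of G) + forest_of (rep_of F)"
    by (simp add: forest_of_disj_union f forest_of_eq_iff forest_iso_disj_union_commute)
  then show "F + G = G + F" by (simp add: forest_of_rep_of)
  have "0 + forest_of (rep_of F) = forest_of (rep_of F)"
    by (simp add: zero_forest_def forest_of_disj_union f forest_of_eq_iff forest_iso_disj_union_empty)
  then show "0 + F = F" by (simp add: forest_of_rep_of)
qed

end


section \<open>The bialgebra of decorated forests\<close>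

text \<open>\<open>('p, 'e, 'k) hforest\<close> is spanned by all forests with decorations in \<open>'p\<close> and \<open>'e\<close>; the
  bialgebra of \<open>(P, E)\<close>-forests is its subspace \<open>PE_space P E\<close>.\<close>

type_synonym ('p, 'e, 'k) hforest = "('p, 'e) forest \<Rightarrow>\<^sub>0 'k"

definition PE_forest :: "'p set \<Rightarrow> ('p \<Rightarrow> 'e set) \<Rightarrow> ('v, 'p, 'e) dforest \<Rightarrow> bool" where
  "PE_forest P E X \<longleftrightarrow> is_forest X \<and> (\<forall>a\<in>verts X. vdec X a \<in> P) \<and>
     (\<forall>a b. covered_by X a b \<longrightarrow> edec X b a \<in> E (vdec X b))"

definition PE_space :: "'p set \<Rightarrow> ('p \<Rightarrow> 'e set) \<Rightarrow> ('p, 'e, 'k::comm_ring_1) hforest set" where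
  "PE_space P E = {f. \<forall>F\<in>Poly_Mapping.keys f. PE_forest P E (rep_of F)}"

definition forest_coprod ::
  "('p, 'e, 'k::comm_ring_1) hforest \<Rightarrow> (('p, 'e) forest \<times> ('p, 'e) forest) \<Rightarrow>\<^sub>0 'k" where
  "forest_coprod = lin_ext (\<lambda>F. let X = rep_of F in
     \<Sum>D | downset X D.
       Poly_Mapping.single
         (forest_of (restrict_forest X D), forest_of (restrict_forest X (verts X - D))) 1)"

definition forest_counit :: "('p, 'e, 'k::comm_ring_1) hforest \<Rightarrow> 'k" where
  "forest_counit f = Poly_Mapping.lookup f 0"

definition B_plus :: "'p \<Rightarrow> (('e \<Rightarrow>\<^sub>0 ('p, 'e) forest) \<Rightarrow>\<^sub>0 'k::comm_ring_1) \<Rightarrow> ('p, 'e, 'k) hforest" where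
  "B_plus p = lin_ext (\<lambda>F. Poly_Mapping.single (forest_of (add_root p (\<lambda>e. rep_of (Poly_Mapping.lookup F e)))) 1)"


section \<open>The combinatorial Dyson-Schwinger system\<close>

definition invariant_charge ::
  "'i set \<Rightarrow> ('i \<Rightarrow> 'k::field_char_0) \<Rightarrow> ('i \<Rightarrow> ('p, 'e, 'k) hforest fps) \<Rightarrow> ('p, 'e, 'k) hforest fps" where
  "invariant_charge I s T = fps_X * (\<Prod>j\<in>I. fps_pow (T j) (s j))"

text \<open>The sums over \<open>P i\<close> may be infinite; \<open>has_sum\<close> on power series refers to the \<open>x\<close>-adic
  topology.  Every summand is divisible by \<open>x\<close>, so a solution automatically has \<open>T i $ 0 = 1\<close>,
  as the binomial series require; likewise for \<open>DSE_solution\<close> below.\<close>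

definition combinatorial_DSE_solution ::
  "'i set \<Rightarrow> ('i \<Rightarrow> 'p set) \<Rightarrow> ('p \<Rightarrow> 'e set) \<Rightarrow> ('i \<Rightarrow> 'k::field_char_0) \<Rightarrow> ('p \<Rightarrow> 'e \<Rightarrow> 'k) \<Rightarrow>
     ('p \<Rightarrow> 'e \<Rightarrow> nat) \<Rightarrow> ('i \<Rightarrow> ('p, 'e, 'k) hforest fps) \<Rightarrow> bool" where
  "combinatorial_DSE_solution I P E s u \<alpha> T \<longleftrightarrow>
     (\<forall>i\<in>I. \<forall>n. T i $ n \<in> PE_space (\<Union>j\<in>I. P j) E) \<and>
     (\<forall>i\<in>I. ((\<lambda>p. fps_map (B_plus p)
                (\<Prod>e\<in>E p. fps_map (incl e)
                   (fps_pow (T i) (u p e) * invariant_charge I s T ^ \<alpha> p e)))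
        has_sum (T i - 1)) (P i))"


section \<open>1-cocycles and the Dyson-Schwinger system\<close>

text \<open>\<open>nat \<Rightarrow>\<^sub>0 'k\<close> is the polynomial algebra in \<open>L\<close>, the basis vector \<open>n\<close> being \<open>L\<^sup>n\<close>.\<close>

definition KL_coprod :: "(nat \<Rightarrow>\<^sub>0 'k::comm_ring_1) \<Rightarrow> ((nat \<times> nat) \<Rightarrow>\<^sub>0 'k)" where
  "KL_coprod = lin_ext (\<lambda>n.
     (tensor (Poly_Mapping.single 1 1) 1 + tensor 1 (Poly_Mapping.single 1 1)) ^ n)"

definition KL_deriv :: "(nat \<Rightarrow>\<^sub>0 'k::comm_ring_1) \<Rightarrow> (nat \<Rightarrow>\<^sub>0 'k)" where
  "KL_deriv = lin_ext (\<lambda>n. Poly_Mapping.single (n - 1) (of_nat n))"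

definition KL_vars :: "'e set \<Rightarrow> (('e \<Rightarrow>\<^sub>0 nat) \<Rightarrow>\<^sub>0 'k::comm_ring_1) set" where
  "KL_vars E = {f. \<forall>\<alpha>\<in>Poly_Mapping.keys f. Poly_Mapping.keys \<alpha> \<subseteq> E}"

definition mdeg :: "('e \<Rightarrow>\<^sub>0 nat) \<Rightarrow> nat" where
  "mdeg \<alpha> = (\<Sum>e\<in>Poly_Mapping.keys \<alpha>. Poly_Mapping.lookup \<alpha> e)"

definition KL_coaction :: "(('e \<Rightarrow>\<^sub>0 nat) \<Rightarrow>\<^sub>0 'k::comm_ring_1) \<Rightarrow> ((nat \<times> ('e \<Rightarrow>\<^sub>0 nat)) \<Rightarrow>\<^sub>0 'k)" where
  "KL_coaction = lin_ext (\<lambda>\<alpha>.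
     \<Sum>\<beta> | \<forall>e. Poly_Mapping.lookup \<beta> e \<le> Poly_Mapping.lookup \<alpha> e.
       Poly_Mapping.single (mdeg \<alpha> - mdeg \<beta>, \<beta>)
         (of_nat (\<Prod>e\<in>Poly_Mapping.keys \<alpha>. Poly_Mapping.lookup \<alpha> e choose Poly_Mapping.lookup \<beta> e)))"

definition one_cocycle ::
  "'e set \<Rightarrow> ((('e \<Rightarrow>\<^sub>0 nat) \<Rightarrow>\<^sub>0 'k::comm_ring_1) \<Rightarrow> (nat \<Rightarrow>\<^sub>0 'k)) \<Rightarrow> bool" where
  "one_cocycle E \<Lambda> \<longleftrightarrow>
     (\<forall>f\<in>KL_vars E. \<forall>g\<in>KL_vars E. \<Lambda> (f + g) = \<Lambda> f + \<Lambda> g) \<and>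
     (\<forall>c. \<forall>f\<in>KL_vars E. \<Lambda> (smul c f) = smul c (\<Lambda> f)) \<and>
     (\<forall>f\<in>KL_vars E. KL_coprod (\<Lambda> f) = tensor (\<Lambda> f) 1 + tensor_map id \<Lambda> (KL_coaction f))"

definition DSE_solution ::
  "'i set \<Rightarrow> ('i \<Rightarrow> 'p set) \<Rightarrow> ('p \<Rightarrow> nat) \<Rightarrow> ('p \<Rightarrow> 'e set) \<Rightarrow> ('i \<Rightarrow> 'k::field_char_0) \<Rightarrow>
     ('p \<Rightarrow> 'e \<Rightarrow> 'k) \<Rightarrow> ('p \<Rightarrow> 'e \<Rightarrow> nat) \<Rightarrow> ('p \<Rightarrow> (('e \<Rightarrow>\<^sub>0 nat) \<Rightarrow>\<^sub>0 'k) \<Rightarrow> (nat \<Rightarrow>\<^sub>0 'k)) \<Rightarrow>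
     ('i \<Rightarrow> (nat \<Rightarrow>\<^sub>0 'k) fps) \<Rightarrow> bool" where
  "DSE_solution I P w E s u \<alpha> \<Lambda> G \<longleftrightarrow>
     (\<forall>i\<in>I. ((\<lambda>p. fps_X ^ w p * fps_map (\<Lambda> p)
                (\<Prod>e\<in>E p. fps_pow (fps_map (incl e) (G i)) (u p e) *
                   (\<Prod>j\<in>I. fps_pow (fps_map (incl e) (G j)) (of_nat (\<alpha> p e) * s j))))
        has_sum (G i - 1)) (P i))"

definition anomalous_dim :: "(nat \<Rightarrow>\<^sub>0 'k::comm_ring_1) fps \<Rightarrow> (nat \<Rightarrow>\<^sub>0 'k) fps" where
  "anomalous_dim g = fps_map (\<lambda>f. Poly_Mapping.single 0 (Poly_Mapping.lookup f 1)) g"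

definition beta_function ::
  "'i set \<Rightarrow> ('i \<Rightarrow> 'k::comm_ring_1) \<Rightarrow> ('i \<Rightarrow> (nat \<Rightarrow>\<^sub>0 'k) fps) \<Rightarrow> (nat \<Rightarrow>\<^sub>0 'k) fps" where
  "beta_function I s G =
     (\<Sum>i\<in>I. fps_const (Poly_Mapping.single 0 (s i)) * fps_X * anomalous_dim (G i))"

end

(*
  Both parts go by induction on the order of truncation in x, since the factor x^w in each summand of a
  system gains an order.

  First part: the claim is Delta T_i = (T_i(x) (x) 1) (1 (x) T_i)(Q(x) (x) 1), the second series being
  evaluated at Q(x) (x) 1 in place of x.  Grafting satisfies Delta B = B (x) 1 + (id (x) B) delta with an
  algebra morphism delta, and relations Delta X = (t (x) 1) (1 (x) X)(Q (x) 1) are stable under products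
  and powers.  The argument of B is x^w V, where V satisfies the relation with t = T_i (Q/x)^w by the
  hypotheses on u_e and alpha_e; multiplication by x^w turns this into the relation with t = T_i for x^w V.

  Second part: no trees are needed.  The coefficient of L^1 in the left factor of the cocycle identity gives
  d/dL Lambda(f) = const + Lambda(sum_e d/dL_e f).  The operator d/dL - beta(x) d/dx is a derivation, so
  being an eigenvector of it is stable under products and powers, and the same bookkeeping applies.
*)

theory Submission
  imports Defs
begin

section \<open>Linear maps and monoid algebras\<close>

text \<open>The relation \<Delta>X = (t \<otimes> 1) (1 \<otimes> X)(Q \<otimes> 1) says that
  \<Delta> acts as a weighted composition operator f -> t (f o Q), the way a Riordan array acts on
  series; \<gamma>_i + \<beta>(x) d/dx is the infinitesimal version. This relation is not stable
  under subtracting 1: for T_i - 1 it misses (T_i - 1) \<otimes> 1. Exactly this defect is the sum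
  of the terms B \<otimes> 1 of the cocycle identity. In the second part the constants [L^1]
  \<Lambda>(f) play the same role and sum to \<gamma>_i. Truncation also serves a second purpose.
  Modulo x^n each possibly infinite sum over P_i is a finite one, so grafting and cocycles enter
  through linearity alone. In return every outer operation must respect congruence modulo x^n,
  whence x d/dx in place of d/dx. Powers with arbitrary exponents are controlled by f d(f^a) = a (d
  f) f^a, valid for every such derivation d that kills scalars: d = x d/dx characterises f^a and
  yields the laws of exponents, and d/dL - \<beta>(x) d/dx yields the eigenvalues of powers.\<close>

definition lin :: "(('a \<Rightarrow>\<^sub>0 'k::comm_ring_1) \<Rightarrow> ('b \<Rightarrow>\<^sub>0 'k)) \<Rightarrow> bool" where
  "lin \<phi> \<longleftrightarrow> (\<forall>f g. \<phi> (f + g) = \<phi> f + \<phi> g) \<and> (\<forall>c f. \<phi> (smul c f) = smul c (\<phi> f))"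

lemma lookup_smul [simp]: "Poly_Mapping.lookup (smul c f) k = c * Poly_Mapping.lookup f k"
  by (simp add: smul_def Poly_Mapping.map.rep_eq when_def)

lemma smul_single [simp]: "smul c (Poly_Mapping.single a d) = Poly_Mapping.single a (c * d)"
  by (rule poly_mapping_eqI) (simp add: lookup_single when_def)

lemma smul_one [simp]: "smul 1 f = f"
  by (rule poly_mapping_eqI) simp

lemma smul_zero [simp]: "smul 0 f = 0" "smul c 0 = 0"
  by (rule poly_mapping_eqI, simp)+

lemma smul_add: "smul c (f + g) = smul c f + smul c g" "smul (c + d) f = smul c f + smul d f"
  by (rule poly_mapping_eqI, simp add: lookup_add algebra_simps)+

lemma smul_smul [simp]: "smul c (smul d f) = smul (c * d) f"
  by (rule poly_mapping_eqI) (simp add: mult.assoc)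

lemma smul_conv_mult: "smul c (f :: 'm::comm_monoid_add \<Rightarrow>\<^sub>0 'k::comm_ring_1) = Poly_Mapping.single 0 c * f"
  by (simp add: smul_def mult_map_scale_conv_mult)

lemma smul_mult [simp]:
  fixes f g :: "'m::comm_monoid_add \<Rightarrow>\<^sub>0 'k::comm_ring_1"
  shows "smul c f * g = smul c (f * g)" "f * smul c g = smul c (f * g)"
  by (simp_all add: smul_conv_mult algebra_simps)

lemma smul_sum: "smul c (\<Sum>x\<in>A. f x) = (\<Sum>x\<in>A. smul c (f x))"
  by (rule poly_mapping_eqI) (simp add: lookup_sum sum_distrib_left)

lemma linI:
  "(\<And>f g. \<phi> (f + g) = \<phi> f + \<phi> g) \<Longrightarrow> (\<And>c f. \<phi> (smul c f) = smul c (\<phi> f)) \<Longrightarrow> lin \<phi>"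
  by (simp add: lin_def)

lemma linD:
  assumes "lin \<phi>"
  shows "\<phi> (f + g) = \<phi> f + \<phi> g" "\<phi> (smul c f) = smul c (\<phi> f)" "\<phi> 0 = 0"
    "\<phi> (\<Sum>x\<in>A. h x) = (\<Sum>x\<in>A. \<phi> (h x))"
    "\<phi> (- f) = - \<phi> f" "\<phi> (f - g) = \<phi> f - \<phi> g"
proof -
  show add: "\<phi> (f + g) = \<phi> f + \<phi> g" for f g
    using assms by (simp add: lin_def)
  show "\<phi> (smul c f) = smul c (\<phi> f)"
    using assms by (simp add: lin_def)
  show zero: "\<phi> 0 = 0"
    using add[of 0 0] by simp
  show "\<phi> (\<Sum>x\<in>A. h x) = (\<Sum>x\<in>A. \<phi> (h x))"
    by (induction A rule: infinite_finite_induct) (simp_all add: add zero)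
  show neg: "\<phi> (- f) = - \<phi> f" for f
    using add[of "- f" f] zero by (simp add: eq_neg_iff_add_eq_0)
  show "\<phi> (f - g) = \<phi> f - \<phi> g"
    using add[of f "- g"] neg[of g] by simp
qed

lemma poly_mapping_expand:
  "f = (\<Sum>a\<in>Poly_Mapping.keys f. smul (Poly_Mapping.lookup f a) (Poly_Mapping.single a 1))"
  by (rule poly_mapping_eqI)
     (auto simp: lookup_sum lookup_single when_def in_keys_iff sum.delta)

lemma lin_eq_on:
  assumes "lin \<phi>" "lin \<psi>"
    "\<And>a. a \<in> Poly_Mapping.keys f \<Longrightarrow> \<phi> (Poly_Mapping.single a 1) = \<psi> (Poly_Mapping.single a 1)"
  shows "\<phi> f = \<psi> f"
  using arg_cong[OF poly_mapping_expand, of \<phi> f] arg_cong[OF poly_mapping_expand, of \<psi> f]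
  by (simp add: linD[OF assms(1)] linD[OF assms(2)] assms(3) del: smul_single)

lemma lin_eq:
  assumes "lin \<phi>" "lin \<psi>" "\<And>a. \<phi> (Poly_Mapping.single a 1) = \<psi> (Poly_Mapping.single a 1)"
  shows "\<phi> = \<psi>"
  using lin_eq_on[OF assms(1,2)] assms(3) by blast

text \<open>Linearity in one argument at a time reduces a bilinear identity to pairs of basis
  vectors; multiplicativity, Leibniz rules and tensor identities are all checked this way.\<close>

lemma lin_eq2:
  assumes "\<And>g. lin (\<lambda>f. B f g)" "\<And>f. lin (B f)" "\<And>g. lin (\<lambda>f. C f g)" "\<And>f. lin (C f)"
    and "\<And>a b. B (Poly_Mapping.single a 1) (Poly_Mapping.single b 1) =
      C (Poly_Mapping.single a 1) (Poly_Mapping.single b 1)"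
  shows "B f g = C f g"
proof -
  have "B (Poly_Mapping.single a 1) = C (Poly_Mapping.single a 1)" for a
    by (rule lin_eq) (use assms in auto)
  then show ?thesis
    using fun_cong[OF lin_eq[OF assms(1)[of g] assms(3)[of g]], of f] by auto
qed

named_theorems lin_intros

lemma lin_id [lin_intros]: "lin (\<lambda>f. f)"
  by (rule linI) simp_all

lemma lin_comp: "lin \<phi> \<Longrightarrow> lin \<psi> \<Longrightarrow> lin (\<lambda>f. \<phi> (\<psi> f))"
  by (rule linI) (simp_all add: linD)

lemma lin_add [lin_intros]: "lin \<phi> \<Longrightarrow> lin \<psi> \<Longrightarrow> lin (\<lambda>f. \<phi> f + \<psi> f)"
  by (rule linI) (simp_all add: linD smul_add algebra_simps)

lemma lin_smul [lin_intros]: "lin \<phi> \<Longrightarrow> lin (\<lambda>f. smul c (\<phi> f))"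
  by (rule linI) (simp_all add: linD smul_add mult.commute)

lemma lin_mult_left [lin_intros]:
  fixes g :: "'m::comm_monoid_add \<Rightarrow>\<^sub>0 'k::comm_ring_1"
  shows "lin \<phi> \<Longrightarrow> lin (\<lambda>f. \<phi> f * g)"
  by (rule linI) (simp_all add: linD algebra_simps)

lemma lin_mult_right [lin_intros]:
  fixes g :: "'m::comm_monoid_add \<Rightarrow>\<^sub>0 'k::comm_ring_1"
  shows "lin \<phi> \<Longrightarrow> lin (\<lambda>f. g * \<phi> f)"
  by (rule linI) (simp_all add: linD algebra_simps)

lemma lin_ext_superset:
  assumes "finite A" "Poly_Mapping.keys f \<subseteq> A"
  shows "lin_ext g f = (\<Sum>a\<in>A. smul (Poly_Mapping.lookup f a) (g a))"
  unfolding lin_ext_def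
  by (rule sum.mono_neutral_left) (use assms in \<open>auto simp: in_keys_iff\<close>)

lemma lin_lin_ext [lin_intros]: "lin (lin_ext g)"
proof (rule linI)
  fix f h :: "'a \<Rightarrow>\<^sub>0 'b" and c
  let ?A = "Poly_Mapping.keys f \<union> Poly_Mapping.keys h"
  show "lin_ext g (f + h) = lin_ext g f + lin_ext g h"
    using keys_add[of f h]
    by (simp add: lin_ext_superset[of ?A] lookup_add smul_add sum.distrib)
  have "Poly_Mapping.keys (smul c f) \<subseteq> Poly_Mapping.keys f"
    by (auto simp: in_keys_iff)
  then show "lin_ext g (smul c f) = smul c (lin_ext g f)"
    by (simp add: lin_ext_superset[of "Poly_Mapping.keys f"] smul_sum)
qed

lemma lin_ext_single [simp]: "lin_ext g (Poly_Mapping.single a c) = smul c (g a)"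
  by (simp add: lin_ext_superset[of "{a}"])

lemma lin_ext_one: "lin_ext g 1 = g 0"
  using lin_ext_single[of g 0 1] by simp

lemma lin_alg_hom: "alg_hom \<phi> \<Longrightarrow> lin \<phi>"
  by (simp add: alg_hom_def lin_def)

lemma alg_homD:
  assumes "alg_hom \<phi>"
  shows "\<phi> 1 = 1" "\<phi> (f * g) = \<phi> f * \<phi> g" "\<phi> (f ^ n) = \<phi> f ^ n"
    "\<phi> (\<Prod>x\<in>A. h x) = (\<Prod>x\<in>A. \<phi> (h x))"
    "\<phi> (Poly_Mapping.single 0 c) = Poly_Mapping.single 0 c"
proof -
  show one: "\<phi> 1 = 1" and mult: "\<phi> (f * g) = \<phi> f * \<phi> g" for f g
    using assms by (simp_all add: alg_hom_def)
  show "\<phi> (f ^ n) = \<phi> f ^ n"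
    by (induction n) (simp_all add: one mult)
  show "\<phi> (\<Prod>x\<in>A. h x) = (\<Prod>x\<in>A. \<phi> (h x))"
    by (induction A rule: infinite_finite_induct) (simp_all add: one mult)
  have "\<phi> (smul c 1) = smul c 1"
    using linD(2)[OF lin_alg_hom[OF assms]] one by simp
  then show "\<phi> (Poly_Mapping.single 0 c) = Poly_Mapping.single 0 c"
    by (simp add: smul_conv_mult)
qed

lemma alg_homI:
  assumes lin: "lin \<phi>" and one: "\<phi> (Poly_Mapping.single 0 1) = 1"
    and mult: "\<And>a b. \<phi> (Poly_Mapping.single (a + b) 1) =
      \<phi> (Poly_Mapping.single a 1) * \<phi> (Poly_Mapping.single b 1)"
  shows "alg_hom \<phi>"
proof -
  have "\<phi> (f * g) = \<phi> f * \<phi> g" for f g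
    by (rule lin_eq2[where B = "\<lambda>f g. \<phi> (f * g)" and C = "\<lambda>f g. \<phi> f * \<phi> g"])
       (auto intro!: lin_intros lin lin_comp[OF lin] mult simp: mult_single)
  then show ?thesis
    using linD(1,2)[OF lin] one by (simp add: alg_hom_def)
qed

lemma single_add_one:
  "Poly_Mapping.single (a + b) (1::'k::comm_ring_1) = Poly_Mapping.single a 1 * Poly_Mapping.single b 1"
  by (simp add: mult_single)

lemma alg_hom_comp: "alg_hom \<phi> \<Longrightarrow> alg_hom \<psi> \<Longrightarrow> alg_hom (\<lambda>f. \<phi> (\<psi> f))"
  by (simp add: alg_hom_def)

lemma alg_hom_lin_ext:
  assumes "h 0 = 1" "\<And>a b. h (a + b) = h a * h b"
  shows "alg_hom (lin_ext h)"
  by (rule alg_homI) (simp_all add: assms lin_lin_ext del: single_one)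

lemma derivationI:
  fixes D :: "('m::comm_monoid_add \<Rightarrow>\<^sub>0 'k::comm_ring_1) \<Rightarrow> ('m \<Rightarrow>\<^sub>0 'k)"
  assumes lin: "lin D"
    and "\<And>a b. D (Poly_Mapping.single (a + b) 1) =
      D (Poly_Mapping.single a 1) * Poly_Mapping.single b 1 + Poly_Mapping.single a 1 * D (Poly_Mapping.single b 1)"
  shows "D (f * g) = D f * g + f * D g"
  by (rule lin_eq2[where B = "\<lambda>f g. D (f * g)" and C = "\<lambda>f g. D f * g + f * D g"])
     (auto intro!: lin_intros lin lin_comp[OF lin] assms(2) simp: mult_single)

lemma single_eq_prod:
  "Poly_Mapping.single m (1 :: 'k::comm_ring_1) =
    (\<Prod>v\<in>Poly_Mapping.keys m. Poly_Mapping.single (Poly_Mapping.single v (Poly_Mapping.lookup m v)) 1)"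
proof -
  have "(\<Prod>v\<in>A. Poly_Mapping.single (Poly_Mapping.single v (Poly_Mapping.lookup m v)) (1::'k)) =
      Poly_Mapping.single (\<Sum>v\<in>A. Poly_Mapping.single v (Poly_Mapping.lookup m v)) 1" if "finite A" for A
    using that by (induction A rule: finite_induct) (simp_all add: mult_single)
  moreover have "(\<Sum>v\<in>Poly_Mapping.keys m. Poly_Mapping.single v (Poly_Mapping.lookup m v)) = m"
    by (rule poly_mapping_eqI) (auto simp: lookup_sum lookup_single when_def in_keys_iff sum.delta)
  ultimately show ?thesis by simp
qed

section \<open>Tensor products of vectors, linear maps and algebra morphisms\<close>

lemma tensor_superset:
  assumes "finite A" "Poly_Mapping.keys f \<subseteq> A" "finite B" "Poly_Mapping.keys g \<subseteq> B"
  shows "tensor f g = (\<Sum>a\<in>A. \<Sum>b\<in>B.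
     Poly_Mapping.single (a, b) (Poly_Mapping.lookup f a * Poly_Mapping.lookup g b))"
proof -
  have "tensor f g = (\<Sum>a\<in>A. \<Sum>b\<in>Poly_Mapping.keys g.
     Poly_Mapping.single (a, b) (Poly_Mapping.lookup f a * Poly_Mapping.lookup g b))"
    unfolding tensor_def
    by (rule sum.mono_neutral_left) (use assms in \<open>auto simp: in_keys_iff\<close>)
  also have "\<dots> = (\<Sum>a\<in>A. \<Sum>b\<in>B.
     Poly_Mapping.single (a, b) (Poly_Mapping.lookup f a * Poly_Mapping.lookup g b))"
    by (intro sum.cong refl sum.mono_neutral_left) (use assms in \<open>auto simp: in_keys_iff\<close>)
  finally show ?thesis .
qed

lemma lookup_tensor: "Poly_Mapping.lookup (tensor f g) (a, b) = Poly_Mapping.lookup f a * Poly_Mapping.lookup g b"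
proof -
  have "tensor f g = (\<Sum>a\<in>insert a (Poly_Mapping.keys f). \<Sum>b\<in>insert b (Poly_Mapping.keys g).
     Poly_Mapping.single (a, b) (Poly_Mapping.lookup f a * Poly_Mapping.lookup g b))"
    by (rule tensor_superset) auto
  also have "Poly_Mapping.lookup \<dots> (a, b) = (\<Sum>a'\<in>insert a (Poly_Mapping.keys f). if a' = a then
      \<Sum>b'\<in>insert b (Poly_Mapping.keys g). if b' = b then Poly_Mapping.lookup f a * Poly_Mapping.lookup g b else 0 else 0)"
    by (simp only: lookup_sum) (intro sum.cong refl, auto simp: lookup_single when_def intro!: sum.cong sum.neutral)
  also have "\<dots> = Poly_Mapping.lookup f a * Poly_Mapping.lookup g b"
    by (simp only: sum.delta finite_insert finite_keys insert_iff simp_thms if_True)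
  finally show ?thesis .
qed

lemma lin_tensor_left [lin_intros]: "lin \<phi> \<Longrightarrow> lin (\<lambda>f. tensor (\<phi> f) g)"
  by (rule linI; rule poly_mapping_eqI)
     (auto simp: lookup_tensor lookup_add linD algebra_simps split: prod.splits)

lemma lin_tensor_right [lin_intros]: "lin \<phi> \<Longrightarrow> lin (\<lambda>f. tensor g (\<phi> f))"
  by (rule linI; rule poly_mapping_eqI)
     (auto simp: lookup_tensor lookup_add linD algebra_simps split: prod.splits)

lemma tensor_single [simp]:
  "tensor (Poly_Mapping.single a c) (Poly_Mapping.single b d) = Poly_Mapping.single (a, b) (c * d)"
proof (rule poly_mapping_eqI)
  fix k
  show "Poly_Mapping.lookup (tensor (Poly_Mapping.single a c) (Poly_Mapping.single b d)) k =
    Poly_Mapping.lookup (Poly_Mapping.single (a, b) (c * d)) k"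
    by (cases k) (auto simp: lookup_tensor lookup_single when_def)
qed

lemma tensor_mult:
  fixes f f' :: "'a::comm_monoid_add \<Rightarrow>\<^sub>0 'k::comm_ring_1" and g g' :: "'b::comm_monoid_add \<Rightarrow>\<^sub>0 'k"
  shows "tensor f g * tensor f' g' = tensor (f * f') (g * g')"
proof -
  \<comment> \<open>The identity is linear in four arguments: the second pair is treated first, with
    basis vectors in the first pair.\<close>
  have "tensor (Poly_Mapping.single a 1) (Poly_Mapping.single b 1) * tensor f' g' =
      tensor (Poly_Mapping.single a 1 * f') (Poly_Mapping.single b 1 * g')" for a b
    by (rule lin_eq2[where B = "\<lambda>f' g'. tensor (Poly_Mapping.single a 1) (Poly_Mapping.single b 1) * tensor f' g'"])
       (auto intro!: lin_intros simp: mult_single)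
  then show ?thesis
    by - (rule lin_eq2[where B = "\<lambda>f g. tensor f g * tensor f' g'"], auto intro!: lin_intros)
qed

lemma tensor_one: "tensor 1 1 = 1"
  using tensor_single[of 0 1 0 1] by (simp add: zero_prod_def[symmetric])

lemma lin_tensor_map [lin_intros]: "lin (tensor_map \<phi> \<psi>)"
  by (simp add: tensor_map_def lin_lin_ext)

lemma tensor_map_tensor:
  assumes "lin \<phi>" "lin \<psi>"
  shows "tensor_map \<phi> \<psi> (tensor f g) = tensor (\<phi> f) (\<psi> g)"
  by (rule lin_eq2[where B = "\<lambda>f g. tensor_map \<phi> \<psi> (tensor f g)"])
     (use assms in \<open>auto intro!: lin_intros lin_comp[OF lin_lin_ext] simp: tensor_map_def\<close>)

lemma alg_hom_tensor_map:
  assumes "alg_hom \<phi>" "alg_hom \<psi>"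
  shows "alg_hom (tensor_map \<phi> \<psi>)"
  unfolding tensor_map_def
  by (rule alg_hom_lin_ext)
     (auto simp: zero_prod_def plus_prod_def alg_homD[OF assms(1)] alg_homD[OF assms(2)] tensor_one tensor_mult
       single_add_one split: prod.splits)

lemma alg_hom_id: "alg_hom (\<lambda>f. f)"
  by (simp add: alg_hom_def)

lemma alg_hom_tensor_left: "alg_hom (\<lambda>f. tensor f 1)"
  by (rule alg_homI) (auto intro!: lin_intros simp: tensor_one tensor_mult mult_single)

lemma alg_hom_tensor_right: "alg_hom (\<lambda>f. tensor 1 f)"
  by (rule alg_homI) (auto intro!: lin_intros simp: tensor_one tensor_mult mult_single)

lemma alg_hom_incl: "alg_hom (incl e)"
  unfolding incl_def by (rule alg_hom_lin_ext) (simp_all add: mult_single single_add)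

lemma incl_single: "incl e (Poly_Mapping.single m c) = Poly_Mapping.single (Poly_Mapping.single e m) c"
  by (simp add: incl_def)

text \<open>Each monomial is a product of powers of variables. This gives the uniqueness of \<phi>_i
  and reduces the compatibility with coproduct and counit to generators.\<close>

lemma alg_hom_eq:
  fixes \<phi> \<psi> :: "(('v \<Rightarrow>\<^sub>0 nat) \<Rightarrow>\<^sub>0 'k::comm_ring_1) \<Rightarrow> ('b::comm_monoid_add \<Rightarrow>\<^sub>0 'k)"
  assumes "alg_hom \<phi>" "alg_hom \<psi>"
    and "\<And>v. \<phi> (Poly_Mapping.single (Poly_Mapping.single v 1) 1) = \<psi> (Poly_Mapping.single (Poly_Mapping.single v 1) 1)"
  shows "\<phi> = \<psi>"
proof -
  have pow: "Poly_Mapping.single (Poly_Mapping.single v n) (1::'k) = Poly_Mapping.single (Poly_Mapping.single v 1) 1 ^ n" for v :: 'v and n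
  proof (induction n)
    case (Suc n)
    have "Poly_Mapping.single v (Suc n) = Poly_Mapping.single v 1 + Poly_Mapping.single v n"
      by (simp flip: single_add)
    then show ?case
      using Suc by (simp only: single_add_one power_Suc)
  qed simp
  have "\<phi> (Poly_Mapping.single m 1) = \<psi> (Poly_Mapping.single m 1)" for m
    unfolding single_eq_prod[of m] alg_homD(4)[OF assms(1)] alg_homD(4)[OF assms(2)]
    by (subst (1 2) pow) (simp only: alg_homD(3)[OF assms(1)] alg_homD(3)[OF assms(2)] assms(3))
  then show ?thesis
    by (intro lin_eq lin_alg_hom assms)
qed

lemma prod_keys_power_superset:
  fixes m :: "'v \<Rightarrow>\<^sub>0 nat" and g :: "'v \<Rightarrow> 'a::comm_monoid_mult"
  assumes "finite A" "Poly_Mapping.keys m \<subseteq> A"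
  shows "(\<Prod>v\<in>Poly_Mapping.keys m. g v ^ Poly_Mapping.lookup m v) = (\<Prod>v\<in>A. g v ^ Poly_Mapping.lookup m v)"
  by (rule prod.mono_neutral_left) (use assms in \<open>auto simp: in_keys_iff\<close>)

lemma alg_hom_poly_eval: "alg_hom (poly_eval g)"
  unfolding poly_eval_def
proof (rule alg_hom_lin_ext)
  fix a b :: "'a \<Rightarrow>\<^sub>0 nat"
  define A where "A = Poly_Mapping.keys a \<union> Poly_Mapping.keys b"
  have A: "finite A" "Poly_Mapping.keys a \<subseteq> A" "Poly_Mapping.keys b \<subseteq> A" "Poly_Mapping.keys (a + b) \<subseteq> A"
    using keys_add[of a b] by (auto simp: A_def)
  show "(\<Prod>v\<in>Poly_Mapping.keys (a + b). g v ^ Poly_Mapping.lookup (a + b) v) =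
    (\<Prod>v\<in>Poly_Mapping.keys a. g v ^ Poly_Mapping.lookup a v) * (\<Prod>v\<in>Poly_Mapping.keys b. g v ^ Poly_Mapping.lookup b v)"
    unfolding prod_keys_power_superset[OF A(1,2)] prod_keys_power_superset[OF A(1,3)] prod_keys_power_superset[OF A(1,4)]
    by (simp add: lookup_add power_add prod.distrib)
qed simp

lemma poly_eval_var: "poly_eval g (Poly_Mapping.single (Poly_Mapping.single v 1) 1) = g v"
  by (simp add: poly_eval_def)


section \<open>Truncated equality of power series\<close>

text \<open>Congruence modulo x^n, written without subtraction so that it makes sense for any
  coefficient type. Level 0 is vacuous, so inductions on the level start trivially.\<close>

definition fps_cong :: "nat \<Rightarrow> 'a fps \<Rightarrow> 'a fps \<Rightarrow> bool" where
  "fps_cong n f g \<longleftrightarrow> (\<forall>k<n. f $ k = g $ k)"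

lemma fps_cong_refl [simp]: "fps_cong n f f"
  by (simp add: fps_cong_def)

lemma fps_cong_sym: "fps_cong n f g \<Longrightarrow> fps_cong n g f"
  by (simp add: fps_cong_def)

lemma fps_cong_trans [trans]: "fps_cong n f g \<Longrightarrow> fps_cong n g h \<Longrightarrow> fps_cong n f h"
  by (simp add: fps_cong_def)

lemma fps_cong_mono: "fps_cong n f g \<Longrightarrow> m \<le> n \<Longrightarrow> fps_cong m f g"
  by (simp add: fps_cong_def)

lemma fps_eq_by_cong: "(\<And>n. fps_cong n f g) \<Longrightarrow> f = g"
  by (auto simp: fps_cong_def fps_eq_iff)

lemma fps_cong_add: "fps_cong n f g \<Longrightarrow> fps_cong n f' g' \<Longrightarrow> fps_cong n (f + f') (g + g')"
  by (simp add: fps_cong_def)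

lemma fps_cong_diff: "fps_cong n f g \<Longrightarrow> fps_cong n f' g' \<Longrightarrow> fps_cong n (f - f') (g - g')"
  for f g :: "'a::group_add fps"
  by (simp add: fps_cong_def)

lemma fps_cong_mult: "fps_cong n f g \<Longrightarrow> fps_cong n f' g' \<Longrightarrow> fps_cong n (f * f') (g * g')"
  by (simp add: fps_cong_def fps_mult_nth)

lemma fps_cong_power: "fps_cong n f g \<Longrightarrow> fps_cong n (f ^ m) (g ^ m)"
  by (induction m) (simp_all add: fps_cong_mult)

lemma fps_cong_sum: "(\<And>a. a \<in> A \<Longrightarrow> fps_cong n (f a) (g a)) \<Longrightarrow> fps_cong n (\<Sum>a\<in>A. f a) (\<Sum>a\<in>A. g a)"
  by (simp add: fps_cong_def fps_sum_nth)

text \<open>This gain of w orders is what drives both inductions.\<close>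

lemma fps_cong_X_power_mult:
  fixes f g :: "'a::comm_ring_1 fps"
  shows "fps_cong n f g \<Longrightarrow> fps_cong (n + w) (fps_X ^ w * f) (fps_X ^ w * g)"
  by (auto simp: fps_cong_def fps_X_power_mult_nth)

lemma fps_cong_map: "fps_cong n f g \<Longrightarrow> fps_cong n (fps_map h f) (fps_map h g)"
  by (simp add: fps_cong_def fps_map_def)

lemma fps_cong_compose:
  fixes a b :: "'a::comm_ring_1 fps"
  assumes "fps_cong n a b" "fps_cong n f g"
  shows "fps_cong n (a oo f) (b oo g)"
  using assms(1) fps_cong_power[OF assms(2)]
  by (simp add: fps_cong_def fps_compose_nth)

text \<open>The distance of distinct series is 2 to the minus the order of their difference, so
  distance below 2^(-n) forces agreement below x^n. Linear maps then only have to be exchanged with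
  finite sums.\<close>

lemma has_sum_fps_cong:
  fixes S :: "'a::ab_group_add fps"
  assumes "(f has_sum S) A"
  shows "\<exists>F. finite F \<and> F \<subseteq> A \<and> fps_cong n (\<Sum>a\<in>F. f a) S"
proof -
  have "eventually (\<lambda>F. dist (\<Sum>a\<in>F. f a) S < inverse (2 ^ n)) (finite_subsets_at_top A)"
    using assms unfolding has_sum_def by (rule tendstoD) simp
  then obtain F where F: "finite F" "F \<subseteq> A" "dist (\<Sum>a\<in>F. f a) S < inverse (2 ^ n)"
    unfolding eventually_finite_subsets_at_top by blast
  have "fps_cong n (\<Sum>a\<in>F. f a) S"
  \<comment> \<open>Equality is treated apart, since \<open>subdegree 0\<close> is 0 by convention
    and says nothing about the distance.\<close>
  proof (cases "(\<Sum>a\<in>F. f a) = S")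
    case False
    then have "n < subdegree ((\<Sum>a\<in>F. f a) - S)"
      using F(3) by (simp add: dist_fps_def)
    then have "((\<Sum>a\<in>F. f a) - S) $ k = 0" if "k < n" for k
      using that by (intro nth_less_subdegree_zero) simp
    then show ?thesis by (simp add: fps_cong_def)
  qed simp
  with F show ?thesis by blast
qed


section \<open>Composition of power series over commutative rings\<close>

text \<open>The library has these laws for integral domains only, and the forest algebra is not an
  instance of that class.\<close>

lemma fps_cong_compose_sum:
  fixes a g :: "'a::comm_ring_1 fps"
  assumes "g $ 0 = 0"
  shows "fps_cong n (a oo g) (\<Sum>i<n. fps_const (a $ i) * g ^ i)"
  unfolding fps_cong_def
proof (intro allI impI)
  fix k assume "k < n"
  \<comment> \<open>As g has no constant term, \<open>g ^ i\<close> has no coefficient at k when i >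
    k, so the sum may be extended up to n.\<close>
  have "(\<Sum>i=0..k. a $ i * g ^ i $ k) = (\<Sum>i<n. a $ i * g ^ i $ k)"
    by (rule sum.mono_neutral_left) (use \<open>k < n\<close> startsby_zero_power_prefix[OF assms] in auto)
  then show "(a oo g) $ k = (\<Sum>i<n. fps_const (a $ i) * g ^ i) $ k"
    by (simp add: fps_compose_nth fps_sum_nth)
qed

text \<open>Modulo x^n both factors are polynomials in c. Products with i + j \<ge> n vanish there
  because c has no constant term, and the remaining triangle is regrouped by i + j.\<close>

lemma compose_mult:
  fixes a b c :: "'a::comm_ring_1 fps"
  assumes c: "c $ 0 = 0"
  shows "(a * b) oo c = (a oo c) * (b oo c)"
proof (rule fps_eq_by_cong)
  fix n
  let ?h = "\<lambda>i j. fps_const (a $ i) * c ^ i * (fps_const (b $ j) * c ^ j)"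
  have high: "fps_cong n (?h i j) 0" if "i + j \<ge> n" for i j
  proof -
    have "?h i j = fps_const (a $ i * b $ j) * c ^ (i + j)"
      by (simp add: power_add algebra_simps flip: fps_const_mult)
    then show ?thesis
      using that startsby_zero_power_prefix[OF c] by (simp add: fps_cong_def)
  qed
  have "fps_cong n ((a oo c) * (b oo c))
      ((\<Sum>i<n. fps_const (a $ i) * c ^ i) * (\<Sum>j<n. fps_const (b $ j) * c ^ j))"
    by (intro fps_cong_mult fps_cong_compose_sum c)
  also have "\<dots> = (\<Sum>(i, j)\<in>{..<n} \<times> {..<n}. ?h i j)"
    by (simp add: sum_product sum.cartesian_product)
  also have "\<dots> = (\<Sum>(i, j)\<in>{(i, j). i + j < n}. ?h i j) +
      (\<Sum>(i, j)\<in>{..<n} \<times> {..<n} - {(i, j). i + j < n}. ?h i j)"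
    by (subst add.commute, rule sum.subset_diff) auto
  also have "fps_cong n \<dots> ((\<Sum>(i, j)\<in>{(i, j). i + j < n}. ?h i j) + (\<Sum>x\<in>{..<n} \<times> {..<n} - {(i, j). i + j < n}. 0))"
    by (intro fps_cong_add fps_cong_refl fps_cong_sum) (use high in auto)
  also have "\<dots> = (\<Sum>(i, j)\<in>{(i, j). i + j < n}. ?h i j)"
    by simp
  also have "\<dots> = (\<Sum>k<n. \<Sum>i\<le>k. ?h i (k - i))"
    by (rule sum.triangle_reindex)
  also have "\<dots> = (\<Sum>k<n. fps_const ((a * b) $ k) * c ^ k)"
  proof (intro sum.cong refl)
    fix k
    have "?h i (k - i) = fps_const (a $ i * b $ (k - i)) * c ^ k" if "i \<le> k" for i
      using that power_add[of c i "k - i"] by (simp add: algebra_simps flip: fps_const_mult)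
    then have "(\<Sum>i\<le>k. ?h i (k - i)) = (\<Sum>i\<le>k. fps_const (a $ i * b $ (k - i)) * c ^ k)"
      by (intro sum.cong) auto
    also have "\<dots> = fps_const (\<Sum>i\<le>k. a $ i * b $ (k - i)) * c ^ k"
      by (simp add: sum_distrib_right fps_eq_iff fps_sum_nth)
    finally show "(\<Sum>i\<le>k. ?h i (k - i)) = fps_const ((a * b) $ k) * c ^ k"
      by (simp add: fps_mult_nth atLeast0AtMost)
  qed
  also have "fps_cong n \<dots> ((a * b) oo c)"
    by (rule fps_cong_sym[OF fps_cong_compose_sum[OF c]])
  finally show "fps_cong n ((a * b) oo c) ((a oo c) * (b oo c))"
    by (rule fps_cong_sym)
qed

lemma compose_power: "c $ 0 = 0 \<Longrightarrow> a ^ n oo c = (a oo c) ^ n"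
  for a c :: "'a::comm_ring_1 fps"
  by (induction n) (simp_all add: compose_mult)

lemma compose_prod: "c $ 0 = 0 \<Longrightarrow> (\<Prod>x\<in>A. a x) oo c = (\<Prod>x\<in>A. a x oo c)"
  for c :: "'a::comm_ring_1 fps"
  by (induction A rule: infinite_finite_induct) (simp_all add: compose_mult)

text \<open>Modulo x^n the outer series is a polynomial in b, and substituting c is a ring morphism
  by \<open>compose_mult\<close>.\<close>

lemma compose_assoc:
  fixes a b c :: "'a::comm_ring_1 fps"
  assumes b: "b $ 0 = 0" and c: "c $ 0 = 0"
  shows "a oo (b oo c) = a oo b oo c"
proof (rule fps_eq_by_cong)
  fix n
  have "fps_cong n (a oo b oo c) ((\<Sum>i<n. fps_const (a $ i) * b ^ i) oo c)"
    by (intro fps_cong_compose fps_cong_compose_sum b fps_cong_refl)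
  also have "\<dots> = (\<Sum>i<n. fps_const (a $ i) * (b oo c) ^ i)"
    by (simp add: fps_compose_sum_distrib compose_mult compose_power c)
  also have "fps_cong n \<dots> (a oo (b oo c))"
    by (rule fps_cong_sym[OF fps_cong_compose_sum]) (simp add: b)
  finally show "fps_cong n (a oo (b oo c)) (a oo b oo c)"
    by (rule fps_cong_sym)
qed


section \<open>Continuous derivations\<close>

text \<open>The third clause is continuity in the strong form that no order is lost. The derivation
  d/dx loses one order, x d/dx none.\<close>

definition derivation :: "('a::comm_ring_1 fps \<Rightarrow> 'a fps) \<Rightarrow> bool" where
  "derivation d \<longleftrightarrow> (\<forall>f g. d (f + g) = d f + d g) \<and> (\<forall>f g. d (f * g) = d f * g + f * d g) \<and>
     (\<forall>n f g. fps_cong n f g \<longrightarrow> fps_cong n (d f) (d g))"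

lemma derivationD:
  assumes "derivation d"
  shows "d (f + g) = d f + d g" "d (f * g) = d f * g + f * d g" "d 0 = 0" "d 1 = 0" "d (f - g) = d f - d g"
    "fps_cong n f g \<Longrightarrow> fps_cong n (d f) (d g)"
    "d (\<Sum>x\<in>A. h x) = (\<Sum>x\<in>A. d (h x))"
    "d (f ^ Suc m) = of_nat (Suc m) * f ^ m * d f"
proof -
  show add: "d (f + g) = d f + d g" and mult: "d (f * g) = d f * g + f * d g" for f g
    using assms by (auto simp: derivation_def)
  show "fps_cong n f g \<Longrightarrow> fps_cong n (d f) (d g)"
    using assms by (auto simp: derivation_def)
  show zero: "d 0 = 0"
    using add[of 0 0] by simp
  show "d 1 = 0"
    using mult[of 1 1] by simp
  show "d (f - g) = d f - d g"
    using add[of "f - g" g] by simp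
  show "d (\<Sum>x\<in>A. h x) = (\<Sum>x\<in>A. d (h x))"
    by (induction A rule: infinite_finite_induct) (simp_all add: add zero)
  show "d (f ^ Suc m) = of_nat (Suc m) * f ^ m * d f"
    by (induction m) (simp_all add: mult algebra_simps)
qed

text \<open>The chain rule: it holds for the polynomials that approximate b o g, and passes to the
  limit by order preservation.\<close>

lemma derivation_compose:
  assumes d: "derivation d" and g: "g $ 0 = 0" and const: "\<And>n. d (fps_const (b $ n)) = 0"
  shows "d (b oo g) = (fps_deriv b oo g) * d g"
proof (rule fps_eq_by_cong)
  fix n
  \<comment> \<open>One term more than the level requires: the derivation removes the term of index
    0, and n terms of the derived series remain.\<close>
  have "fps_cong n (b oo g) (\<Sum>i<Suc n. fps_const (b $ i) * g ^ i)"
    by (rule fps_cong_mono[OF fps_cong_compose_sum[OF g]]) simp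
  then have "fps_cong n (d (b oo g)) (d (\<Sum>i<Suc n. fps_const (b $ i) * g ^ i))"
    by (rule derivationD(6)[OF d])
  also have "\<dots> = (\<Sum>i<n. d (fps_const (b $ Suc i) * g ^ Suc i))"
    unfolding sum.lessThan_Suc_shift derivationD(1)[OF d] derivationD(7)[OF d]
    by (simp add: const del: power_Suc)
  also have "\<dots> = (\<Sum>i<n. fps_const (fps_deriv b $ i) * g ^ i) * d g"
    unfolding sum_distrib_right
  proof (intro sum.cong refl)
    fix i
    show "d (fps_const (b $ Suc i) * g ^ Suc i) = fps_const (fps_deriv b $ i) * g ^ i * d g"
      unfolding derivationD(2)[OF d] derivationD(8)[OF d] const fps_deriv_nth
      by (simp add: fps_of_nat[symmetric] algebra_simps flip: fps_const_mult fps_const_add del: of_nat_Suc)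
  qed
  also have "fps_cong n \<dots> ((fps_deriv b oo g) * d g)"
    by (intro fps_cong_mult fps_cong_refl fps_cong_sym[OF fps_cong_compose_sum[OF g]])
  finally show "fps_cong n (d (b oo g)) ((fps_deriv b oo g) * d g)" .
qed

lemma derivation_X_deriv: "derivation (\<lambda>f :: 'a::comm_ring_1 fps. fps_X * fps_deriv f)"
  unfolding derivation_def
proof (intro conjI allI impI)
  fix n and f g :: "'a fps" assume "fps_cong n f g"
  then show "fps_cong n (fps_X * fps_deriv f) (fps_X * fps_deriv g)"
    by (auto simp: fps_cong_def)
qed (simp_all add: algebra_simps)

lemma derivation_add_mult:
  assumes "derivation d" "derivation d'"
  shows "derivation (\<lambda>f. d f + h * d' f)"
  using assms unfolding derivation_def
  by (auto simp: algebra_simps intro!: fps_cong_add fps_cong_mult)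


section \<open>Binomial series\<close>

abbreviation scal :: "'k::comm_ring_1 \<Rightarrow> ('m::comm_monoid_add \<Rightarrow>\<^sub>0 'k) fps" where
  "scal c \<equiv> fps_const (Poly_Mapping.single 0 c)"

lemma scal_add: "scal (a + b) = scal a + scal b"
  by (simp add: single_add)

lemma scal_mult: "scal (a * b) = scal a * scal b"
  by (simp add: mult_single)

lemma scal_sum: "scal (\<Sum>x\<in>A. h x) = (\<Sum>x\<in>A. scal (h x))"
  by (induction A rule: infinite_finite_induct) (simp_all add: scal_add del: fps_const_add)

lemma fps_pow_nth_0 [simp]: "fps_pow f a $ 0 = 1"
  by (simp add: fps_pow_def)

lemma fps_pow_cong: "fps_cong n f g \<Longrightarrow> fps_cong n (fps_pow f a) (fps_pow g a)"
  unfolding fps_pow_def by (intro fps_cong_compose fps_cong_diff) simp_all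

lemma fps_pow_compose:
  assumes "f $ 0 = 1" "q $ 0 = 0"
  shows "fps_pow (f oo q) a = fps_pow f a oo q"
proof -
  have "(f oo q) - 1 = (f - 1) oo q"
    by (simp add: fps_compose_sub_distrib)
  then show ?thesis
    using assms by (simp add: fps_pow_def compose_assoc)
qed

text \<open>The binomial series solves (1 + x) B' = a B; substituting f - 1 and using the chain rule
  gives this division-free form. The general d allows two uses: the characterisation of powers, and
  the renormalization operator.\<close>

lemma fps_pow_derivation:
  assumes d: "derivation d" and const: "\<And>c. d (scal c) = 0" and f: "f $ 0 = 1"
  shows "f * d (fps_pow f a) = scal a * d f * fps_pow f a"
proof -
  define B :: "('a \<Rightarrow>\<^sub>0 'b) fps" where "B = Abs_fps (\<lambda>n. Poly_Mapping.single 0 (a gchoose n))"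
  have pow: "fps_pow f a = B oo (f - 1)"
    by (simp add: fps_pow_def B_def)
  have f0: "(f - 1) $ 0 = 0"
    using f by simp
  \<comment> \<open>Coefficientwise this is (n+1) (a choose n+1) + n (a choose n) = a (a choose
    n).\<close>
  have "(1 + fps_X) * fps_deriv B = scal a * B"
  proof (rule fps_ext)
    fix n
    have "Poly_Mapping.single (0::'a) (of_nat (Suc n) * (a gchoose Suc n)) + Poly_Mapping.single 0 (of_nat n * (a gchoose n)) =
      Poly_Mapping.single 0 (a * (a gchoose n))"
      by (simp only: gbinomial_mult_1[of a n] single_add add.commute)
    moreover have "((1 + fps_X) * fps_deriv B) $ n =
       of_nat (Suc n) * Poly_Mapping.single 0 (a gchoose Suc n) + of_nat n * Poly_Mapping.single 0 (a gchoose n)"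
      by (cases n) (simp_all add: B_def distrib_right)
    ultimately show "((1 + fps_X) * fps_deriv B) $ n = (scal a * B) $ n"
      by (simp add: B_def mult_single flip: single_of_nat del: of_nat_Suc)
  qed
  then have "((1 + fps_X) oo (f - 1)) * (fps_deriv B oo (f - 1)) = (scal a oo (f - 1)) * (B oo (f - 1))"
    by (metis compose_mult f0)
  then have "f * (fps_deriv B oo (f - 1)) = scal a * fps_pow f a"
    using f by (simp add: fps_compose_add_distrib pow)
  moreover have "d (fps_pow f a) = (fps_deriv B oo (f - 1)) * d f"
    unfolding pow using derivation_compose[OF d f0, of B]
    by (simp add: B_def const derivationD[OF d])
  ultimately show ?thesis
    by (simp add: mult.assoc[symmetric])
qed

text \<open>Torsion is excluded by the scalar field of characteristic 0, which acts on the monoid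
  algebra even if that algebra has zero divisors.\<close>

lemma of_nat_mult_eq_0:
  fixes f :: "'m::comm_monoid_add \<Rightarrow>\<^sub>0 'k::field_char_0"
  assumes "of_nat n * f = 0" "n > 0"
  shows "f = 0"
proof -
  have "smul (inverse (of_nat n)) (smul (of_nat n) f) = 0"
    using assms(1) by (simp only: smul_conv_mult[of "of_nat n"] single_of_nat smul_zero)
  then show ?thesis
    using assms(2) by simp
qed

text \<open>With \<open>x d/dx\<close> in place of \<open>d/dx\<close>, the equation \<open>f F' = a f' F\<close> that characterises
  \<open>F = f\<^sup>a\<close> involves an order-preserving derivation.\<close>

lemma X_deriv_equation_zero:
  fixes f :: "('m::comm_monoid_add \<Rightarrow>\<^sub>0 'k::field_char_0) fps"
  assumes eq: "f * (fps_X * fps_deriv h) = g * h" and f: "f $ 0 = 1" and g: "g $ 0 = 0" and h: "h $ 0 = 0"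
  shows "h = 0"
proof -
  have "h $ n = 0" for n
  proof (induction n rule: less_induct)
    case (less n)
    have X: "(fps_X * fps_deriv h) $ k = of_nat k * h $ k" for k
      by (cases k) simp_all
    \<comment> \<open>Lower coefficients of h vanish by induction, so only n h_n survives on the
      left, while on the right h_n meets g_0 = 0. The case n = 0 is the assumption on h.\<close>
    have "(f * (fps_X * fps_deriv h)) $ n = (\<Sum>i=0..n. if i = 0 then of_nat n * h $ n else 0)"
      unfolding fps_mult_nth[of f] X by (intro sum.cong) (auto simp: f less)
    moreover have "(g * h) $ n = 0"
      unfolding fps_mult_nth
    proof (intro sum.neutral ballI)
      fix i assume "i \<in> {0..n}"
      then show "g $ i * h $ (n - i) = 0"
        by (cases "i = 0") (auto simp: g less)
    qed
    ultimately have "of_nat n * h $ n = 0"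
      using eq by simp
    then show ?case
      by (cases "n = 0") (auto simp: h dest: of_nat_mult_eq_0)
  qed
  then show ?thesis by (simp add: fps_eq_iff)
qed

lemma X_deriv_scal: "fps_X * fps_deriv (scal c) = 0"
  by simp

text \<open>The difference of two solutions solves the homogeneous equation and has constant term 0.
  The laws of exponents that follow are obtained by checking this equation for the proposed
  right-hand side.\<close>

lemma fps_pow_unique:
  fixes f F :: "('m::comm_monoid_add \<Rightarrow>\<^sub>0 'k::field_char_0) fps"
  assumes f: "f $ 0 = 1" and F: "F $ 0 = 1"
    and eq: "f * (fps_X * fps_deriv F) = scal a * (fps_X * fps_deriv f) * F"
  shows "F = fps_pow f a"
proof -
  have "F - fps_pow f a = 0"
  proof (rule X_deriv_equation_zero[where f = f and g = "scal a * (fps_X * fps_deriv f)"])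
    show "f * (fps_X * fps_deriv (F - fps_pow f a)) = scal a * (fps_X * fps_deriv f) * (F - fps_pow f a)"
      using eq fps_pow_derivation[OF derivation_X_deriv X_deriv_scal f, of a]
      by (simp add: algebra_simps)
  qed (use f F in simp_all)
  then show ?thesis by simp
qed

lemma fps_pow_mult:
  assumes f: "f $ 0 = 1" and g: "g $ 0 = 1"
  shows "fps_pow (f * g) a = fps_pow f a * fps_pow g a"
proof (rule fps_pow_unique[symmetric])
  let ?d = "\<lambda>f. fps_X * fps_deriv f"
  note d = fps_pow_derivation[OF derivation_X_deriv X_deriv_scal]
  have "(f * g) * ?d (fps_pow f a * fps_pow g a) =
      (f * ?d (fps_pow f a)) * g * fps_pow g a + f * fps_pow f a * (g * ?d (fps_pow g a))"
    by (simp add: algebra_simps)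
  also have "\<dots> = scal a * ?d (f * g) * (fps_pow f a * fps_pow g a)"
    unfolding d[OF f] d[OF g] by (simp add: algebra_simps)
  finally show "(f * g) * ?d (fps_pow f a * fps_pow g a) = scal a * ?d (f * g) * (fps_pow f a * fps_pow g a)" .
qed (simp_all add: f g)

lemma fps_pow_add:
  assumes f: "f $ 0 = 1"
  shows "fps_pow f (a + b) = fps_pow f a * fps_pow f b"
proof (rule fps_pow_unique[symmetric])
  let ?d = "\<lambda>f. fps_X * fps_deriv f"
  note d = fps_pow_derivation[OF derivation_X_deriv X_deriv_scal f]
  have "f * ?d (fps_pow f a * fps_pow f b) = (f * ?d (fps_pow f a)) * fps_pow f b + fps_pow f a * (f * ?d (fps_pow f b))"
    by (simp add: algebra_simps)
  also have "\<dots> = scal (a + b) * ?d f * (fps_pow f a * fps_pow f b)"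
    unfolding d scal_add by (simp add: algebra_simps del: fps_const_add)
  finally show "f * ?d (fps_pow f a * fps_pow f b) = scal (a + b) * ?d f * (fps_pow f a * fps_pow f b)" .
qed (simp_all add: f)

lemma fps_pow_1: "f $ 0 = 1 \<Longrightarrow> fps_pow f 1 = f"
  by (rule fps_pow_unique[symmetric]) simp_all

lemma fps_pow_0: "f $ 0 = 1 \<Longrightarrow> fps_pow f 0 = 1"
  by (rule fps_pow_unique[symmetric]) simp_all

lemma fps_pow_sum:
  assumes "f $ 0 = 1"
  shows "fps_pow f (\<Sum>x\<in>A. h x) = (\<Prod>x\<in>A. fps_pow f (h x))"
  by (induction A rule: infinite_finite_induct) (simp_all add: assms fps_pow_0 fps_pow_add)


section \<open>Coefficientwise maps\<close>

lemma fps_map_nth [simp]: "fps_map h f $ n = h (f $ n)"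
  by (simp add: fps_map_def)

lemma fps_map_ring_hom:
  assumes "alg_hom \<phi>"
  shows "fps_map \<phi> (f + g) = fps_map \<phi> f + fps_map \<phi> g" "fps_map \<phi> (f - g) = fps_map \<phi> f - fps_map \<phi> g"
    "fps_map \<phi> (f * g) = fps_map \<phi> f * fps_map \<phi> g" "fps_map \<phi> 1 = 1" "fps_map \<phi> fps_X = fps_X"
    "fps_map \<phi> (f ^ m) = fps_map \<phi> f ^ m"
    "fps_map \<phi> (\<Prod>x\<in>A. h x) = (\<Prod>x\<in>A. fps_map \<phi> (h x))"
    "fps_map \<phi> (f oo g) = fps_map \<phi> f oo fps_map \<phi> g"
proof -
  note lin = linD[OF lin_alg_hom[OF assms]]
  show "fps_map \<phi> (f + g) = fps_map \<phi> f + fps_map \<phi> g" "fps_map \<phi> (f - g) = fps_map \<phi> f - fps_map \<phi> g"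
    by (simp_all add: fps_eq_iff lin)
  show mult: "fps_map \<phi> (f * g) = fps_map \<phi> f * fps_map \<phi> g" for f g
    by (simp add: fps_eq_iff lin fps_mult_nth alg_homD[OF assms])
  show one: "fps_map \<phi> 1 = 1" and "fps_map \<phi> fps_X = fps_X"
    by (simp_all add: fps_eq_iff lin alg_homD[OF assms] fps_X_def)
  show pow: "fps_map \<phi> (f ^ m) = fps_map \<phi> f ^ m" for f m
    by (induction m) (simp_all add: mult one)
  show "fps_map \<phi> (\<Prod>x\<in>A. h x) = (\<Prod>x\<in>A. fps_map \<phi> (h x))"
    by (induction A rule: infinite_finite_induct) (simp_all add: mult one)
  show "fps_map \<phi> (f oo g) = fps_map \<phi> f oo fps_map \<phi> g"
    by (simp add: fps_eq_iff fps_compose_nth lin alg_homD(2)[OF assms] flip: pow)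
qed

lemma fps_map_pow:
  assumes "alg_hom \<phi>"
  shows "fps_map \<phi> (fps_pow f a) = fps_pow (fps_map \<phi> f) a"
proof -
  have "fps_map \<phi> (Abs_fps (\<lambda>n. Poly_Mapping.single 0 (a gchoose n))) = Abs_fps (\<lambda>n. Poly_Mapping.single 0 (a gchoose n))"
    by (simp add: fps_eq_iff alg_homD(5)[OF assms])
  then show ?thesis
    by (simp add: fps_pow_def fps_map_ring_hom[OF assms])
qed

lemma fps_map_comp: "fps_map \<phi> (fps_map \<psi> f) = fps_map (\<lambda>x. \<phi> (\<psi> x)) f"
  by (simp add: fps_eq_iff)

lemma fps_map_lin:
  assumes "lin \<phi>"
  shows "fps_map \<phi> (f + g) = fps_map \<phi> f + fps_map \<phi> g" "fps_map \<phi> (f - g) = fps_map \<phi> f - fps_map \<phi> g"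
    "fps_map \<phi> (\<Sum>x\<in>A. h x) = (\<Sum>x\<in>A. fps_map \<phi> (h x))"
  by (simp_all add: fps_eq_iff linD[OF assms] fps_sum_nth)

lemma fps_map_X_power:
  fixes f :: "('m::comm_monoid_add \<Rightarrow>\<^sub>0 'k::comm_ring_1) fps" and \<phi> :: "_ \<Rightarrow> ('n::comm_monoid_add \<Rightarrow>\<^sub>0 'k)"
  assumes "lin \<phi>"
  shows "fps_map \<phi> (fps_X ^ w * f) = fps_X ^ w * fps_map \<phi> f"
  by (simp add: fps_eq_iff fps_X_power_mult_nth linD[OF assms])


section \<open>Subalgebras\<close>

text \<open>Instances are the forests with admissible decorations and the polynomials in the L_e
  with e in E. Scalars are included so that binomial series stay inside.\<close>

definition subalg :: "('m::comm_monoid_add \<Rightarrow>\<^sub>0 'k::comm_ring_1) set \<Rightarrow> bool" where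
  "subalg A \<longleftrightarrow> (\<forall>c. Poly_Mapping.single 0 c \<in> A) \<and> (\<forall>f\<in>A. \<forall>g\<in>A. f + g \<in> A \<and> f * g \<in> A)"

definition fps_over :: "'a set \<Rightarrow> 'a fps set" where
  "fps_over A = {f. \<forall>n. f $ n \<in> A}"

lemma subalgD:
  assumes "subalg A"
  shows "Poly_Mapping.single 0 c \<in> A" "0 \<in> A" "1 \<in> A" "f \<in> A \<Longrightarrow> g \<in> A \<Longrightarrow> f + g \<in> A"
    "f \<in> A \<Longrightarrow> g \<in> A \<Longrightarrow> f * g \<in> A" "f \<in> A \<Longrightarrow> smul c f \<in> A"
    "f \<in> A \<Longrightarrow> g \<in> A \<Longrightarrow> f - g \<in> A" "(\<And>x. x \<in> X \<Longrightarrow> h x \<in> A) \<Longrightarrow> (\<Sum>x\<in>X. h x) \<in> A"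
proof -
  show const: "Poly_Mapping.single 0 c \<in> A" for c
    using assms by (simp add: subalg_def)
  show zero: "0 \<in> A" and "1 \<in> A"
    using const[of 0] const[of 1] by simp_all
  show add: "f \<in> A \<Longrightarrow> g \<in> A \<Longrightarrow> f + g \<in> A" and "f \<in> A \<Longrightarrow> g \<in> A \<Longrightarrow> f * g \<in> A" for f g
    using assms by (simp_all add: subalg_def)
  show smul: "f \<in> A \<Longrightarrow> smul c f \<in> A" for f c
    using assms const by (simp add: subalg_def smul_conv_mult)
  have "f - g = f + smul (- 1) g" for f g :: "'a \<Rightarrow>\<^sub>0 'b"
    by (rule poly_mapping_eqI) (simp add: lookup_add lookup_minus)
  then show "f \<in> A \<Longrightarrow> g \<in> A \<Longrightarrow> f - g \<in> A"
    using add smul by metis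
  show "(\<And>x. x \<in> X \<Longrightarrow> h x \<in> A) \<Longrightarrow> (\<Sum>x\<in>X. h x) \<in> A"
    by (induction X rule: infinite_finite_induct) (simp_all add: zero add)
qed

lemma fps_overD:
  assumes "subalg A"
  shows "1 \<in> fps_over A" "fps_X \<in> fps_over A"
    "f \<in> fps_over A \<Longrightarrow> g \<in> fps_over A \<Longrightarrow> f * g \<in> fps_over A"
    "f \<in> fps_over A \<Longrightarrow> f ^ m \<in> fps_over A"
    "(\<And>x. x \<in> X \<Longrightarrow> h x \<in> fps_over A) \<Longrightarrow> (\<Prod>x\<in>X. h x) \<in> fps_over A"
    "f \<in> fps_over A \<Longrightarrow> fps_pow f a \<in> fps_over A"
proof -
  note A = subalgD[OF assms]
  show one: "1 \<in> fps_over A" and "fps_X \<in> fps_over A"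
    by (auto simp: fps_over_def A fps_X_def)
  show mult: "f \<in> fps_over A \<Longrightarrow> g \<in> fps_over A \<Longrightarrow> f * g \<in> fps_over A" for f g
    by (auto simp: fps_over_def fps_mult_nth A)
  show pow: "f \<in> fps_over A \<Longrightarrow> f ^ m \<in> fps_over A" for f m
    by (induction m) (simp_all add: one mult)
  show "(\<And>x. x \<in> X \<Longrightarrow> h x \<in> fps_over A) \<Longrightarrow> (\<Prod>x\<in>X. h x) \<in> fps_over A"
    by (induction X rule: infinite_finite_induct) (simp_all add: one mult)
  assume "f \<in> fps_over A"
  then have "(f - 1) ^ m \<in> fps_over A" for m
    by (intro pow) (auto simp: fps_over_def A)
  then show "fps_pow f a \<in> fps_over A"
    unfolding fps_over_def fps_pow_def by (auto simp: fps_compose_nth intro!: A(5,8) A(1))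
qed


section \<open>The bialgebra structure of forests\<close>

lemma restrict_forest_simps [simp]:
  "verts (restrict_forest X S) = S" "below (restrict_forest X S) = below X \<inter> S \<times> S"
  "vdec (restrict_forest X S) = vdec X" "edec (restrict_forest X S) = edec X"
  by (simp_all add: restrict_forest_def)

text \<open>Order-convexity is what the two halves of a cut have in common. Restriction to a convex
  set creates no new covering pairs, so the result is again a forest and its edge decorations keep
  their meaning.\<close>

definition convex_in :: "('v, 'p, 'e) dforest \<Rightarrow> 'v set \<Rightarrow> bool" where
  "convex_in X S \<longleftrightarrow> S \<subseteq> verts X \<and> (\<forall>a b c. a \<in> S \<and> b \<in> S \<and> (a, c) \<in> below X \<and> (c, b) \<in> below X \<longrightarrow> c \<in> S)"

lemma convex_in_downset: "downset X D \<Longrightarrow> convex_in X D"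
  unfolding convex_in_def downset_def by blast

lemma convex_in_upset: "is_forest X \<Longrightarrow> downset X D \<Longrightarrow> convex_in X (verts X - D)"
  unfolding convex_in_def downset_def using is_forestD(2) by fastforce

lemma covered_by_restrict:
  assumes "convex_in X S"
  shows "covered_by (restrict_forest X S) a b \<longleftrightarrow> covered_by X a b \<and> a \<in> S \<and> b \<in> S"
proof -
  have "c \<in> S" if "a \<in> S" "b \<in> S" "(a, c) \<in> below X" "(c, b) \<in> below X" for c
    using assms that unfolding convex_in_def by blast
  then show ?thesis
    unfolding covered_by_def restrict_forest_simps by blast
qed

lemma is_forest_restrict:
  assumes X: "is_forest X" and S: "convex_in X S"
  shows "is_forest (restrict_forest X S)"
proof (rule is_forestI)
  note XD = is_forestD[OF X]
  have SX: "S \<subseteq> verts X"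
    using S by (simp add: convex_in_def)
  show "finite (verts (restrict_forest X S))"
    using finite_subset[OF SX XD(1)] by simp
  show "b = c" if "covered_by (restrict_forest X S) a b" "covered_by (restrict_forest X S) a c" for a b c
    using that XD(6)[of a b c] by (simp add: covered_by_restrict[OF S])
  show "(a, a) \<in> below (restrict_forest X S)" if "a \<in> verts (restrict_forest X S)" for a
    using that XD(3)[of a] SX by auto
  show "(a, c) \<in> below (restrict_forest X S)"
    if "(a, b) \<in> below (restrict_forest X S)" "(b, c) \<in> below (restrict_forest X S)" for a b c
    using that XD(4)[of a b c] by simp
  show "a = b" if "(a, b) \<in> below (restrict_forest X S)" "(b, a) \<in> below (restrict_forest X S)" for a b
    using that XD(5)[of a b] by simp
qed simp

lemma is_forest_iso_restrict:
  assumes X: "is_forest X" and f: "is_forest_iso f X Y" and S: "convex_in X S"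
  shows "is_forest_iso f (restrict_forest X S) (restrict_forest Y (f ` S))"
proof -
  have SX: "S \<subseteq> verts X"
    using S by (simp add: convex_in_def)
  have "inj_on f (verts X)"
    using f by (simp add: is_forest_iso_def bij_betw_def)
  then have "bij_betw f S (f ` S)"
    using SX by (simp add: bij_betw_def inj_on_subset)
  then show ?thesis
    using f unfolding is_forest_iso_def covered_by_restrict[OF S]
    by (simp add: subsetD[OF SX])
qed

lemma downset_iso:
  assumes X: "is_forest X" and Y: "is_forest Y" and f: "is_forest_iso f X Y"
  shows "bij_betw ((`) f) {D. downset X D} {D. downset Y D}"
proof (rule bij_betw_imageI)
  have bij: "bij_betw f (verts X) (verts Y)"
    and le: "\<And>a b. a \<in> verts X \<Longrightarrow> b \<in> verts X \<Longrightarrow> (f a, f b) \<in> below Y \<longleftrightarrow> (a, b) \<in> below X"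
    using f by (auto simp: is_forest_iso_def)
  show "inj_on ((`) f) {D. downset X D}"
    by (rule inj_on_subset[OF inj_on_image_Pow[OF bij_betw_imp_inj_on[OF bij]]]) (auto simp: downset_def)
  show "(`) f ` {D. downset X D} = {D. downset Y D}"
  proof (intro equalityI subsetI)
    fix D' assume "D' \<in> (`) f ` {D. downset X D}"
    then obtain D where D: "downset X D" "D' = f ` D"
      by blast
    have "downset Y D'"
      unfolding downset_def
    proof (intro conjI ballI allI impI)
      show "D' \<subseteq> verts Y"
        using D bij_betw_imp_surj_on[OF bij] by (auto simp: downset_def)
      fix b a assume b: "b \<in> D'" and ab: "(a, b) \<in> below Y"
      then obtain b' where b': "b' \<in> D" "b = f b'"
        using D by blast
      have "a \<in> verts Y"
        using ab is_forestD(2)[OF Y] by blast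
      then obtain a' where a': "a' \<in> verts X" "a = f a'"
        using bij by (auto simp: bij_betw_def)
      then show "a \<in> D'"
        using D b' ab le by (auto simp: downset_def)
    qed
    then show "D' \<in> {D. downset Y D}" by simp
  next
    fix D' assume "D' \<in> {D. downset Y D}"
    then have D': "downset Y D'" by simp
    define D where "D = {a \<in> verts X. f a \<in> D'}"
    have "f ` D = D'"
      using D' bij by (auto simp: D_def downset_def bij_betw_def)
    moreover have "downset X D"
      using D' le is_forestD(2)[OF X] unfolding D_def downset_def by blast
    ultimately show "D' \<in> (`) f ` {D. downset X D}"
      by blast
  qed
qed

lemma finite_downsets: "is_forest X \<Longrightarrow> finite {D. downset X D}"
  by (rule finite_subset[of _ "Pow (verts X)"]) (auto simp: downset_def dest: is_forestD(1))

section \<open>The coproduct on isomorphism classes and on disjoint unions\<close>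

definition cut :: "('v, 'p, 'e) dforest \<Rightarrow> 'v set \<Rightarrow> (('p, 'e) forest \<times> ('p, 'e) forest) \<Rightarrow>\<^sub>0 'k::comm_ring_1" where
  "cut X D = Poly_Mapping.single (forest_of (restrict_forest X D), forest_of (restrict_forest X (verts X - D))) 1"

text \<open>The coproduct of a concrete forest with vertices of any type. It can be computed
  directly on disjoint unions and grafted trees, whose vertices are not natural numbers, and
  \<open>cut_sum_iso\<close> carries the result to the chosen representatives.\<close>

definition cut_sum :: "('v, 'p, 'e) dforest \<Rightarrow> (('p, 'e) forest \<times> ('p, 'e) forest) \<Rightarrow>\<^sub>0 'k::comm_ring_1" where
  "cut_sum X = (\<Sum>D | downset X D. cut X D)"

lemma cut_sum_iso:
  assumes X: "is_forest X" and Y: "is_forest Y" and "forest_iso X Y"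
  shows "cut_sum X = (cut_sum Y :: _ \<Rightarrow>\<^sub>0 'k::comm_ring_1)"
proof -
  obtain f where f: "is_forest_iso f X Y"
    using assms(3) by (auto simp: forest_iso_def)
  have bij: "bij_betw f (verts X) (verts Y)"
    using f by (simp add: is_forest_iso_def)
  have "cut_sum Y = (\<Sum>D | downset X D. cut Y (f ` D) :: _ \<Rightarrow>\<^sub>0 'k)"
    unfolding cut_sum_def by (rule sum.reindex_bij_betw[OF downset_iso[OF X Y f], symmetric])
  also have "\<dots> = cut_sum X"
    unfolding cut_sum_def
  proof (intro sum.cong refl)
    fix D assume "D \<in> {D. downset X D}"
    then have D: "downset X D" by simp
    then have "f ` D \<in> {D. downset Y D}"
      using downset_iso[OF X Y f] by (auto simp: bij_betw_def)
    then have fD: "downset Y (f ` D)" by simp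
    have DX: "D \<subseteq> verts X"
      using D by (simp add: downset_def)
    have diff: "f ` (verts X - D) = verts Y - f ` D"
      using inj_on_image_set_diff[OF bij_betw_imp_inj_on[OF bij] Diff_subset DX]
      by (simp add: bij_betw_imp_surj_on[OF bij])
    have "forest_of (restrict_forest X S) = forest_of (restrict_forest Y (f ` S))"
      if S: "convex_in X S" and fS: "convex_in Y (f ` S)" for S
      using is_forest_iso_restrict[OF X f S]
      by (subst forest_of_eq_iff) (auto simp: forest_iso_def intro: is_forest_restrict X Y S fS)
    then show "cut Y (f ` D) = (cut X D :: _ \<Rightarrow>\<^sub>0 'k)"
      using D fD diff by (simp add: cut_def convex_in_downset convex_in_upset X Y)
  qed
  finally show ?thesis ..
qed

lemma forest_coprod_basis: "forest_coprod (Poly_Mapping.single F 1) = cut_sum (rep_of F)"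
  by (simp add: forest_coprod_def cut_sum_def cut_def Let_def)

lemma forest_coprod_forest_of:
  assumes "is_forest X"
  shows "forest_coprod (Poly_Mapping.single (forest_of X) 1) = cut_sum X"
  unfolding forest_coprod_basis
  by (rule cut_sum_iso[OF is_forest_rep_of assms forest_iso_rep_of(2)[OF assms]])

lemma forest_of_no_verts:
  assumes "is_forest X" "verts X = {}"
  shows "forest_of X = 0"
proof -
  have "below X = {}"
    using is_forestD(2)[OF assms(1)] assms(2) by auto
  then have "is_forest_iso (\<lambda>_. 0) X empty_dforest"
    using assms(2) by (auto simp: is_forest_iso_def empty_dforest_def bij_betw_def covered_by_def)
  then show ?thesis
    unfolding zero_forest_def by (subst forest_of_eq_iff) (auto simp: forest_iso_def assms(1) is_forest_empty)
qed

lemma verts_rep_of_0: "verts (rep_of 0) = {}"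
proof -
  have "forest_iso empty_dforest (rep_of (forest_of empty_dforest))"
    by (rule forest_iso_rep_of[OF is_forest_empty])
  then show ?thesis
    by (auto simp: zero_forest_def forest_iso_def is_forest_iso_def empty_dforest_def bij_betw_def)
qed

lemma forest_of_eq_0_iff:
  assumes "is_forest X"
  shows "forest_of X = 0 \<longleftrightarrow> verts X = {}"
proof
  assume "forest_of X = 0"
  then have "forest_iso X empty_dforest"
    using forest_of_eq_iff[OF assms is_forest_empty] by (simp add: zero_forest_def)
  then show "verts X = {}"
    by (auto simp: forest_iso_def is_forest_iso_def empty_dforest_def bij_betw_def)
qed (rule forest_of_no_verts[OF assms])

text \<open>Because the empty forest cannot be a product of nonempty ones, the coefficient at the
  empty forest is multiplicative.\<close>

lemma forest_add_eq_0_iff: "F + G = 0 \<longleftrightarrow> F = 0 \<and> G = (0 :: ('p, 'e) forest)"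
proof
  assume "F + G = 0"
  then have "verts (disj_union (rep_of F) (rep_of G)) = {}"
    unfolding plus_forest_def
    by (subst (asm) forest_of_eq_0_iff) (auto intro: is_forest_disj_union is_forest_rep_of)
  then show "F = 0 \<and> G = 0"
    using forest_of_no_verts[OF is_forest_rep_of] by (auto simp: forest_of_rep_of)
qed simp

lemma downset_disj_union:
  "{D. downset (disj_union X Y) D} = (\<lambda>(A, B). Inl ` A \<union> Inr ` B) ` ({A. downset X A} \<times> {B. downset Y B})"
    (is "?L = ?R")
proof (intro equalityI subsetI)
  fix D assume "D \<in> ?L"
  then have D: "D \<subseteq> Inl ` verts X \<union> Inr ` verts Y" "\<And>a b. b \<in> D \<Longrightarrow> (a, b) \<in> below (disj_union X Y) \<Longrightarrow> a \<in> D"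
    by (auto simp: downset_def)
  have "D = Inl ` (Inl -` D) \<union> Inr ` (Inr -` D)"
    using D(1) by auto
  moreover have "downset X (Inl -` D)" "downset Y (Inr -` D)"
    using D(1) D(2)[of "Inl _" "Inl _"] D(2)[of "Inr _" "Inr _"] by (auto simp: downset_def)
  ultimately show "D \<in> ?R"
    by (intro image_eqI[of _ _ "(Inl -` D, Inr -` D)"]) simp_all
next
  fix D assume "D \<in> ?R"
  then obtain A B where "downset X A" "downset Y B" "D = Inl ` A \<union> Inr ` B"
    by auto
  then show "D \<in> ?L"
    by (auto simp: downset_def disj_union_def)
qed

lemma restrict_disj_union:
  assumes "A \<subseteq> verts X" "B \<subseteq> verts Y"
  shows "restrict_forest (disj_union X Y) (Inl ` A \<union> Inr ` B) = disj_union (restrict_forest X A) (restrict_forest Y B)"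
  unfolding disj_union_def restrict_forest_simps unfolding restrict_forest_def by auto

text \<open>The two components are cut independently, and both halves of a cut are again disjoint
  unions, so the sum over cuts factors.\<close>

lemma cut_sum_disj_union:
  assumes X: "is_forest X" and Y: "is_forest Y"
  shows "cut_sum (disj_union X Y) = (cut_sum X * cut_sum Y :: _ \<Rightarrow>\<^sub>0 'k::comm_ring_1)"
proof -
  let ?h = "\<lambda>(A, B). Inl ` A \<union> Inr ` B"
  have inj: "inj_on ?h ({A. downset X A} \<times> {B. downset Y B})"
    by (rule inj_onI) auto
  have step: "cut (disj_union X Y) (?h (A, B)) = (cut X A * cut Y B :: _ \<Rightarrow>\<^sub>0 'k)" if A: "downset X A" and B: "downset Y B" for A B
  proof -
    have sub: "A \<subseteq> verts X" "B \<subseteq> verts Y"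
      using A B by (auto simp: downset_def)
    have diff: "verts (disj_union X Y) - (Inl ` A \<union> Inr ` B) = Inl ` (verts X - A) \<union> Inr ` (verts Y - B)"
      by auto
    note f = is_forest_restrict[OF X] is_forest_restrict[OF Y] convex_in_downset[OF A] convex_in_downset[OF B]
      convex_in_upset[OF X A] convex_in_upset[OF Y B]
    show ?thesis
      unfolding cut_def prod.case diff restrict_disj_union[OF sub] restrict_disj_union[OF Diff_subset Diff_subset]
      by (simp add: mult_single plus_prod_def forest_of_disj_union f)
  qed
  have "cut_sum (disj_union X Y) = (\<Sum>AB\<in>{A. downset X A} \<times> {B. downset Y B}. cut (disj_union X Y) (?h AB) :: _ \<Rightarrow>\<^sub>0 'k)"
    unfolding cut_sum_def downset_disj_union sum.reindex[OF inj] by simp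
  also have "\<dots> = (\<Sum>(A, B)\<in>{A. downset X A} \<times> {B. downset Y B}. cut X A * cut Y B)"
    using step by (intro sum.cong refl) auto
  also have "\<dots> = cut_sum X * cut_sum Y"
    by (simp add: cut_sum_def sum_product sum.cartesian_product)
  finally show ?thesis .
qed

lemma cut_sum_0: "cut_sum (rep_of (0 :: ('p, 'e) forest)) = (1 :: _ \<Rightarrow>\<^sub>0 'k::comm_ring_1)"
proof -
  have D: "{D. downset (rep_of (0 :: ('p, 'e) forest)) D} = {{}}"
    by (auto simp: downset_def verts_rep_of_0)
  have "forest_of (restrict_forest (rep_of (0 :: ('p, 'e) forest)) {}) = 0"
    by (intro forest_of_no_verts is_forest_restrict is_forest_rep_of) (auto simp: convex_in_def)
  then show ?thesis
    by (simp add: cut_sum_def cut_def D verts_rep_of_0 flip: zero_prod_def)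
qed

lemma alg_hom_forest_coprod: "alg_hom forest_coprod"
proof (rule alg_homI)
  show "lin forest_coprod"
    unfolding forest_coprod_def by (rule lin_lin_ext)
  show "forest_coprod (Poly_Mapping.single 0 1) = 1"
    unfolding forest_coprod_basis by (rule cut_sum_0)
  show "forest_coprod (Poly_Mapping.single (F + G) 1) =
    forest_coprod (Poly_Mapping.single F 1) * (forest_coprod (Poly_Mapping.single G 1) :: _ \<Rightarrow>\<^sub>0 'c)" for F G :: "('a, 'b) forest"
    unfolding plus_forest_def
    by (rule trans[OF forest_coprod_forest_of])
      (simp_all only: is_forest_disj_union is_forest_rep_of cut_sum_disj_union forest_coprod_basis)
qed

text \<open>Scalars are viewed as constant polynomials because the target of \<open>alg_hom\<close>
  has to be a monoid algebra.\<close>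

lemma alg_hom_forest_counit:
  "alg_hom (\<lambda>f :: ('p, 'e, 'k::comm_ring_1) hforest. Poly_Mapping.single (0::nat) (forest_counit f))"
proof (rule alg_homI)
  show "lin (\<lambda>f :: ('p, 'e, 'k) hforest. Poly_Mapping.single (0::nat) (forest_counit f))"
    by (rule linI) (simp_all add: forest_counit_def lookup_add single_add)
  show "Poly_Mapping.single (0::nat) (forest_counit (Poly_Mapping.single (F + G) 1)) =
    Poly_Mapping.single 0 (forest_counit (Poly_Mapping.single F 1)) *
    Poly_Mapping.single 0 (forest_counit (Poly_Mapping.single G (1::'k)))" for F G :: "('p, 'e) forest"
    by (auto simp: forest_counit_def lookup_single when_def mult_single forest_add_eq_0_iff)
qed (simp add: forest_counit_def)

section \<open>Admissible decorations\<close>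

lemma PE_forest_iso:
  assumes X: "is_forest X" and Y: "is_forest Y" and "forest_iso X Y" and PE: "PE_forest P E X"
  shows "PE_forest P E Y"
proof -
  obtain f where f: "is_forest_iso f X Y"
    using assms(3) by (auto simp: forest_iso_def)
  have surj: "verts Y = f ` verts X"
    using f by (simp add: is_forest_iso_def bij_betw_def)
  show ?thesis
    unfolding PE_forest_def
  proof (intro conjI Y ballI allI impI)
    show "vdec Y a \<in> P" if "a \<in> verts Y" for a
      using that PE f unfolding surj PE_forest_def is_forest_iso_def by auto
    fix a b assume ab: "covered_by Y a b"
    then have "a \<in> verts Y" "b \<in> verts Y"
      using is_forestD(2)[OF Y] by (auto dest: covered_byD)
    then obtain a' b' where v: "a' \<in> verts X" "b' \<in> verts X" "a = f a'" "b = f b'"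
      unfolding surj by blast
    then have "covered_by X a' b'"
      using ab is_forest_iso_covered[OF X Y f] by simp
    then show "edec Y b a \<in> E (vdec Y b)"
      using PE f v unfolding PE_forest_def is_forest_iso_def by auto
  qed
qed

lemma PE_forest_add:
  assumes "PE_forest P E (rep_of F)" "PE_forest P E (rep_of G)"
  shows "PE_forest P E (rep_of (F + G))"
proof -
  have f: "is_forest (disj_union (rep_of F) (rep_of G))"
    by (intro is_forest_disj_union is_forest_rep_of)
  have "PE_forest P E (disj_union (rep_of F) (rep_of G))"
    using assms f unfolding PE_forest_def all_sum by auto
  then show ?thesis
    unfolding plus_forest_def by (rule PE_forest_iso[OF f is_forest_rep_of forest_iso_rep_of(1)[OF f]])
qed

lemma subalg_PE_space: "subalg (PE_space P E)"
  unfolding subalg_def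
proof (intro conjI allI ballI)
  show "Poly_Mapping.single 0 c \<in> PE_space P E" for c :: 'c
    by (auto simp: PE_space_def PE_forest_def is_forest_rep_of verts_rep_of_0 split: if_splits
      dest!: covered_byD is_forestD(2)[OF is_forest_rep_of, THEN subsetD])
  fix f g :: "('a, 'b, 'c) hforest"
  assume f: "f \<in> PE_space P E" and g: "g \<in> PE_space P E"
  show "f + g \<in> PE_space P E"
    using f g keys_add[of f g] by (auto simp: PE_space_def)
  show "f * g \<in> PE_space P E"
    unfolding PE_space_def mem_Collect_eq
  proof
    fix F assume "F \<in> Poly_Mapping.keys (f * g)"
    then obtain F' G' where "F = F' + G'" "F' \<in> Poly_Mapping.keys f" "G' \<in> Poly_Mapping.keys g"
      using keys_mult[of f g] by blast
    then show "PE_forest P E (rep_of F)"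
      using f g by (auto simp: PE_space_def intro: PE_forest_add)
  qed
qed


section \<open>Grafted trees and their cuts\<close>

lemma verts_add_root: "verts (add_root p R) = insert None {Some (e, v) | e v. v \<in> verts (R e)}"
  by (simp add: add_root_def Let_def)

lemma below_add_root [simp]:
  "(x, None) \<in> below (add_root p R) \<longleftrightarrow> x \<in> verts (add_root p R)"
  "(None, Some y) \<notin> below (add_root p R)"
  "(Some (e, a), Some (e', b)) \<in> below (add_root p R) \<longleftrightarrow> e = e' \<and> (a, b) \<in> below (R e)"
  by (auto simp: add_root_def Let_def)

lemma dec_add_root [simp]:
  "vdec (add_root p R) None = p" "vdec (add_root p R) (Some (e, v)) = vdec (R e) v"
  "edec (add_root p R) None (Some (e, v)) = e" "edec (add_root p R) (Some (e', b)) (Some (e, a)) = edec (R e) b a"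
  by (auto simp: add_root_def Let_def)

text \<open>The new root lies above everything, so a vertex that already has a parent has this
  parent strictly between itself and the root. Hence no vertex acquires a second parent.\<close>

lemma covered_by_add_root:
  fixes R :: "'e \<Rightarrow> ('v, 'p, 'e) dforest"
  assumes "\<And>e. is_forest (R e)"
  shows "covered_by (add_root p R) (Some (e, a)) (Some (e', b)) \<longleftrightarrow> e = e' \<and> covered_by (R e) a b"
    "\<not> covered_by (add_root p R) None y"
    "covered_by (add_root p R) (Some (e, a)) None \<Longrightarrow> \<not> covered_by (add_root p R) (Some (e, a)) (Some (e', b))"
proof -
  let ?A = "add_root p R"
  show "covered_by ?A (Some (e, a)) (Some (e', b)) \<longleftrightarrow> e = e' \<and> covered_by (R e) a b" (is "?L \<longleftrightarrow> ?R")
  proof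
    assume L: ?L
    have "(Some (e, a), Some (e', b)) \<in> below ?A" "Some (e, a) \<noteq> Some (e', b)"
      using L unfolding covered_by_def by blast+
    then have ab: "e = e'" "(a, b) \<in> below (R e)" "a \<noteq> b"
      by auto
    have "c = a \<or> c = b" if "(a, c) \<in> below (R e)" "(c, b) \<in> below (R e)" for c
    proof -
      have "(Some (e, a), Some (e, c)) \<in> below ?A" "(Some (e, c), Some (e', b)) \<in> below ?A"
        using that ab(1) by simp_all
      then have "Some (e, c) = Some (e, a) \<or> Some (e, c) = Some (e', b)"
        using L unfolding covered_by_def by blast
      then show ?thesis by auto
    qed
    with ab show ?R by (simp add: covered_by_def)
  next
    assume R: ?R
    have "c = Some (e, a) \<or> c = Some (e', b)" if "(Some (e, a), c) \<in> below ?A" "(c, Some (e', b)) \<in> below ?A" for c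
    proof (cases c)
      case (Some x)
      then show ?thesis
        using that R by (cases x) (auto simp: covered_by_def)
    qed (use that in simp)
    with R show ?L by (auto simp: covered_by_def)
  qed
  show "\<not> covered_by ?A None y"
    by (cases y) (auto simp: covered_by_def)
  show "\<not> covered_by ?A (Some (e, a)) (Some (e', b))" if "covered_by ?A (Some (e, a)) None"
  proof
    assume b: "covered_by ?A (Some (e, a)) (Some (e', b))"
    then have "(Some (e, a), Some (e', b)) \<in> below ?A" "Some (e, a) \<noteq> Some (e', b)"
      unfolding covered_by_def by blast+
    moreover have "(Some (e', b), None) \<in> below ?A"
      using calculation(1) is_forestD(2)[OF assms] by (auto simp: verts_add_root)
    ultimately show False
      using that unfolding covered_by_def by blast
  qed
qed

text \<open>\<open>R\<close> is indexed by the whole type of edge decorations; the finite set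
  \<open>K\<close> contains the indices of all nonempty branches.\<close>

lemma is_forest_add_root:
  assumes R: "\<And>e. is_forest (R e)" and K: "finite K" "\<And>e. e \<notin> K \<Longrightarrow> verts (R e) = {}"
  shows "is_forest (add_root p R)"
proof (rule is_forestI)
  let ?A = "add_root p R"
  note RD = is_forestD[OF R]
  have "verts ?A \<subseteq> insert None (Some ` (SIGMA e:K. verts (R e)))"
    using K(2) by (force simp: verts_add_root)
  moreover have "finite (insert None (Some ` (SIGMA e:K. verts (R e))))"
    by (intro finite.insertI finite_imageI finite_SigmaI K RD(1))
  ultimately show "finite (verts ?A)"
    by (rule finite_subset)
  show sub: "below ?A \<subseteq> verts ?A \<times> verts ?A"
    using RD(2) by (fastforce simp: add_root_def Let_def)
  show "(a, a) \<in> below ?A" if "a \<in> verts ?A" for a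
    using that RD(3) by (cases a) (auto simp: verts_add_root)
  show "(a, c) \<in> below ?A" if ab: "(a, b) \<in> below ?A" and bc: "(b, c) \<in> below ?A" for a b c
  proof (cases c)
    case None
    then show ?thesis
      using sub ab by auto
  next
    case (Some z)
    then obtain e v v' where "c = Some (e, v)" "b = Some (e, v')" "(v', v) \<in> below (R e)"
      using bc by (cases z; cases b) auto
    moreover from this obtain v'' where "a = Some (e, v'')" "(v'', v') \<in> below (R e)"
      using ab by (cases a) auto
    ultimately show ?thesis
      using RD(4)[of v'' v' e v] by simp
  qed
  show "a = b" if "(a, b) \<in> below ?A" "(b, a) \<in> below ?A" for a b
    using that RD(5) by (cases a; cases b) auto
  show "b = c" if "covered_by ?A a b" "covered_by ?A a c" for a b c
  proof (cases a)
    case None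
    then show ?thesis using that covered_by_add_root(2)[where R = R, OF R] by blast
  next
    case (Some x)
    obtain e v where x: "x = (e, v)" by (cases x)
    show ?thesis
    proof (cases b; cases c)
      fix y z assume "b = Some y" "c = Some z"
      then show ?thesis
        using that RD(6) by (cases y; cases z) (auto simp: Some x covered_by_add_root(1)[where R = R, OF R])
    next
      fix y assume b: "b = Some y" and c: "c = None"
      obtain e' v' where "y = (e', v')" by (cases y)
      then show ?thesis
        using that covered_by_add_root(3)[where R = R, OF R, of p e v e' v'] by (simp add: Some x b c)
    next
      fix y assume b: "b = None" and c: "c = Some y"
      obtain e' v' where "y = (e', v')" by (cases y)
      then show ?thesis
        using that covered_by_add_root(3)[where R = R, OF R, of p e v e' v'] by (simp add: Some x b c)
    qed simp
  qed
qed

lemma forest_iso_add_root: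
  assumes R: "\<And>e. is_forest (R e)" and iso: "\<And>e. forest_iso (R e) (R' e)"
  shows "forest_iso (add_root p R) (add_root p R')"
proof -
  obtain f where f: "\<And>e. is_forest_iso (f e) (R e) (R' e)"
    using iso unfolding forest_iso_def by metis
  let ?h = "map_option (\<lambda>(e, v). (e, f e v))"
  have bij: "bij_betw (f e) (verts (R e)) (verts (R' e))" for e
    using f[of e] by (simp add: is_forest_iso_def)
  have surj: "verts (R' e) = f e ` verts (R e)" for e
    using bij by (simp add: bij_betw_def)
  have "inj_on ?h (verts (add_root p R))"
    by (intro inj_onI) (auto simp: verts_add_root dest: inj_onD[OF bij_betw_imp_inj_on[OF bij]])
  moreover have "?h ` verts (add_root p R) = verts (add_root p R')"
    by (force simp: verts_add_root surj)
  ultimately have hbij: "bij_betw ?h (verts (add_root p R)) (verts (add_root p R'))"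
    by (rule bij_betw_imageI)
  have "is_forest_iso ?h (add_root p R) (add_root p R')"
    unfolding is_forest_iso_def
  proof (intro conjI hbij ballI allI impI)
    fix a b assume a: "a \<in> verts (add_root p R)" and b: "b \<in> verts (add_root p R)"
    have "?h a \<in> verts (add_root p R')"
      using hbij a by (auto simp: bij_betw_def)
    then show "(?h a, ?h b) \<in> below (add_root p R') \<longleftrightarrow> (a, b) \<in> below (add_root p R)"
      using a b f by (cases a; cases b) (auto simp: verts_add_root is_forest_iso_def)
    show "vdec (add_root p R') (?h a) = vdec (add_root p R) a"
      using a f by (cases a) (auto simp: verts_add_root is_forest_iso_def)
  next
    fix a b assume ab: "covered_by (add_root p R) a b"
    then obtain e v where a: "a = Some (e, v)"
      using covered_by_add_root(2)[where R = R, OF R] by (cases a) auto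
    show "edec (add_root p R') (?h b) (?h a) = edec (add_root p R) b a"
      using ab f by (cases b) (auto simp: a covered_by_add_root(1)[where R = R, OF R] is_forest_iso_def)
  qed
  then show ?thesis by (auto simp: forest_iso_def)
qed

text \<open>Without the root the branches are unrelated, and the edges that carried the labels e are
  gone. The induction splits off one branch at a time.\<close>

lemma forest_of_branches:
  assumes R: "\<And>e. is_forest (R e)" and A: "is_forest (add_root p R)" and K: "finite K"
  shows "forest_of (restrict_forest (add_root p R) {Some (e, v) | e v. e \<in> K \<and> v \<in> verts (R e)}) = (\<Sum>e\<in>K. forest_of (R e))"
  using K
proof (induction K rule: finite_induct)
  let ?S = "\<lambda>K. {Some (e, v) | e v. e \<in> K \<and> v \<in> verts (R e)}"
  have S: "is_forest (restrict_forest (add_root p R) (?S K))" for K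
  proof (intro is_forest_restrict A convex_in_downset)
    show "downset (add_root p R) (?S K)"
      unfolding downset_def
    proof (intro conjI ballI allI impI)
      show "?S K \<subseteq> verts (add_root p R)"
        by (auto simp: verts_add_root)
      show "a \<in> ?S K" if "b \<in> ?S K" "(a, b) \<in> below (add_root p R)" for a b
        using that by (cases a) (auto dest: subsetD[OF is_forestD(2)[OF R]])
    qed
  qed
  case empty
  show ?case
    using forest_of_no_verts[OF S[of "{}"]] by simp
  case (insert e K)
  let ?B = "restrict_forest (add_root p R) (?S K)"
  let ?f = "case_sum (\<lambda>v. Some (e, v)) id"
  have iso: "forest_iso (disj_union (R e) ?B) (restrict_forest (add_root p R) (?S (insert e K)))"
    unfolding forest_iso_def is_forest_iso_def
  proof (intro exI[of _ ?f] conjI)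
    show "bij_betw ?f (verts (disj_union (R e) ?B)) (verts (restrict_forest (add_root p R) (?S (insert e K))))"
      using insert.hyps(2) by (intro bij_betw_imageI inj_onI) (auto simp: image_Un image_image)
  qed (use insert.hyps(2) in \<open>auto simp: all_sum covered_by_add_root[where R = R, OF R] ball_Un\<close>)
  have "forest_of (disj_union (R e) ?B) = forest_of (restrict_forest (add_root p R) (?S (insert e K)))"
    by (rule forest_of_eq_iff[THEN iffD2, OF is_forest_disj_union[OF R S] S iso])
  from this[symmetric] show ?case
    using insert by (simp add: forest_of_disj_union[OF R S, symmetric])
qed

definition branch_cut :: "'e set \<Rightarrow> ('e \<Rightarrow> 'v set) \<Rightarrow> ('e \<times> 'v) option set" where
  "branch_cut K g = {Some (e, v) | e v. e \<in> K \<and> v \<in> g e}"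

text \<open>A downset containing the root contains everything below it; otherwise it is an
  independent choice in every branch. This dichotomy is the source of the two summands in the
  cocycle identity of grafting.\<close>

lemma downset_add_root:
  assumes R: "\<And>e. is_forest (R e)" and K: "\<And>e. e \<notin> K \<Longrightarrow> verts (R e) = {}"
  shows "{D. downset (add_root p R) D} =
    insert (verts (add_root p R)) (branch_cut K ` PiE K (\<lambda>e. {D. downset (R e) D}))" (is "?L = ?R")
proof (intro equalityI subsetI)
  fix D assume "D \<in> ?L"
  then have D: "D \<subseteq> verts (add_root p R)" "\<And>a b. b \<in> D \<Longrightarrow> (a, b) \<in> below (add_root p R) \<Longrightarrow> a \<in> D"
    by (auto simp: downset_def)
  show "D \<in> ?R"
  proof (cases "None \<in> D")
    case True
    then have "D = verts (add_root p R)"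
      using D(1) D(2)[OF True] by auto
    then show ?thesis by simp
  next
    case False
    define g where "g = (\<lambda>e\<in>K. {v. Some (e, v) \<in> D})"
    have "D = branch_cut K g"
    proof (intro equalityI subsetI)
      fix x assume x: "x \<in> D"
      then obtain e v where xe: "x = Some (e, v)"
        using False by (cases x) auto
      then have "v \<in> verts (R e)"
        using D(1) x by (auto simp: verts_add_root)
      then have "e \<in> K"
        using K by blast
      then show "x \<in> branch_cut K g"
        using x by (simp add: xe branch_cut_def g_def)
    qed (auto simp: branch_cut_def g_def)
    moreover have "downset (R e) {v. Some (e, v) \<in> D}" for e
      unfolding downset_def
    proof (intro conjI ballI allI impI)
      show "{v. Some (e, v) \<in> D} \<subseteq> verts (R e)"
        using D(1) by (auto simp: verts_add_root)
      show "a \<in> {v. Some (e, v) \<in> D}" if "b \<in> {v. Some (e, v) \<in> D}" "(a, b) \<in> below (R e)" for a b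
        using that D(2)[of "Some (e, b)" "Some (e, a)"] by simp
    qed
    then have "g \<in> PiE K (\<lambda>e. {D. downset (R e) D})"
      by (simp add: g_def)
    ultimately show ?thesis by blast
  qed
next
  fix D assume "D \<in> ?R"
  then consider "D = verts (add_root p R)" | g where "g \<in> PiE K (\<lambda>e. {D. downset (R e) D})" "D = branch_cut K g"
    by blast
  then show "D \<in> ?L"
  proof cases
    case 1
    have "a \<in> verts (add_root p R)" if "(a, b) \<in> below (add_root p R)" for a b
      using that by (cases a; cases b) (auto simp: verts_add_root dest: subsetD[OF is_forestD(2)[OF R]])
    then show ?thesis
      by (auto simp: 1 downset_def)
  next
    case 2
    then have g: "downset (R e) (g e)" if "e \<in> K" for e
      using that by auto
    have "a \<in> D" if b: "b \<in> D" and ab: "(a, b) \<in> below (add_root p R)" for a b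
    proof -
      obtain e v where e: "e \<in> K" "v \<in> g e" "b = Some (e, v)"
        using b by (auto simp: 2 branch_cut_def)
      then obtain v' where "(v', v) \<in> below (R e)" "a = Some (e, v')"
        using ab by (cases a) auto
      moreover from this have "v' \<in> g e"
        using g[OF e(1)] e(2) by (simp add: downset_def)
      ultimately show ?thesis
        using e by (simp add: 2 branch_cut_def)
    qed
    moreover have "D \<subseteq> verts (add_root p R)"
    proof
      fix x assume "x \<in> D"
      then obtain e v where e: "e \<in> K" "v \<in> g e" "x = Some (e, v)"
        by (auto simp: 2 branch_cut_def)
      then have "v \<in> verts (R e)"
        using g[OF e(1)] by (auto simp: downset_def)
      then show "x \<in> verts (add_root p R)"
        using e by (simp add: verts_add_root)
    qed
    ultimately show ?thesis
      by (auto simp: downset_def)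
  qed
qed

lemma inj_on_branch_cut: "inj_on (branch_cut K) (PiE K B)"
proof (rule inj_onI)
  fix g h assume g: "g \<in> PiE K B" and h: "h \<in> PiE K B" and eq: "branch_cut K g = branch_cut K h"
  have branch: "f e = {v. Some (e, v) \<in> branch_cut K f}" if "e \<in> K" for e and f :: "'a \<Rightarrow> 'b set"
    using that by (simp add: branch_cut_def)
  show "g = h"
    by (rule PiE_ext[OF g h]) (simp add: branch[of _ g] branch[of _ h] eq)
qed

lemma cut_sum_add_root:
  assumes R: "\<And>e. is_forest (R e)" and K: "finite K" "\<And>e. e \<notin> K \<Longrightarrow> verts (R e) = {}"
  shows "cut_sum (add_root p R) = Poly_Mapping.single (forest_of (add_root p R), 0) 1 +
    (\<Sum>g\<in>PiE K (\<lambda>e. {D. downset (R e) D}). Poly_Mapping.single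
      (\<Sum>e\<in>K. forest_of (restrict_forest (R e) (g e)),
       forest_of (add_root p (\<lambda>e. restrict_forest (R e) (verts (R e) - g e)))) (1::'k::comm_ring_1))"
proof -
  let ?A = "add_root p R"
  let ?G = "PiE K (\<lambda>e. {D. downset (R e) D})"
  have A: "is_forest ?A"
    by (rule is_forest_add_root[where R = R, OF R K])
  have fin: "finite ?G"
    by (intro finite_PiE K finite_downsets R)
  have notin: "verts ?A \<notin> branch_cut K ` ?G"
    by (auto simp: branch_cut_def verts_add_root)
  have "restrict_forest ?A (verts ?A) = ?A"
    using is_forestD(2)[OF A] by (simp add: restrict_forest_def Int_absorb2)
  moreover have "forest_of (restrict_forest ?A {}) = 0"
    by (intro forest_of_no_verts is_forest_restrict A) (simp_all add: convex_in_def)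
  ultimately have full: "cut ?A (verts ?A) = Poly_Mapping.single (forest_of ?A, 0) (1::'k)"
    by (simp add: cut_def)
  have part: "cut ?A (branch_cut K g) = Poly_Mapping.single
      (\<Sum>e\<in>K. forest_of (restrict_forest (R e) (g e)),
       forest_of (add_root p (\<lambda>e. restrict_forest (R e) (verts (R e) - g e)))) (1::'k)" if g: "g \<in> ?G" for g
  proof -
    \<comment> \<open>Outside \<open>K\<close> the value of g is \<open>undefined\<close>, so there
      the cut part is set to be empty. The complementary part needs no such care, its branches being
      empty outside \<open>K\<close>.\<close>
    define R' where "R' e = restrict_forest (R e) (if e \<in> K then g e else {})" for e
    have down: "downset (R e) (g e)" if "e \<in> K" for e
      using g that by auto
    have R': "is_forest (R' e)" for e
    proof (cases "e \<in> K")
      case True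
      then show ?thesis
        unfolding R'_def using is_forest_restrict[OF R convex_in_downset[OF down[OF True]]] by simp
    next
      case False
      then show ?thesis
        unfolding R'_def by (simp add: is_forest_restrict[OF R] convex_in_def)
    qed
    have A': "is_forest (add_root p R')"
      by (rule is_forest_add_root[where R = R', OF R' K(1)]) (simp add: R'_def)
    have vR': "{Some (e, v) | e v. e \<in> K \<and> v \<in> verts (R' e)} = branch_cut K g"
      by (auto simp: R'_def branch_cut_def)
    have "restrict_forest ?A (branch_cut K g) = restrict_forest (add_root p R') (branch_cut K g)"
      unfolding add_root_def R'_def restrict_forest_simps Let_def unfolding restrict_forest_def
      by (auto simp: branch_cut_def)
    then have "forest_of (restrict_forest ?A (branch_cut K g)) = (\<Sum>e\<in>K. forest_of (R' e))"
      using forest_of_branches[where R = R', OF R' A' K(1)] unfolding vR' by simp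
    also have "\<dots> = (\<Sum>e\<in>K. forest_of (restrict_forest (R e) (g e)))"
      by (simp add: R'_def)
    finally have 1: "forest_of (restrict_forest ?A (branch_cut K g)) = (\<Sum>e\<in>K. forest_of (restrict_forest (R e) (g e)))" .
    have "v \<in> verts (R e) \<Longrightarrow> e \<in> K" for e v
      using K(2) by blast
    then have diff: "verts ?A - branch_cut K g = insert None {Some (e, v) | e v. v \<in> verts (R e) - g e}"
      by (auto simp: branch_cut_def verts_add_root)
    have "restrict_forest ?A (verts ?A - branch_cut K g) = add_root p (\<lambda>e. restrict_forest (R e) (verts (R e) - g e))"
      unfolding diff
      unfolding add_root_def restrict_forest_simps Let_def unfolding restrict_forest_def by auto
    then show ?thesis
      unfolding cut_def 1 by simp
  qed
  have "cut_sum ?A = (\<Sum>D\<in>insert (verts ?A) (branch_cut K ` ?G). cut ?A D :: _ \<Rightarrow>\<^sub>0 'k)"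
    unfolding cut_sum_def by (rule sum.cong[OF downset_add_root[where R = R, OF R K(2)] refl])
  also have "\<dots> = cut ?A (verts ?A) + (\<Sum>g\<in>?G. cut ?A (branch_cut K g))"
    unfolding sum.insert[OF finite_imageI[OF fin] notin] sum.reindex[OF inj_on_branch_cut] by simp
  finally show ?thesis
    by (simp add: full part)
qed


section \<open>The cocycle property of grafting\<close>

text \<open>The universal property of a tensor power of commutative algebras: the algebra morphism
  that restricts to \<open>\<phi> e\<close> on the e-th factor.\<close>

definition tensor_lift :: "('e \<Rightarrow> ('m::comm_monoid_add \<Rightarrow>\<^sub>0 'k::comm_ring_1) \<Rightarrow> ('n::comm_monoid_add \<Rightarrow>\<^sub>0 'k)) \<Rightarrow>
    (('e \<Rightarrow>\<^sub>0 'm) \<Rightarrow>\<^sub>0 'k) \<Rightarrow> ('n \<Rightarrow>\<^sub>0 'k)" where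
  "tensor_lift \<phi> = lin_ext (\<lambda>F. \<Prod>e\<in>Poly_Mapping.keys F. \<phi> e (Poly_Mapping.single (Poly_Mapping.lookup F e) 1))"

lemma alg_hom_tensor_lift:
  assumes \<phi>: "\<And>e. alg_hom (\<phi> e)"
  shows "alg_hom (tensor_lift \<phi>)"
  unfolding tensor_lift_def
proof (rule alg_hom_lin_ext)
  fix F G :: "'a \<Rightarrow>\<^sub>0 'b"
  define A where "A = Poly_Mapping.keys F \<union> Poly_Mapping.keys G"
  have A: "finite A" "Poly_Mapping.keys F \<subseteq> A" "Poly_Mapping.keys G \<subseteq> A" "Poly_Mapping.keys (F + G) \<subseteq> A"
    using keys_add[of F G] by (auto simp: A_def)
  have sup: "(\<Prod>e\<in>Poly_Mapping.keys H. \<phi> e (Poly_Mapping.single (Poly_Mapping.lookup H e) 1)) =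
    (\<Prod>e\<in>A. \<phi> e (Poly_Mapping.single (Poly_Mapping.lookup H e) 1))" if "Poly_Mapping.keys H \<subseteq> A" for H
    by (rule prod.mono_neutral_left) (use A(1) that in \<open>auto simp: in_keys_iff alg_homD(1)[OF \<phi>]\<close>)
  show "(\<Prod>e\<in>Poly_Mapping.keys (F + G). \<phi> e (Poly_Mapping.single (Poly_Mapping.lookup (F + G) e) 1)) =
    (\<Prod>e\<in>Poly_Mapping.keys F. \<phi> e (Poly_Mapping.single (Poly_Mapping.lookup F e) 1)) *
    (\<Prod>e\<in>Poly_Mapping.keys G. \<phi> e (Poly_Mapping.single (Poly_Mapping.lookup G e) 1))"
    unfolding sup[OF A(2)] sup[OF A(3)] sup[OF A(4)]
    by (simp add: lookup_add single_add_one alg_homD(2)[OF \<phi>] prod.distrib)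
qed simp

lemma tensor_lift_incl:
  assumes \<phi>: "\<And>e. alg_hom (\<phi> e)"
  shows "tensor_lift \<phi> (incl e f) = \<phi> e f"
proof -
  have "(\<lambda>f. tensor_lift \<phi> (incl e f)) = \<phi> e"
  proof (rule lin_eq)
    show "lin (\<lambda>f. tensor_lift \<phi> (incl e f))"
      by (rule lin_comp[OF lin_alg_hom[OF alg_hom_tensor_lift[OF \<phi>]] lin_alg_hom[OF alg_hom_incl]])
    show "tensor_lift \<phi> (incl e (Poly_Mapping.single m 1)) = \<phi> e (Poly_Mapping.single m 1)" for m
      by (cases "m = 0") (simp_all add: incl_single tensor_lift_def alg_homD(1)[OF \<phi>] lin_ext_one alg_homD(1)[OF alg_hom_incl])
  qed (rule lin_alg_hom[OF \<phi>])
  then show ?thesis by (rule fun_cong)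
qed

text \<open>The coaction of forests on the tensor power: every factor is cut, the lower parts are
  multiplied together on the left, and each upper part stays in its own factor.\<close>

definition forest_coaction :: "(('e \<Rightarrow>\<^sub>0 ('p, 'e) forest) \<Rightarrow>\<^sub>0 'k::comm_ring_1) \<Rightarrow>
    (('p, 'e) forest \<times> ('e \<Rightarrow>\<^sub>0 ('p, 'e) forest)) \<Rightarrow>\<^sub>0 'k" where
  "forest_coaction = tensor_lift (\<lambda>e f. tensor_map (\<lambda>x. x) (incl e) (forest_coprod f))"

lemma alg_hom_incl_coprod: "alg_hom (\<lambda>f. tensor_map (\<lambda>x. x) (incl e) (forest_coprod f))"
  by (rule alg_hom_comp[OF alg_hom_tensor_map[OF alg_hom_id alg_hom_incl] alg_hom_forest_coprod])

lemma alg_hom_forest_coaction: "alg_hom forest_coaction"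
  unfolding forest_coaction_def by (rule alg_hom_tensor_lift[OF alg_hom_incl_coprod])

lemma forest_coaction_incl: "forest_coaction (incl e f) = tensor_map (\<lambda>x. x) (incl e) (forest_coprod f)"
  unfolding forest_coaction_def by (rule tensor_lift_incl[OF alg_hom_incl_coprod])

lemma lin_B_plus: "lin (B_plus p)"
  unfolding B_plus_def by (rule lin_lin_ext)

text \<open>On basis vectors this is the description of the cuts of a grafted tree in
  \<open>cut_sum_add_root\<close>: the cut that takes the whole tree gives B \<otimes> 1, and the
  others leave the root on the right.\<close>

lemma B_plus_cocycle:
  fixes f :: "('e \<Rightarrow>\<^sub>0 ('p, 'e) forest) \<Rightarrow>\<^sub>0 'k::comm_ring_1"
  shows "forest_coprod (B_plus p f) = tensor (B_plus p f) 1 + tensor_map (\<lambda>x. x) (B_plus p) (forest_coaction f)"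
proof -
  have "(\<lambda>f :: ('e \<Rightarrow>\<^sub>0 ('p, 'e) forest) \<Rightarrow>\<^sub>0 'k. forest_coprod (B_plus p f)) =
    (\<lambda>f. tensor (B_plus p f) 1 + tensor_map (\<lambda>x. x) (B_plus p) (forest_coaction f))"
  proof (rule lin_eq)
    show "lin (\<lambda>f :: ('e \<Rightarrow>\<^sub>0 ('p, 'e) forest) \<Rightarrow>\<^sub>0 'k. forest_coprod (B_plus p f))"
      by (rule lin_comp[OF lin_alg_hom[OF alg_hom_forest_coprod] lin_B_plus])
    show "lin (\<lambda>f :: ('e \<Rightarrow>\<^sub>0 ('p, 'e) forest) \<Rightarrow>\<^sub>0 'k. tensor (B_plus p f) 1 + tensor_map (\<lambda>x. x) (B_plus p) (forest_coaction f))"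
      by (intro lin_add lin_tensor_left lin_B_plus lin_comp[OF lin_tensor_map lin_alg_hom[OF alg_hom_forest_coaction]])
    fix F :: "'e \<Rightarrow>\<^sub>0 ('p, 'e) forest"
    define K where "K = Poly_Mapping.keys F"
    define R where "R e = rep_of (Poly_Mapping.lookup F e)" for e
    have R: "is_forest (R e)" for e
      by (simp add: R_def is_forest_rep_of)
    have K: "finite K" "verts (R e) = {}" if "e \<notin> K" for e
      using that by (auto simp: K_def R_def in_keys_iff verts_rep_of_0)
    have finK: "finite K"
      by (simp add: K_def)
    let ?G = "PiE K (\<lambda>e. {D. downset (R e) D})"
    let ?a = "\<lambda>e D. forest_of (restrict_forest (R e) D)"
    let ?b = "\<lambda>e D. forest_of (restrict_forest (R e) (verts (R e) - D))"
    have B: "B_plus p (Poly_Mapping.single F (1::'k)) = Poly_Mapping.single (forest_of (add_root p R)) 1"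
      by (simp add: B_plus_def R_def[abs_def])
    have A: "is_forest (add_root p R)"
      by (rule is_forest_add_root[where R = R, OF R finK K(2)])
    have branch: "tensor_map (\<lambda>x. x) (incl e) (forest_coprod (Poly_Mapping.single (Poly_Mapping.lookup F e) (1::'k))) =
      (\<Sum>D | downset (R e) D. Poly_Mapping.single (?a e D, Poly_Mapping.single e (?b e D)) 1)" for e
      unfolding forest_coprod_basis R_def[symmetric] cut_sum_def linD(4)[OF lin_tensor_map] cut_def
      by (simp add: tensor_map_def incl_single)
    have prod: "(\<Prod>e\<in>K. Poly_Mapping.single (x e, y e) (1::'k)) = Poly_Mapping.single (\<Sum>e\<in>K. x e, \<Sum>e\<in>K. y e) 1"
      for x :: "'e \<Rightarrow> ('p, 'e) forest" and y :: "'e \<Rightarrow> ('e \<Rightarrow>\<^sub>0 ('p, 'e) forest)"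
      using finK by (induction K rule: finite_induct) (simp_all add: mult_single plus_prod_def flip: zero_prod_def)
    have "forest_coaction (Poly_Mapping.single F (1::'k)) =
      (\<Prod>e\<in>K. \<Sum>D | downset (R e) D. Poly_Mapping.single (?a e D, Poly_Mapping.single e (?b e D)) 1)"
      unfolding forest_coaction_def tensor_lift_def lin_ext_single smul_one branch K_def ..
    \<comment> \<open>Distributivity turns the product of sums over cuts of single branches into a
      sum over families of cuts, the index set used for the grafted tree.\<close>
    also have "\<dots> = (\<Sum>g\<in>?G. \<Prod>e\<in>K. Poly_Mapping.single (?a e (g e), Poly_Mapping.single e (?b e (g e))) 1)"
      by (rule prod_sum_PiE[OF finK]) (rule finite_downsets[OF R])
    also have "\<dots> = (\<Sum>g\<in>?G. Poly_Mapping.single (\<Sum>e\<in>K. ?a e (g e), \<Sum>e\<in>K. Poly_Mapping.single e (?b e (g e))) 1)"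
      unfolding prod ..
    finally have "tensor_map (\<lambda>x. x) (B_plus p) (forest_coaction (Poly_Mapping.single F (1::'k))) =
      (\<Sum>g\<in>?G. tensor_map (\<lambda>x. x) (B_plus p)
        (Poly_Mapping.single (\<Sum>e\<in>K. ?a e (g e), \<Sum>e\<in>K. Poly_Mapping.single e (?b e (g e))) 1))"
      by (simp only: linD(4)[OF lin_tensor_map])
    also have "\<dots> = (\<Sum>g\<in>?G. Poly_Mapping.single (\<Sum>e\<in>K. ?a e (g e),
        forest_of (add_root p (\<lambda>e. restrict_forest (R e) (verts (R e) - g e)))) 1)"
    proof (intro sum.cong refl)
      fix g assume g: "g \<in> ?G"
      let ?R' = "\<lambda>e. restrict_forest (R e) (verts (R e) - g e)"
      have R': "is_forest (?R' e)" for e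
      proof (cases "e \<in> K")
        case True
        then show ?thesis
          using g by (intro is_forest_restrict[OF R] convex_in_upset[OF R]) auto
      next
        case False
        then show ?thesis
          by (intro is_forest_restrict[OF R]) (simp add: K convex_in_def)
      qed
      have "Poly_Mapping.lookup (\<Sum>e\<in>K. Poly_Mapping.single e (?b e (g e))) e = forest_of (?R' e)" for e
      proof (cases "e \<in> K")
        case True
        then show ?thesis
          using finK by (simp add: lookup_sum lookup_single when_def sum.delta)
      next
        case False
        then have "forest_of (?R' e) = 0"
          by (intro forest_of_no_verts R') (simp add: K)
        then show ?thesis
          using finK False by (auto simp: lookup_sum lookup_single when_def intro!: sum.neutral)
      qed
      then have "B_plus p (Poly_Mapping.single (\<Sum>e\<in>K. Poly_Mapping.single e (?b e (g e))) (1::'k)) =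
        Poly_Mapping.single (forest_of (add_root p (\<lambda>e. rep_of (forest_of (?R' e))))) 1"
        by (simp add: B_plus_def)
      \<comment> \<open>\<open>B_plus\<close> grafts chosen representatives, so the pruned branches
        are compared with the representatives of their classes.\<close>
      also have "forest_of (add_root p (\<lambda>e. rep_of (forest_of (?R' e)))) = forest_of (add_root p ?R')"
      proof (subst forest_of_eq_iff)
        show "is_forest (add_root p ?R')"
          by (rule is_forest_add_root[OF R' finK]) (simp add: K)
        have "verts (rep_of (forest_of (?R' e))) = {}" if "e \<notin> K" for e
        proof -
          have "forest_of (?R' e) = 0"
            by (rule forest_of_no_verts[OF R']) (simp add: K(2)[OF that])
          then show ?thesis
            by (simp only: verts_rep_of_0)
        qed
        then show "is_forest (add_root p (\<lambda>e. rep_of (forest_of (?R' e))))"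
          by (intro is_forest_add_root[OF is_forest_rep_of finK])
        show "forest_iso (add_root p (\<lambda>e. rep_of (forest_of (?R' e)))) (add_root p ?R')"
          by (intro forest_iso_add_root is_forest_rep_of forest_iso_rep_of(2) R')
      qed
      finally show "tensor_map (\<lambda>x. x) (B_plus p)
          (Poly_Mapping.single (\<Sum>e\<in>K. ?a e (g e), \<Sum>e\<in>K. Poly_Mapping.single e (?b e (g e))) (1::'k)) =
        Poly_Mapping.single (\<Sum>e\<in>K. ?a e (g e), forest_of (add_root p ?R')) 1"
        by (simp add: tensor_map_def)
    qed
    finally have "tensor_map (\<lambda>x. x) (B_plus p) (forest_coaction (Poly_Mapping.single F (1::'k))) =
      (\<Sum>g\<in>?G. Poly_Mapping.single (\<Sum>e\<in>K. ?a e (g e),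
        forest_of (add_root p (\<lambda>e. restrict_forest (R e) (verts (R e) - g e)))) 1)" .
    moreover have "cut_sum (add_root p R) = Poly_Mapping.single (forest_of (add_root p R), 0) 1 +
      (\<Sum>g\<in>?G. Poly_Mapping.single (\<Sum>e\<in>K. ?a e (g e),
        forest_of (add_root p (\<lambda>e. restrict_forest (R e) (verts (R e) - g e)))) (1::'k))"
      by (rule cut_sum_add_root[where R = R, OF R finK K(2)])
    ultimately show "forest_coprod (B_plus p (Poly_Mapping.single F (1::'k))) =
      tensor (B_plus p (Poly_Mapping.single F 1)) 1 + tensor_map (\<lambda>x. x) (B_plus p) (forest_coaction (Poly_Mapping.single F 1))"
      using tensor_single[of "forest_of (add_root p R)" "1::'k" "0 :: ('p, 'e) forest" 1]
      unfolding B forest_coprod_forest_of[OF A] by simp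
  qed
  then show ?thesis by (rule fun_cong)
qed


section \<open>The coproduct of the solution of the combinatorial system\<close>

abbreviation left_fps :: "('a \<Rightarrow>\<^sub>0 'k::comm_ring_1) fps \<Rightarrow> (('a \<times> 'b::comm_monoid_add) \<Rightarrow>\<^sub>0 'k) fps" where
  "left_fps \<equiv> fps_map (\<lambda>f. tensor f 1)"

abbreviation right_fps :: "('b \<Rightarrow>\<^sub>0 'k::comm_ring_1) fps \<Rightarrow> (('a::comm_monoid_add \<times> 'b) \<Rightarrow>\<^sub>0 'k) fps" where
  "right_fps \<equiv> fps_map (\<lambda>f. tensor 1 f)"

text \<open>The right-hand side has the shape of the Riordan coproduct formulas: f = 1 and g = a =
  \<Pi> for the \<pi>_n, and f = a = Y with g = \<Pi> for the y_n.\<close>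

lemma tensor_compose_nth:
  fixes f g :: "('a::comm_monoid_add \<Rightarrow>\<^sub>0 'k::comm_ring_1) fps" and a :: "('b::comm_monoid_add \<Rightarrow>\<^sub>0 'k) fps"
  assumes g: "g $ 0 = 0"
  shows "(left_fps f * (right_fps a oo left_fps g)) $ n = (\<Sum>j\<le>n. tensor ((f * g ^ j) $ n) (a $ j))"
proof -
  have g': "(left_fps g :: (('a \<times> 'b) \<Rightarrow>\<^sub>0 'k) fps) $ 0 = 0"
    using g by (simp add: linD(3)[OF lin_alg_hom[OF alg_hom_tensor_left]])
  have "fps_cong (Suc n) (left_fps f * (right_fps a oo left_fps g))
      (left_fps f * (\<Sum>j<Suc n. fps_const (right_fps a $ j) * left_fps g ^ j))"
    by (rule fps_cong_mult[OF fps_cong_refl fps_cong_compose_sum[OF g']])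
  also have "\<dots> = (\<Sum>j<Suc n. fps_const (right_fps a $ j) * left_fps (f * g ^ j))"
    by (simp add: fps_map_ring_hom[OF alg_hom_tensor_left] sum_distrib_left algebra_simps)
  finally show ?thesis
    by (simp add: fps_cong_def fps_sum_nth lessThan_Suc_atMost tensor_mult)
qed

text \<open>Each coefficient is a finite sum of tensors whose right factors are coefficients of a,
  so linearity of B suffices to move it inside, although composition involves products.\<close>

lemma fps_map_tensor_map:
  fixes f g :: "('a::comm_monoid_add \<Rightarrow>\<^sub>0 'k::comm_ring_1) fps" and a :: "('b::comm_monoid_add \<Rightarrow>\<^sub>0 'k) fps"
    and B :: "('b \<Rightarrow>\<^sub>0 'k) \<Rightarrow> ('c::comm_monoid_add \<Rightarrow>\<^sub>0 'k)"
  assumes B: "lin B" and g: "g $ 0 = 0"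
  shows "fps_map (tensor_map (\<lambda>x. x) B) (left_fps f * (right_fps a oo left_fps g)) =
    left_fps f * (right_fps (fps_map B a) oo left_fps g)"
  unfolding fps_eq_iff fps_map_nth[of "tensor_map (\<lambda>x. x) B"] tensor_compose_nth[OF g]
  by (simp add: linD(4)[OF lin_tensor_map] tensor_map_tensor[OF lin_id B])

text \<open>In use, q is Q \<otimes> 1, h is the image of a series under a coproduct or coaction,
  and f is that series placed in the right tensor factor.\<close>

definition twisted :: "'a::comm_ring_1 fps \<Rightarrow> nat \<Rightarrow> 'a fps \<Rightarrow> 'a fps \<Rightarrow> 'a fps \<Rightarrow> bool" where
  "twisted q n h t f \<longleftrightarrow> fps_cong n h (t * (f oo q))"

lemma twisted_mult:
  assumes q: "q $ 0 = 0" and "twisted q n h t f" "twisted q n h' t' f'"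
  shows "twisted q n (h * h') (t * t') (f * f')"
proof -
  have "fps_cong n (h * h') ((t * (f oo q)) * (t' * (f' oo q)))"
    using assms(2,3) unfolding twisted_def by (rule fps_cong_mult)
  then show ?thesis
    by (simp add: twisted_def compose_mult[OF q] mult_ac)
qed

lemma twisted_prod:
  assumes q: "q $ 0 = 0" and "\<And>x. x \<in> A \<Longrightarrow> twisted q n (h x) (t x) (f x)"
  shows "twisted q n (\<Prod>x\<in>A. h x) (\<Prod>x\<in>A. t x) (\<Prod>x\<in>A. f x)"
  using assms(2)
  by (induction A rule: infinite_finite_induct) (simp_all add: twisted_mult[OF q], simp_all add: twisted_def)

lemma twisted_power:
  assumes q: "q $ 0 = 0" and "twisted q n h t f"
  shows "twisted q n (h ^ m) (t ^ m) (f ^ m)"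
  using twisted_prod[OF q, of "{..<m}" n "\<lambda>_. h" "\<lambda>_. t" "\<lambda>_. f"] assms(2) by simp

text \<open>The congruence replaces h by t (f o q) first; for this product the constant terms 1 of t
  and f permit splitting the power.\<close>

lemma twisted_fps_pow:
  assumes q: "q $ 0 = 0" and t: "t $ 0 = 1" and f: "f $ 0 = 1" and "twisted q n h t f"
  shows "twisted q n (fps_pow h a) (fps_pow t a) (fps_pow f a)"
proof -
  have "fps_cong n (fps_pow h a) (fps_pow (t * (f oo q)) a)"
    using assms(4) unfolding twisted_def by (rule fps_pow_cong)
  also have "\<dots> = fps_pow t a * (fps_pow f a oo q)"
    by (simp add: fps_pow_mult t f fps_pow_compose q)
  finally show ?thesis
    unfolding twisted_def .
qed

context
  fixes I :: "'i set" and P :: "'i \<Rightarrow> 'p set" and w :: "'p \<Rightarrow> nat" and E :: "'p \<Rightarrow> 'e set"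
    and s :: "'i \<Rightarrow> 'k::field_char_0" and u :: "'p \<Rightarrow> 'e \<Rightarrow> 'k" and \<alpha> :: "'p \<Rightarrow> 'e \<Rightarrow> nat"
    and T :: "'i \<Rightarrow> ('p, 'e, 'k) hforest fps"
  assumes w: "\<And>p. p \<in> (\<Union>i\<in>I. P i) \<Longrightarrow> w p \<ge> 1"
    and u: "\<And>p. p \<in> (\<Union>i\<in>I. P i) \<Longrightarrow> (\<Sum>e\<in>E p. u p e) = 1"
    and \<alpha>: "\<And>p. p \<in> (\<Union>i\<in>I. P i) \<Longrightarrow> (\<Sum>e\<in>E p. \<alpha> p e) = w p"
    and DSE: "combinatorial_DSE_solution I P E s u \<alpha> T"
begin

private abbreviation (input) "Q \<equiv> invariant_charge I s T"

text \<open>\<open>R\<close> is Q / x, and \<open>V i p\<close> below is the argument of the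
  grafting operator freed from its power of x. Keeping that power apart allows it to be restored
  last, raising the level of a congruence.\<close>

private definition "R = (\<Prod>j\<in>I. fps_pow (T j) (s j))"

private definition "V i p = (\<Prod>e\<in>E p. fps_pow (fps_map (incl e) (T i)) (u p e) *
  (\<Prod>j\<in>I. fps_pow (fps_map (incl e) (T j)) (s j)) ^ \<alpha> p e)"

private definition "W i p = fps_X ^ w p * V i p"

private lemma Q_eq: "Q = fps_X * R"
  by (simp add: invariant_charge_def R_def)

private lemma Q_nth: "Q $ 0 = 0" "Q $ 1 = 1"
proof -
  have "R $ 0 = 1"
    unfolding R_def by (induction I rule: infinite_finite_induct) simp_all
  then show "Q $ 0 = 0" "Q $ 1 = 1"
    by (simp_all add: Q_eq)
qed

text \<open>Through Q the edge e contributes x to the power \<alpha>_e, and these exponents add up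
  to the weight of p.\<close>

private lemma has_sum_T:
  assumes i: "i \<in> I"
  shows "((\<lambda>p. fps_map (B_plus p) (W i p)) has_sum (T i - 1)) (P i)"
proof -
  have "fps_map (B_plus p) (\<Prod>e\<in>E p. fps_map (incl e) (fps_pow (T i) (u p e) * invariant_charge I s T ^ \<alpha> p e)) =
    fps_map (B_plus p) (W i p)" if "p \<in> P i" for p
  proof -
    have "fps_map (incl e) (fps_pow (T i) (u p e) * invariant_charge I s T ^ \<alpha> p e) =
      fps_X ^ \<alpha> p e * (fps_pow (fps_map (incl e) (T i)) (u p e) * (\<Prod>j\<in>I. fps_pow (fps_map (incl e) (T j)) (s j)) ^ \<alpha> p e)" for e
      by (simp add: invariant_charge_def fps_map_ring_hom[OF alg_hom_incl] fps_map_pow[OF alg_hom_incl]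
        power_mult_distrib mult_ac)
    then have "(\<Prod>e\<in>E p. fps_map (incl e) (fps_pow (T i) (u p e) * invariant_charge I s T ^ \<alpha> p e)) =
      fps_X ^ (\<Sum>e\<in>E p. \<alpha> p e) * V i p"
      by (simp only: prod.distrib power_sum V_def)
    moreover have "(\<Sum>e\<in>E p. \<alpha> p e) = w p"
      using i that by (intro \<alpha>) blast
    ultimately show ?thesis
      by (simp add: W_def)
  qed
  moreover have "((\<lambda>p. fps_map (B_plus p) (\<Prod>e\<in>E p. fps_map (incl e) (fps_pow (T i) (u p e) * invariant_charge I s T ^ \<alpha> p e)))
    has_sum (T i - 1)) (P i)"
    using DSE i by (simp add: combinatorial_DSE_solution_def)
  ultimately show ?thesis
    by (subst (asm) has_sum_cong) auto
qed

private lemma T_cong: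
  assumes "i \<in> I"
  shows "\<exists>F. F \<subseteq> P i \<and> fps_cong n (\<Sum>p\<in>F. fps_map (B_plus p) (W i p)) (T i - 1)"
  using has_sum_fps_cong[OF has_sum_T[OF assms]] by blast

private lemma T_nth_0:
  assumes i: "i \<in> I"
  shows "T i $ 0 = 1"
proof -
  obtain F where F: "F \<subseteq> P i" "fps_cong 1 (\<Sum>p\<in>F. fps_map (B_plus p) (W i p)) (T i - 1)"
    using T_cong[OF i] by blast
  have "(\<Sum>p\<in>F. fps_map (B_plus p) (W i p)) $ 0 = 0"
    unfolding fps_sum_nth
  proof (intro sum.neutral ballI)
    fix p assume "p \<in> F"
    then have "w p \<ge> 1"
      using F(1) i by (intro w) blast
    then show "fps_map (B_plus p) (W i p) $ 0 = 0"
      by (simp add: W_def zero_power linD(3)[OF lin_B_plus])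
  qed
  then show ?thesis
    using F(2) by (simp add: fps_cong_def)
qed

text \<open>From level n to level n + 1: the extra order comes from x^w with w \<ge> 1, and it
  closes the induction in \<open>coproduct_T\<close>.\<close>

private lemma W_twisted:
  assumes i: "i \<in> I" and p: "p \<in> P i"
    and T: "\<And>j. j \<in> I \<Longrightarrow> fps_cong n (fps_map forest_coprod (T j)) (left_fps (T j) * (right_fps (T j) oo left_fps Q))"
  shows "fps_cong (Suc n) (fps_map forest_coaction (W i p)) (left_fps (T i) * (right_fps (W i p) oo left_fps Q))"
proof -
  let ?q = "left_fps Q :: ((('p, 'e) forest \<times> ('e \<Rightarrow>\<^sub>0 ('p, 'e) forest)) \<Rightarrow>\<^sub>0 'k) fps"
  let ?T = "\<lambda>j. left_fps (T j) :: ((('p, 'e) forest \<times> ('e \<Rightarrow>\<^sub>0 ('p, 'e) forest)) \<Rightarrow>\<^sub>0 'k) fps"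
  have pU: "p \<in> (\<Union>i\<in>I. P i)"
    using i p by blast
  have q: "?q $ 0 = 0"
    using Q_nth(1) by (simp add: linD(3)[OF lin_alg_hom[OF alg_hom_tensor_left]])
  have T0: "?T j $ 0 = 1" "(right_fps (fps_map (incl e) (T j)) :: ((('p, 'e) forest \<times> ('e \<Rightarrow>\<^sub>0 ('p, 'e) forest)) \<Rightarrow>\<^sub>0 'k) fps) $ 0 = 1"
    if "j \<in> I" for j and e :: 'e
    using T_nth_0[OF that] by (simp_all add: tensor_one alg_homD(1)[OF alg_hom_incl])
  \<comment> \<open>The assumed relation for T_j, after id \<otimes> \<open>incl e\<close> has moved
    its right factor into the e-th place of the tensor power.\<close>
  have base: "twisted ?q n (fps_map forest_coaction (fps_map (incl e) (T j))) (?T j) (right_fps (fps_map (incl e) (T j)))"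
    if "j \<in> I" for j and e :: 'e
    using fps_cong_map[OF T[OF that], of "tensor_map (\<lambda>x. x) (incl e)"]
    unfolding twisted_def fps_map_tensor_map[OF lin_alg_hom[OF alg_hom_incl] Q_nth(1)] fps_map_comp forest_coaction_incl .
  let ?t = "\<Prod>e\<in>E p. fps_pow (?T i) (u p e) * (\<Prod>j\<in>I. fps_pow (?T j) (s j)) ^ \<alpha> p e"
  have "twisted ?q n (fps_map forest_coaction (V i p)) ?t (right_fps (V i p))"
    unfolding V_def fps_map_ring_hom[OF alg_hom_forest_coaction] fps_map_pow[OF alg_hom_forest_coaction]
      fps_map_ring_hom[OF alg_hom_tensor_right] fps_map_pow[OF alg_hom_tensor_right]
    by (intro twisted_prod twisted_mult twisted_power twisted_fps_pow q base T0 i)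
  \<comment> \<open>The exponents u_e add up to 1 and the \<alpha>_e to w, while the left tensor
    factor does not depend on e.\<close>
  also have "?t = ?T i * left_fps R ^ w p"
    by (simp add: prod.distrib R_def fps_map_ring_hom[OF alg_hom_tensor_left] fps_map_pow[OF alg_hom_tensor_left]
      flip: fps_pow_sum[OF T0(1)[OF i]] power_sum)
      (simp add: u[OF pU] \<alpha>[OF pU] fps_pow_1[OF T0(1)[OF i]])
  finally have "fps_cong (n + w p) (fps_X ^ w p * fps_map forest_coaction (V i p))
      (fps_X ^ w p * (?T i * left_fps R ^ w p * (right_fps (V i p) oo ?q)))"
    unfolding twisted_def by (rule fps_cong_X_power_mult)
  moreover have "fps_X ^ w p * fps_map forest_coaction (V i p) = fps_map forest_coaction (W i p)"
    by (simp add: W_def fps_map_ring_hom[OF alg_hom_forest_coaction])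
  moreover have "fps_X ^ w p * (?T i * left_fps R ^ w p * (right_fps (V i p) oo ?q)) = ?T i * (right_fps (W i p) oo ?q)"
  proof -
    have "?q = fps_X * left_fps R"
      by (simp add: Q_eq fps_map_ring_hom[OF alg_hom_tensor_left])
    \<comment> \<open>Substituting Q for x produces exactly the surplus factor R^w of
      \<open>?t\<close>.\<close>
    then have "fps_X ^ w p oo ?q = fps_X ^ w p * left_fps R ^ w p"
      using q by (simp add: compose_power power_mult_distrib)
    then show ?thesis
      by (simp add: W_def fps_map_ring_hom[OF alg_hom_tensor_right] compose_mult[OF q] mult_ac)
  qed
  ultimately have "fps_cong (n + w p) (fps_map forest_coaction (W i p)) (?T i * (right_fps (W i p) oo ?q))"
    by simp
  then show ?thesis
    by (rule fps_cong_mono) (use w[OF pU] in simp)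
qed

lemma coproduct_T:
  assumes "i \<in> I"
  shows "fps_map forest_coprod (T i) = left_fps (T i) * (right_fps (T i) oo left_fps Q)"
proof (rule fps_eq_by_cong)
  fix n
  show "fps_cong n (fps_map forest_coprod (T i)) (left_fps (T i) * (right_fps (T i) oo left_fps Q))"
    using assms
  proof (induction n arbitrary: i)
    case 0
    then show ?case by (simp add: fps_cong_def)
  next
    case (Suc n)
    note i = Suc.prems
    note \<Delta> = fps_map_ring_hom[OF alg_hom_forest_coprod] and left = fps_map_ring_hom[OF alg_hom_tensor_left]
      and right = fps_map_ring_hom[OF alg_hom_tensor_right]
    let ?q = "left_fps Q :: ((('p, 'e) forest \<times> ('p, 'e) forest) \<Rightarrow>\<^sub>0 'k) fps"
    obtain F where F: "F \<subseteq> P i" and S: "fps_cong (Suc n) (\<Sum>p\<in>F. fps_map (B_plus p) (W i p)) (T i - 1)"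
      using T_cong[OF i] by blast
    let ?S = "\<Sum>p\<in>F. fps_map (B_plus p) (W i p)"
    have "fps_map forest_coprod (T i) = 1 + fps_map forest_coprod (T i - 1)"
      by (simp add: \<Delta>)
    also have "fps_cong (Suc n) \<dots> (1 + fps_map forest_coprod ?S)"
      by (intro fps_cong_add fps_cong_refl fps_cong_map fps_cong_sym[OF S])
    also have "fps_map forest_coprod ?S = left_fps ?S +
        (\<Sum>p\<in>F. fps_map (tensor_map (\<lambda>x. x) (B_plus p)) (fps_map forest_coaction (W i p)))"
      unfolding fps_map_lin(3)[OF lin_alg_hom[OF alg_hom_forest_coprod]] fps_map_lin(3)[OF lin_alg_hom[OF alg_hom_tensor_left]]
        sum.distrib[symmetric]
      by (intro sum.cong refl) (simp add: fps_eq_iff B_plus_cocycle)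
    \<comment> \<open>The induction hypothesis at level n enters here, and \<open>W_twisted\<close>
      converts it to level n + 1.\<close>
    also have "fps_cong (Suc n) (1 + \<dots>) (1 + (left_fps (T i - 1) +
        (\<Sum>p\<in>F. fps_map (tensor_map (\<lambda>x. x) (B_plus p)) (left_fps (T i) * (right_fps (W i p) oo left_fps Q)))))"
      using F i by (intro fps_cong_add fps_cong_refl fps_cong_map S fps_cong_sum W_twisted Suc.IH) blast+
    also have "(\<Sum>p\<in>F. fps_map (tensor_map (\<lambda>x. x) (B_plus p)) (left_fps (T i) * (right_fps (W i p) oo left_fps Q))) =
        left_fps (T i) * (right_fps ?S oo ?q)"
      by (simp add: fps_map_tensor_map[OF lin_B_plus Q_nth(1)] fps_map_lin(3)[OF lin_alg_hom[OF alg_hom_tensor_right]]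
        fps_compose_sum_distrib sum_distrib_left)
    also have "fps_cong (Suc n) (1 + (left_fps (T i - 1) + \<dots>))
        (1 + (left_fps (T i - 1) + left_fps (T i) * (right_fps (T i - 1) oo ?q)))"
      by (intro fps_cong_add fps_cong_mult fps_cong_compose fps_cong_refl fps_cong_map S)
    \<comment> \<open>The initial 1 completes the terms from B \<otimes> 1 to T_i \<otimes> 1, which
      cancels the contribution of -1 under the composition.\<close>
    also have "\<dots> = left_fps (T i) * (right_fps (T i) oo ?q)"
      by (simp add: left right fps_compose_sub_distrib algebra_simps)
    finally show ?case .
  qed
qed

text \<open>The multipliers of the T_j, raised to the powers s_j, multiply to Q / x in the left
  factor. With the leading x this is Q \<otimes> 1, that is, x composed with Q \<otimes> 1, so no
  multiplier remains.\<close>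

lemma coproduct_Q: "fps_map forest_coprod Q = right_fps Q oo left_fps Q"
proof -
  let ?q = "left_fps Q :: ((('p, 'e) forest \<times> ('p, 'e) forest) \<Rightarrow>\<^sub>0 'k) fps"
  have q: "?q $ 0 = 0"
    using Q_nth(1) by (simp add: linD(3)[OF lin_alg_hom[OF alg_hom_tensor_left]])
  have T0: "(left_fps (T j) :: ((('p, 'e) forest \<times> ('p, 'e) forest) \<Rightarrow>\<^sub>0 'k) fps) $ 0 = 1"
    "(right_fps (T j) :: ((('p, 'e) forest \<times> ('p, 'e) forest) \<Rightarrow>\<^sub>0 'k) fps) $ 0 = 1" if "j \<in> I" for j
    using T_nth_0[OF that] by (simp_all add: tensor_one)
  have "fps_map forest_coprod Q = fps_X * (\<Prod>j\<in>I. fps_pow (fps_map forest_coprod (T j)) (s j))"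
    by (simp add: invariant_charge_def fps_map_ring_hom[OF alg_hom_forest_coprod] fps_map_pow[OF alg_hom_forest_coprod])
  also have "(\<Prod>j\<in>I. fps_pow (fps_map forest_coprod (T j)) (s j)) =
      (\<Prod>j\<in>I. fps_pow (left_fps (T j)) (s j) * (fps_pow (right_fps (T j)) (s j) oo ?q))"
  proof (intro prod.cong refl)
    fix j assume j: "j \<in> I"
    show "fps_pow (fps_map forest_coprod (T j)) (s j) =
        fps_pow (left_fps (T j)) (s j) * (fps_pow (right_fps (T j)) (s j) oo ?q)"
      unfolding coproduct_T[OF j] fps_pow_compose[OF T0(2)[OF j] q, symmetric]
      by (rule fps_pow_mult) (use T0[OF j] in simp_all)
  qed
  also have "fps_X * \<dots> = (fps_X oo ?q) * ((\<Prod>j\<in>I. fps_pow (right_fps (T j)) (s j)) oo ?q)"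
    using q by (simp add: prod.distrib compose_prod mult.assoc) (simp add: invariant_charge_def
      fps_map_ring_hom[OF alg_hom_tensor_left] fps_map_pow[OF alg_hom_tensor_left] mult.assoc)
  also have "\<dots> = (fps_X * (\<Prod>j\<in>I. fps_pow (right_fps (T j)) (s j))) oo ?q"
    by (rule compose_mult[OF q, symmetric])
  also have "fps_X * (\<Prod>j\<in>I. fps_pow (right_fps (T j)) (s j)) = right_fps Q"
    by (simp add: invariant_charge_def fps_map_ring_hom[OF alg_hom_tensor_right] fps_map_pow[OF alg_hom_tensor_right])
  finally show ?thesis .
qed

text \<open>A grafted tree has a root and is never empty, so the counit kills the image of every
  grafting operator and leaves the 1 of the system.\<close>

lemma counit_T:
  assumes i: "i \<in> I"
  shows "fps_map (\<lambda>f. Poly_Mapping.single (0::nat) (forest_counit f)) (T i) = 1"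
proof (rule fps_eq_by_cong)
  fix n
  let ?\<epsilon> = "\<lambda>f :: ('p, 'e, 'k) hforest. Poly_Mapping.single (0::nat) (forest_counit f)"
  note \<epsilon> = linD[OF lin_alg_hom[OF alg_hom_forest_counit]]
  have B: "?\<epsilon> (B_plus p f) = 0" for p and f :: "('e \<Rightarrow>\<^sub>0 ('p, 'e) forest) \<Rightarrow>\<^sub>0 'k"
  proof -
    have "(\<lambda>f :: ('e \<Rightarrow>\<^sub>0 ('p, 'e) forest) \<Rightarrow>\<^sub>0 'k. ?\<epsilon> (B_plus p f)) = (\<lambda>_. 0)"
    proof (rule lin_eq)
      show "lin (\<lambda>f :: ('e \<Rightarrow>\<^sub>0 ('p, 'e) forest) \<Rightarrow>\<^sub>0 'k. ?\<epsilon> (B_plus p f))"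
        by (rule lin_comp[OF lin_alg_hom[OF alg_hom_forest_counit] lin_B_plus])
      fix F :: "'e \<Rightarrow>\<^sub>0 ('p, 'e) forest"
      have "is_forest (add_root p (\<lambda>e. rep_of (Poly_Mapping.lookup F e)))"
        by (rule is_forest_add_root[OF is_forest_rep_of finite_keys[of F]]) (simp add: in_keys_iff verts_rep_of_0)
      then have "forest_of (add_root p (\<lambda>e. rep_of (Poly_Mapping.lookup F e))) \<noteq> 0"
        by (simp add: forest_of_eq_0_iff verts_add_root)
      then show "?\<epsilon> (B_plus p (Poly_Mapping.single F 1)) = 0"
        by (simp add: B_plus_def forest_counit_def lookup_single when_def)
    qed (rule linI, simp_all)
    then show ?thesis by (rule fun_cong)
  qed
  obtain F where "fps_cong n (\<Sum>p\<in>F. fps_map (B_plus p) (W i p)) (T i - 1)"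
    using T_cong[OF i] by blast
  from fps_cong_map[OF this, of ?\<epsilon>]
  have "fps_cong n 0 (fps_map ?\<epsilon> (T i) - 1)"
    by (simp add: fps_map_lin(3)[OF lin_alg_hom[OF alg_hom_forest_counit]] fps_map_comp B
      fps_map_ring_hom[OF alg_hom_forest_counit] fps_map_def[of "\<lambda>_. 0"] fps_zero_def[symmetric])
  from fps_cong_add[OF this fps_cong_refl[of n 1]] show "fps_cong n (fps_map ?\<epsilon> (T i)) 1"
    by (simp add: fps_cong_sym)
qed

lemma counit_Q: "fps_map (\<lambda>f. Poly_Mapping.single (0::nat) (forest_counit f)) Q = fps_X"
proof -
  have "fps_pow (1 :: (nat \<Rightarrow>\<^sub>0 'k) fps) a = 1" for a
    by (rule fps_pow_unique[symmetric]) simp_all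
  then show ?thesis
    by (simp add: invariant_charge_def fps_map_ring_hom[OF alg_hom_forest_counit] fps_map_pow[OF alg_hom_forest_counit] counit_T)
qed

lemma T_over_PE_space:
  assumes "i \<in> I"
  shows "T i \<in> fps_over (PE_space (\<Union>j\<in>I. P j) E)"
  using DSE assms by (simp add: combinatorial_DSE_solution_def fps_over_def)

lemma Q_over_PE_space: "Q \<in> fps_over (PE_space (\<Union>j\<in>I. P j) E)"
  unfolding invariant_charge_def
  by (intro fps_overD[OF subalg_PE_space] T_over_PE_space)

section \<open>The morphism from the Riordan algebra\<close>

context
  fixes i :: 'i
  assumes i: "i \<in> I"
begin

text \<open>Two shifts meet here: \<open>VPi m\<close> is \<pi> with index m + 1, which is the
  coefficient of x^(m+2) in \<Pi>; \<open>VY m\<close> is y with index m + 1.\<close>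

lemma rio_hom_gen:
  assumes \<phi>: "alg_hom \<phi>" "fps_map \<phi> rio_Y = T i" "fps_map \<phi> rio_Pi = Q"
  shows "\<phi> (rio_gen (VPi m)) = Q $ (m + 2)" "\<phi> (rio_gen (VY m)) = T i $ Suc m"
  using arg_cong[OF \<phi>(2), of "\<lambda>f. f $ Suc m"] arg_cong[OF \<phi>(3), of "\<lambda>f. f $ (m + 2)"]
  by (simp_all add: rio_Y_def rio_y_def rio_Pi_def rio_pi_def)

lemma rio_hom_exists_unique:
  "\<exists>!\<phi> :: 'k rio \<Rightarrow> ('p, 'e, 'k) hforest. alg_hom \<phi> \<and> fps_map \<phi> rio_Y = T i \<and> fps_map \<phi> rio_Pi = Q"
proof (rule ex_ex1I)
  define g where "g v = (case v of VPi m \<Rightarrow> Q $ (m + 2) | VY m \<Rightarrow> T i $ Suc m)" for v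
  have \<phi>: "alg_hom (poly_eval g)"
    by (rule alg_hom_poly_eval)
  have gen: "poly_eval g (rio_gen v) = g v" for v
    unfolding rio_gen_def by (rule poly_eval_var)
  \<comment> \<open>Besides the free generators the normalised coefficients must match: y_0 =
    \<pi>_0 = 1 and the missing constant term of \<Pi> correspond to \<open>T_nth_0\<close> and
    \<open>Q_nth\<close>.\<close>
  have "fps_map (poly_eval g) rio_Y $ n = T i $ n" for n
    by (cases n) (simp_all add: rio_Y_def rio_y_def gen g_def T_nth_0[OF i] alg_homD(1)[OF \<phi>])
  moreover have "fps_map (poly_eval g) rio_Pi $ n = Q $ n" for n
  proof (cases n)
    case (Suc m)
    then show ?thesis
      using Q_nth by (cases m) (simp_all add: rio_Pi_def rio_pi_def gen g_def alg_homD(1)[OF \<phi>])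
  qed (use Q_nth in \<open>simp add: rio_Pi_def linD(3)[OF lin_alg_hom[OF \<phi>]]\<close>)
  ultimately show "\<exists>\<phi> :: 'k rio \<Rightarrow> ('p, 'e, 'k) hforest. alg_hom \<phi> \<and> fps_map \<phi> rio_Y = T i \<and> fps_map \<phi> rio_Pi = Q"
    using \<phi> unfolding fps_eq_iff by blast
next
  fix \<phi> \<psi> :: "'k rio \<Rightarrow> ('p, 'e, 'k) hforest"
  assume \<phi>: "alg_hom \<phi> \<and> fps_map \<phi> rio_Y = T i \<and> fps_map \<phi> rio_Pi = Q"
    and \<psi>: "alg_hom \<psi> \<and> fps_map \<psi> rio_Y = T i \<and> fps_map \<psi> rio_Pi = Q"
  have "\<phi> (rio_gen v) = \<psi> (rio_gen v)" for v
    by (cases v) (simp_all add: rio_hom_gen \<phi> \<psi>)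
  then show "\<phi> = \<psi>"
    using \<phi> \<psi> by (intro alg_hom_eq) (simp_all add: rio_gen_def)
qed

context
  fixes \<phi> :: "'k rio \<Rightarrow> ('p, 'e, 'k) hforest"
  assumes \<phi>: "alg_hom \<phi>" "fps_map \<phi> rio_Y = T i" "fps_map \<phi> rio_Pi = Q"
begin

lemma rio_hom_range: "range \<phi> \<subseteq> PE_space (\<Union>j\<in>I. P j) E"
proof -
  let ?A = "PE_space (\<Union>j\<in>I. P j) E :: ('p, 'e, 'k) hforest set"
  note A = subalgD[OF subalg_PE_space]
  have gen: "\<phi> (rio_gen v) \<in> ?A" for v
    using T_over_PE_space[OF i] Q_over_PE_space
    by (cases v) (simp_all add: rio_hom_gen[OF \<phi>] fps_over_def)
  have pow: "f ^ n \<in> ?A" if "f \<in> ?A" for f n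
    using that by (induction n) (simp_all add: A)
  have prod: "(\<Prod>v\<in>V. h v) \<in> ?A" if "\<And>v. h v \<in> ?A" for V :: "rio_var set" and h
    using that by (induction V rule: infinite_finite_induct) (simp_all add: A)
  \<comment> \<open>Written as an evaluation, \<phi> has values that are polynomials in the images
    of the generators, and these images lie in the subalgebra.\<close>
  have "\<phi> = poly_eval (\<lambda>v. \<phi> (rio_gen v))"
    by (rule alg_hom_eq[OF \<phi>(1) alg_hom_poly_eval], subst poly_eval_var) (simp add: rio_gen_def)
  moreover have "poly_eval (\<lambda>v. \<phi> (rio_gen v)) f \<in> ?A" for f
    unfolding poly_eval_def lin_ext_def by (intro A(8,6) prod pow gen)
  ultimately show ?thesis by auto
qed

text \<open>Both sides are algebra morphisms on a polynomial algebra. On generators they agree by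
  comparing coefficients in \<open>coproduct_Q\<close> and \<open>coproduct_T\<close>.\<close>

lemma rio_hom_coprod: "forest_coprod (\<phi> f) = tensor_map \<phi> \<phi> (rio_coprod f)"
proof -
  have \<phi>\<phi>: "alg_hom (tensor_map \<phi> \<phi>)"
    by (rule alg_hom_tensor_map[OF \<phi>(1) \<phi>(1)])
  have rio: "alg_hom (rio_coprod :: 'k rio \<Rightarrow> _)"
    unfolding rio_coprod_def by (rule alg_hom_poly_eval)
  have map: "tensor_map \<phi> \<phi> (tensor f g) = tensor (\<phi> f) (\<phi> g)" for f g
    by (rule tensor_map_tensor[OF lin_alg_hom[OF \<phi>(1)] lin_alg_hom[OF \<phi>(1)]])
  have nth: "\<phi> (f $ n) = fps_map \<phi> f $ n" for f n
    by simp
  have pi: "\<phi> (rio_pi n) = Q $ Suc n" and y: "\<phi> (rio_y n) = T i $ n" for n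
    by (simp_all add: \<phi>(2,3)[symmetric] rio_Pi_def rio_Y_def)
  note hom = fps_map_ring_hom[OF \<phi>(1)]
  have \<Delta>pi: "forest_coprod (Q $ Suc n) = tensor_map \<phi> \<phi> (rio_coprod_pi n)" for n
  proof -
    have "forest_coprod (Q $ Suc n) = (left_fps 1 * (right_fps Q oo left_fps Q)) $ Suc n"
      by (simp add: fps_map_ring_hom[OF alg_hom_tensor_left] flip: coproduct_Q)
    also have "\<dots> = (\<Sum>j\<le>Suc n. tensor ((Q ^ j) $ Suc n) (Q $ j))"
      by (simp only: tensor_compose_nth[OF Q_nth(1)] mult_1_left)
    \<comment> \<open>The term j = 0 vanishes because Q has no constant term, and j = k + 1 since
      \<pi>_k is the coefficient of x^(k+1).\<close>
    also have "\<dots> = (\<Sum>k\<le>n. tensor ((Q ^ Suc k) $ Suc n) (Q $ Suc k))"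
      unfolding sum.atMost_Suc_shift by (simp add: Q_nth(1) linD(3)[OF lin_tensor_right[OF lin_id]] del: power_Suc)
    also have "\<dots> = tensor_map \<phi> \<phi> (rio_coprod_pi n)"
      unfolding rio_coprod_pi_def linD(4)[OF lin_tensor_map] map pi unfolding nth hom \<phi>(3) by simp
    finally show ?thesis .
  qed
  have \<Delta>y: "forest_coprod (T i $ n) = tensor_map \<phi> \<phi> (rio_coprod_y n)" for n
  proof -
    have "forest_coprod (T i $ n) = (left_fps (T i) * (right_fps (T i) oo left_fps Q)) $ n"
      by (simp flip: coproduct_T[OF i])
    also have "\<dots> = (\<Sum>j\<le>n. tensor ((T i * Q ^ j) $ n) (T i $ j))"
      by (rule tensor_compose_nth[OF Q_nth(1)])
    also have "\<dots> = tensor_map \<phi> \<phi> (rio_coprod_y n)"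
      unfolding rio_coprod_y_def linD(4)[OF lin_tensor_map] map y unfolding nth hom \<phi>(2,3) by simp
    finally show ?thesis .
  qed
  have "(\<lambda>f. forest_coprod (\<phi> f)) = (\<lambda>f. tensor_map \<phi> \<phi> (rio_coprod f))"
  proof (rule alg_hom_eq)
    show "alg_hom (\<lambda>f. forest_coprod (\<phi> f))"
      by (rule alg_hom_comp[OF alg_hom_forest_coprod \<phi>(1)])
    show "alg_hom (\<lambda>f. tensor_map \<phi> \<phi> (rio_coprod f))"
      by (rule alg_hom_comp[OF \<phi>\<phi> rio])
    fix v :: rio_var
    have "rio_coprod (rio_gen v :: 'k rio) = (case v of VPi n \<Rightarrow> rio_coprod_pi (Suc n) | VY n \<Rightarrow> rio_coprod_y (Suc n))"
      unfolding rio_coprod_def rio_gen_def by (rule poly_eval_var)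
    then show "forest_coprod (\<phi> (Poly_Mapping.single (Poly_Mapping.single v 1) 1)) =
        tensor_map \<phi> \<phi> (rio_coprod (Poly_Mapping.single (Poly_Mapping.single v 1) 1))"
      unfolding rio_gen_def[symmetric]
      by (cases v) (simp_all add: rio_hom_gen[OF \<phi>] flip: \<Delta>pi \<Delta>y)
  qed
  then show ?thesis by (rule fun_cong)
qed

lemma rio_hom_counit: "forest_counit (\<phi> f) = rio_counit f"
proof -
  let ?\<epsilon> = "\<lambda>f :: ('p, 'e, 'k) hforest. Poly_Mapping.single (0::nat) (forest_counit f)"
  have "(\<lambda>f. ?\<epsilon> (\<phi> f)) = (\<lambda>f. Poly_Mapping.single (0::nat) (rio_counit f))"
  proof (rule alg_hom_eq)
    show "alg_hom (\<lambda>f. ?\<epsilon> (\<phi> f))"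
      by (rule alg_hom_comp[OF alg_hom_forest_counit \<phi>(1)])
    show "alg_hom (\<lambda>f :: 'k rio. Poly_Mapping.single (0::nat) (rio_counit f))"
    proof (rule alg_homI)
      show "lin (\<lambda>f :: 'k rio. Poly_Mapping.single (0::nat) (rio_counit f))"
        by (rule linI) (simp_all add: rio_counit_def lookup_add single_add)
      have "a + b = 0 \<longleftrightarrow> a = 0 \<and> b = 0" for a b :: "rio_var \<Rightarrow>\<^sub>0 nat"
        by (auto simp: poly_mapping_eq_iff fun_eq_iff lookup_add)
      then show "Poly_Mapping.single (0::nat) (rio_counit (Poly_Mapping.single (a + b) 1)) =
        Poly_Mapping.single 0 (rio_counit (Poly_Mapping.single a 1)) * Poly_Mapping.single 0 (rio_counit (Poly_Mapping.single b (1::'k)))"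
        for a b :: "rio_var \<Rightarrow>\<^sub>0 nat"
        by (auto simp: rio_counit_def lookup_single when_def mult_single)
    qed (simp add: rio_counit_def)
    fix v :: rio_var
    have "Poly_Mapping.single v (1::nat) \<noteq> 0"
      by (metis lookup_single_eq lookup_zero one_neq_zero)
    then have "rio_counit (rio_gen v :: 'k rio) = 0"
      by (simp add: rio_counit_def rio_gen_def lookup_single when_def)
    moreover have "?\<epsilon> (\<phi> (rio_gen v)) = 0"
      using arg_cong[OF counit_Q, of "\<lambda>f. f $ (m + 2)" for m] arg_cong[OF counit_T[OF i], of "\<lambda>f. f $ Suc m" for m]
      by (cases v) (simp_all add: rio_hom_gen[OF \<phi>])
    ultimately show "?\<epsilon> (\<phi> (Poly_Mapping.single (Poly_Mapping.single v 1) 1)) =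
      Poly_Mapping.single 0 (rio_counit (Poly_Mapping.single (Poly_Mapping.single v 1) 1))"
      by (simp add: rio_gen_def)
  qed
  then have "?\<epsilon> (\<phi> f) = Poly_Mapping.single (0::nat) (rio_counit f)"
    by (rule fun_cong)
  from arg_cong[OF this, of "\<lambda>f. Poly_Mapping.lookup f 0"] show ?thesis
    by simp
qed

lemma rio_hom_bialg_hom: "bialg_hom rio_coprod rio_counit forest_coprod forest_counit \<phi>"
  using \<phi>(1) rio_hom_coprod rio_hom_counit by (simp add: bialg_hom_def)

end

end

end


section \<open>The infinitesimal form of the cocycle condition\<close>

text \<open>The sum of all partial derivatives d/dL_e. Truncated subtraction of exponents is
  harmless since e runs over variables that occur in the monomial.\<close>

definition KL_grad :: "(('e \<Rightarrow>\<^sub>0 nat) \<Rightarrow>\<^sub>0 'k::comm_ring_1) \<Rightarrow> (('e \<Rightarrow>\<^sub>0 nat) \<Rightarrow>\<^sub>0 'k)" where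
  "KL_grad = lin_ext (\<lambda>\<alpha>. \<Sum>e\<in>Poly_Mapping.keys \<alpha>.
     Poly_Mapping.single (\<alpha> - Poly_Mapping.single e 1) (of_nat (Poly_Mapping.lookup \<alpha> e)))"

lemma lin_KL_grad: "lin KL_grad"
  unfolding KL_grad_def by (rule lin_lin_ext)

lemma lin_KL_deriv: "lin KL_deriv"
  unfolding KL_deriv_def by (rule lin_lin_ext)

lemma KL_deriv_mult: "KL_deriv (f * g) = KL_deriv f * g + f * KL_deriv g"
proof (rule derivationI[OF lin_KL_deriv])
  fix a b :: nat
  show "KL_deriv (Poly_Mapping.single (a + b) 1) =
    KL_deriv (Poly_Mapping.single a 1) * Poly_Mapping.single b 1 + Poly_Mapping.single a 1 * (KL_deriv (Poly_Mapping.single b 1) :: nat \<Rightarrow>\<^sub>0 'a)"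
    by (cases a; cases b) (simp_all add: KL_deriv_def lin_ext_one mult_single single_add[symmetric] add.commute)
qed

lemma KL_grad_single:
  assumes "finite A" "Poly_Mapping.keys \<alpha> \<subseteq> A"
  shows "KL_grad (Poly_Mapping.single \<alpha> 1) = (\<Sum>e\<in>A.
    Poly_Mapping.single (\<alpha> - Poly_Mapping.single e 1) (of_nat (Poly_Mapping.lookup \<alpha> e)))"
  unfolding KL_grad_def lin_ext_single smul_one
  by (rule sum.mono_neutral_left) (use assms in \<open>auto simp: in_keys_iff\<close>)

lemma KL_grad_mult: "KL_grad (f * g) = KL_grad f * g + f * KL_grad g"
proof (rule derivationI[OF lin_KL_grad])
  fix a b :: "'a \<Rightarrow>\<^sub>0 nat"
  define A where "A = Poly_Mapping.keys a \<union> Poly_Mapping.keys b"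
  have A: "finite A" "Poly_Mapping.keys a \<subseteq> A" "Poly_Mapping.keys b \<subseteq> A" "Poly_Mapping.keys (a + b) \<subseteq> A"
    using keys_add[of a b] by (auto simp: A_def)
  \<comment> \<open>If e does not occur in a, both coefficients are 0; otherwise truncated
    subtraction commutes with adding b.\<close>
  have shift: "Poly_Mapping.single (a - Poly_Mapping.single e 1 + b) (of_nat (Poly_Mapping.lookup a e)) =
      Poly_Mapping.single (a + b - Poly_Mapping.single e 1) (of_nat (Poly_Mapping.lookup a e) :: 'b)" for a b :: "'a \<Rightarrow>\<^sub>0 nat" and e
  proof (cases "Poly_Mapping.lookup a e = 0")
    case False
    then have "a - Poly_Mapping.single e 1 + b = a + b - Poly_Mapping.single e 1"
      by (intro poly_mapping_eqI) (auto simp: lookup_add lookup_minus lookup_single when_def)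
    then show ?thesis by simp
  qed simp
  show "KL_grad (Poly_Mapping.single (a + b) 1) =
    KL_grad (Poly_Mapping.single a 1) * Poly_Mapping.single b 1 + Poly_Mapping.single a 1 * (KL_grad (Poly_Mapping.single b 1) :: ('a \<Rightarrow>\<^sub>0 nat) \<Rightarrow>\<^sub>0 'b)"
    unfolding KL_grad_single[OF A(1,2)] KL_grad_single[OF A(1,3)] KL_grad_single[OF A(1,4)]
      sum_distrib_left sum_distrib_right sum.distrib[symmetric]
  proof (intro sum.cong refl)
    fix e
    show "Poly_Mapping.single (a + b - Poly_Mapping.single e 1) (of_nat (Poly_Mapping.lookup (a + b) e)) =
      Poly_Mapping.single (a - Poly_Mapping.single e 1) (of_nat (Poly_Mapping.lookup a e)) * Poly_Mapping.single b 1 +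
      Poly_Mapping.single a 1 * (Poly_Mapping.single (b - Poly_Mapping.single e 1) (of_nat (Poly_Mapping.lookup b e)) :: ('a \<Rightarrow>\<^sub>0 nat) \<Rightarrow>\<^sub>0 'b)"
      using shift[of a e b] shift[of b e a]
      by (simp add: mult_single lookup_add single_add add.commute)
  qed
qed

text \<open>Only L_e occurs in \<open>incl e f\<close>. This intertwining carries the approximate
  equations for the G_j into the arguments of the cocycles.\<close>

lemma KL_grad_incl:
  fixes f :: "nat \<Rightarrow>\<^sub>0 'k::comm_ring_1"
  shows "KL_grad (incl e f) = incl e (KL_deriv f)"
proof -
  have "(\<lambda>f :: nat \<Rightarrow>\<^sub>0 'k. KL_grad (incl e f)) = (\<lambda>f. incl e (KL_deriv f))"
  proof (rule lin_eq)
    show "KL_grad (incl e (Poly_Mapping.single n 1)) = incl e (KL_deriv (Poly_Mapping.single n 1))" for n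
    proof -
      have "KL_grad (Poly_Mapping.single (Poly_Mapping.single e n) 1) =
        Poly_Mapping.single (Poly_Mapping.single e n - Poly_Mapping.single e 1) (of_nat n)"
        by (subst KL_grad_single[of "{e}"]) simp_all
      then show ?thesis
        by (simp add: incl_single KL_deriv_def single_diff)
    qed
  qed (rule lin_comp[OF lin_KL_grad lin_alg_hom[OF alg_hom_incl]]
      lin_comp[OF lin_alg_hom[OF alg_hom_incl] lin_KL_deriv])+
  then show ?thesis by (rule fun_cong)
qed

text \<open>The functional "coefficient of L^1" applied to the left tensor factor.\<close>

definition L1_part :: "((nat \<times> 'a) \<Rightarrow>\<^sub>0 'k::comm_ring_1) \<Rightarrow> ('a \<Rightarrow>\<^sub>0 'k)" where
  "L1_part = lin_ext (\<lambda>(n, a). if n = 1 then Poly_Mapping.single a 1 else 0)"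

lemma lin_L1_part: "lin L1_part"
  unfolding L1_part_def by (rule lin_lin_ext)

lemma L1_part_tensor:
  fixes f :: "nat \<Rightarrow>\<^sub>0 'k::comm_ring_1" and g :: "'a \<Rightarrow>\<^sub>0 'k"
  shows "L1_part (tensor f g) = smul (Poly_Mapping.lookup f 1) g"
proof (rule lin_eq2[where B = "\<lambda>f g. L1_part (tensor f g)" and C = "\<lambda>f g. smul (Poly_Mapping.lookup f 1) g"])
  show "lin (\<lambda>f. smul (Poly_Mapping.lookup f 1) g)" for g :: "'a \<Rightarrow>\<^sub>0 'k"
    by (rule linI) (simp_all add: lookup_add smul_add)
  show "L1_part (tensor (Poly_Mapping.single a 1) (Poly_Mapping.single b 1)) =
    smul (Poly_Mapping.lookup (Poly_Mapping.single a 1) 1) (Poly_Mapping.single b 1)" for a and b :: 'a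
    by (simp add: L1_part_def lookup_single when_def)
qed (auto intro!: lin_intros lin_comp[OF lin_L1_part])

text \<open>The coproduct of f is f(L \<otimes> 1 + 1 \<otimes> L), and the part linear in the first
  summand is the derivative.\<close>

lemma L1_part_KL_coprod:
  fixes f :: "nat \<Rightarrow>\<^sub>0 'a::comm_ring_1"
  shows "L1_part (KL_coprod f) = KL_deriv f"
proof -
  have "(\<lambda>f. L1_part (KL_coprod f)) = (KL_deriv :: (nat \<Rightarrow>\<^sub>0 'a) \<Rightarrow> _)"
  proof (rule lin_eq)
    show "lin (\<lambda>f. L1_part (KL_coprod f))"
      unfolding KL_coprod_def by (intro lin_comp[OF lin_L1_part] lin_intros)
    fix n :: nat
    have "KL_coprod (Poly_Mapping.single n 1) = (\<Sum>k\<le>n. of_nat (n choose k) *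
        tensor (Poly_Mapping.single 1 1) 1 ^ k * (tensor 1 (Poly_Mapping.single 1 1) :: nat \<times> nat \<Rightarrow>\<^sub>0 'a) ^ (n - k))"
      by (simp add: KL_coprod_def binomial_ring)
    also have "\<dots> = (\<Sum>k\<le>n. smul (of_nat (n choose k)) (tensor (Poly_Mapping.single k 1) (Poly_Mapping.single (n - k) 1)))"
    proof (intro sum.cong refl)
      fix k
      have "tensor (Poly_Mapping.single 1 1) 1 ^ k = tensor (Poly_Mapping.single k (1::'a)) (1 :: nat \<Rightarrow>\<^sub>0 'a)" for k :: nat
        by (induction k) (simp_all add: tensor_one tensor_mult mult_single)
      moreover have "tensor 1 (Poly_Mapping.single 1 1) ^ k = tensor (1 :: nat \<Rightarrow>\<^sub>0 'a) (Poly_Mapping.single k (1::'a))" for k :: nat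
        by (induction k) (simp_all add: tensor_one tensor_mult mult_single)
      ultimately show "of_nat (n choose k) *
        tensor (Poly_Mapping.single 1 1) 1 ^ k * (tensor 1 (Poly_Mapping.single 1 1) :: nat \<times> nat \<Rightarrow>\<^sub>0 'a) ^ (n - k) =
        smul (of_nat (n choose k)) (tensor (Poly_Mapping.single k 1) (Poly_Mapping.single (n - k) 1))"
        by (simp only: smul_conv_mult single_of_nat mult.assoc tensor_mult mult_1_left mult_1_right)
    qed
    finally have "L1_part (KL_coprod (Poly_Mapping.single n (1::'a))) = (\<Sum>k\<le>n. if k = 1 then smul (of_nat n) (Poly_Mapping.single (n - 1) 1) else 0)"
      by (simp only: linD[OF lin_L1_part] L1_part_tensor, intro sum.cong) (auto simp: lookup_single when_def)
    also have "\<dots> = KL_deriv (Poly_Mapping.single n 1)"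
      by (cases n) (auto simp: KL_deriv_def lin_ext_one)
    finally show "L1_part (KL_coprod (Poly_Mapping.single n (1::'a))) = KL_deriv (Poly_Mapping.single n 1)" .
  qed (rule lin_KL_deriv)
  then show ?thesis by (rule fun_cong)
qed

lemma mdeg_add: "mdeg (\<alpha> + \<beta>) = mdeg \<alpha> + mdeg \<beta>"
proof -
  have mdeg: "mdeg \<gamma> = (\<Sum>e\<in>A. Poly_Mapping.lookup \<gamma> e)" if "finite A" "Poly_Mapping.keys \<gamma> \<subseteq> A" for \<gamma> :: "'a \<Rightarrow>\<^sub>0 nat" and A
    unfolding mdeg_def by (rule sum.mono_neutral_left) (use that in \<open>auto simp: in_keys_iff\<close>)
  define A where "A = Poly_Mapping.keys \<alpha> \<union> Poly_Mapping.keys \<beta>"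
  have A: "finite A" "Poly_Mapping.keys \<alpha> \<subseteq> A" "Poly_Mapping.keys \<beta> \<subseteq> A" "Poly_Mapping.keys (\<alpha> + \<beta>) \<subseteq> A"
    using keys_add[of \<alpha> \<beta>] by (auto simp: A_def)
  show ?thesis
    unfolding mdeg[OF A(1,2)] mdeg[OF A(1,3)] mdeg[OF A(1,4)] by (simp add: lookup_add sum.distrib)
qed

lemma mdeg_eq_1:
  assumes "mdeg \<alpha> = 1"
  shows "\<exists>e. \<alpha> = Poly_Mapping.single e 1"
proof -
  obtain e where e: "e \<in> Poly_Mapping.keys \<alpha>" "Poly_Mapping.lookup \<alpha> e = 1"
      "\<forall>b\<in>Poly_Mapping.keys \<alpha>. e \<noteq> b \<longrightarrow> Poly_Mapping.lookup \<alpha> b = 0"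
    using assms unfolding mdeg_def by (subst (asm) sum_eq_1_iff) auto
  then have "\<alpha> = Poly_Mapping.single e 1"
    by (intro poly_mapping_eqI) (auto simp: lookup_single when_def in_keys_iff)
  then show ?thesis by blast
qed

lemma mdeg_diff_eq_1:
  "{\<beta>. (\<forall>e. Poly_Mapping.lookup \<beta> e \<le> Poly_Mapping.lookup \<alpha> e) \<and> mdeg \<alpha> - mdeg \<beta> = 1} =
    (\<lambda>e. \<alpha> - Poly_Mapping.single e 1) ` Poly_Mapping.keys \<alpha>" (is "?A = ?B")
proof (intro equalityI subsetI)
  fix \<beta> assume \<beta>: "\<beta> \<in> ?A"
  then have split: "\<alpha> = \<beta> + (\<alpha> - \<beta>)"
    by (intro poly_mapping_eqI) (auto simp: lookup_add lookup_minus)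
  then have "mdeg (\<alpha> - \<beta>) = 1"
    using \<beta> mdeg_add[of \<beta> "\<alpha> - \<beta>"] by simp
  then obtain e where e: "\<alpha> - \<beta> = Poly_Mapping.single e 1"
    using mdeg_eq_1 by blast
  then have \<alpha>: "\<alpha> = \<beta> + Poly_Mapping.single e 1"
    using split by simp
  then have "\<beta> = \<alpha> - Poly_Mapping.single e 1" "e \<in> Poly_Mapping.keys \<alpha>"
    by (auto simp: in_keys_iff lookup_add)
  then show "\<beta> \<in> ?B" by blast
next
  fix \<beta> assume "\<beta> \<in> ?B"
  then obtain e where e: "e \<in> Poly_Mapping.keys \<alpha>" and \<beta>: "\<beta> = \<alpha> - Poly_Mapping.single e 1"
    by blast
  have "\<alpha> = \<beta> + Poly_Mapping.single e 1"
    using e unfolding \<beta>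
    by (intro poly_mapping_eqI) (auto simp: lookup_add lookup_minus lookup_single when_def in_keys_iff)
  then have "mdeg \<alpha> = mdeg \<beta> + mdeg (Poly_Mapping.single e 1)"
    using mdeg_add by metis
  moreover have "mdeg (Poly_Mapping.single e 1) = 1"
    by (simp add: mdeg_def)
  ultimately show "\<beta> \<in> ?A"
    by (auto simp: \<beta> lookup_minus)
qed

lemma finite_le_poly_mapping:
  "finite {\<beta> :: 'a \<Rightarrow>\<^sub>0 nat. \<forall>e. Poly_Mapping.lookup \<beta> e \<le> Poly_Mapping.lookup \<alpha> e}" (is "finite ?A")
proof (rule finite_subset)
  let ?f = "\<lambda>g. \<Sum>e\<in>Poly_Mapping.keys \<alpha>. Poly_Mapping.single e (g e)"
  let ?S = "PiE (Poly_Mapping.keys \<alpha>) (\<lambda>e. {..Poly_Mapping.lookup \<alpha> e})"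
  show "finite (?f ` ?S)"
    by (intro finite_imageI finite_PiE) auto
  show "?A \<subseteq> ?f ` ?S"
  proof
    fix \<beta> assume "\<beta> \<in> ?A"
    then have le: "Poly_Mapping.lookup \<beta> e \<le> Poly_Mapping.lookup \<alpha> e" for e
      by blast
    have "\<beta> = ?f (restrict (Poly_Mapping.lookup \<beta>) (Poly_Mapping.keys \<alpha>))"
    proof (rule poly_mapping_eqI)
      fix e
      show "Poly_Mapping.lookup \<beta> e = Poly_Mapping.lookup (?f (restrict (Poly_Mapping.lookup \<beta>) (Poly_Mapping.keys \<alpha>))) e"
        using le[of e] by (auto simp: lookup_sum lookup_single when_def in_keys_iff sum.delta)
    qed
    moreover have "restrict (Poly_Mapping.lookup \<beta>) (Poly_Mapping.keys \<alpha>) \<in> ?S"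
      using le by auto
    ultimately show "\<beta> \<in> ?f ` ?S" by blast
  qed
qed

text \<open>The coaction is the Taylor expansion of f after adding L to every L_e, so its part
  linear in L is the sum of the partial derivatives. In the defining sum these are the \<beta>
  obtained by lowering one exponent of \<alpha> by 1, and the binomial coefficient is that
  exponent.\<close>

lemma L1_part_KL_coaction:
  assumes \<Lambda>: "lin \<Lambda>"
  shows "L1_part (tensor_map id \<Lambda> (KL_coaction f)) = \<Lambda> (KL_grad f)"
proof -
  have "(\<lambda>f. L1_part (tensor_map id \<Lambda> (KL_coaction f))) = (\<lambda>f. \<Lambda> (KL_grad f))"
  proof (rule lin_eq)
    show "lin (\<lambda>f. L1_part (tensor_map id \<Lambda> (KL_coaction f)))"
      unfolding KL_coaction_def
      by (intro lin_comp[OF lin_L1_part] lin_comp[OF lin_tensor_map] lin_intros)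
    show "lin (\<lambda>f. \<Lambda> (KL_grad f))"
      by (rule lin_comp[OF \<Lambda> lin_KL_grad])
    fix \<alpha> :: "'a \<Rightarrow>\<^sub>0 nat"
    define c where "c \<beta> = (of_nat (\<Prod>e\<in>Poly_Mapping.keys \<alpha>. Poly_Mapping.lookup \<alpha> e choose Poly_Mapping.lookup \<beta> e) :: 'b)" for \<beta>
    let ?S = "{\<beta>. \<forall>e. Poly_Mapping.lookup \<beta> e \<le> Poly_Mapping.lookup \<alpha> e}"
    have single: "L1_part (tensor_map id \<Lambda> (Poly_Mapping.single (n, \<beta>) x)) =
      (if n = 1 then smul x (\<Lambda> (Poly_Mapping.single \<beta> 1)) else 0)" for n \<beta> x
      unfolding tensor_map_def lin_ext_single
      by (simp add: linD[OF lin_L1_part] L1_part_tensor lookup_single when_def)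
    have c: "c (\<alpha> - Poly_Mapping.single e 1) = of_nat (Poly_Mapping.lookup \<alpha> e)" if "e \<in> Poly_Mapping.keys \<alpha>" for e
    proof -
      have "(\<Prod>e'\<in>Poly_Mapping.keys \<alpha>. Poly_Mapping.lookup \<alpha> e' choose Poly_Mapping.lookup (\<alpha> - Poly_Mapping.single e 1) e') =
        (\<Prod>e'\<in>Poly_Mapping.keys \<alpha>. if e' = e then Poly_Mapping.lookup \<alpha> e else 1)"
      proof (intro prod.cong refl)
        fix e'
        show "Poly_Mapping.lookup \<alpha> e' choose Poly_Mapping.lookup (\<alpha> - Poly_Mapping.single e 1) e' =
          (if e' = e then Poly_Mapping.lookup \<alpha> e else 1)"
          using that by (cases "Poly_Mapping.lookup \<alpha> e")
            (auto simp: lookup_minus lookup_single when_def in_keys_iff)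
      qed
      then show ?thesis
        using that by (simp add: c_def)
    qed
    have inj: "inj_on (\<lambda>e. \<alpha> - Poly_Mapping.single e 1) (Poly_Mapping.keys \<alpha>)"
    proof (rule inj_onI, rule ccontr)
      fix e e' assume e: "e \<in> Poly_Mapping.keys \<alpha>" "\<alpha> - Poly_Mapping.single e 1 = \<alpha> - Poly_Mapping.single e' 1" "e \<noteq> e'"
      then have "Poly_Mapping.lookup (\<alpha> - Poly_Mapping.single e 1) e = Poly_Mapping.lookup (\<alpha> - Poly_Mapping.single e' 1) e"
        by simp
      then show False
        using e by (simp add: lookup_minus lookup_single in_keys_iff)
    qed
    have "L1_part (tensor_map id \<Lambda> (KL_coaction (Poly_Mapping.single \<alpha> 1))) =
      (\<Sum>\<beta>\<in>?S. if mdeg \<alpha> - mdeg \<beta> = 1 then smul (c \<beta>) (\<Lambda> (Poly_Mapping.single \<beta> 1)) else 0)"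
      unfolding KL_coaction_def lin_ext_single smul_one linD(4)[OF lin_tensor_map] linD(4)[OF lin_L1_part] single c_def ..
    also have "\<dots> = (\<Sum>\<beta>\<in>{\<beta>\<in>?S. mdeg \<alpha> - mdeg \<beta> = 1}. smul (c \<beta>) (\<Lambda> (Poly_Mapping.single \<beta> 1)))"
      by (rule sum.inter_filter[OF finite_le_poly_mapping, symmetric])
    also have "{\<beta>\<in>?S. mdeg \<alpha> - mdeg \<beta> = 1} = (\<lambda>e. \<alpha> - Poly_Mapping.single e 1) ` Poly_Mapping.keys \<alpha>"
      using mdeg_diff_eq_1[of \<alpha>] by simp
    also have "(\<Sum>\<beta>\<in>\<dots>. smul (c \<beta>) (\<Lambda> (Poly_Mapping.single \<beta> 1))) =
      (\<Sum>e\<in>Poly_Mapping.keys \<alpha>. smul (of_nat (Poly_Mapping.lookup \<alpha> e)) (\<Lambda> (Poly_Mapping.single (\<alpha> - Poly_Mapping.single e 1) 1)))"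
      unfolding sum.reindex[OF inj] by (intro sum.cong) (simp_all only: c o_apply)
    also have "\<dots> = \<Lambda> (KL_grad (Poly_Mapping.single \<alpha> 1))"
      unfolding KL_grad_def lin_ext_single smul_one linD(4)[OF \<Lambda>]
      by (simp flip: linD(2)[OF \<Lambda>])
    finally show "L1_part (tensor_map id \<Lambda> (KL_coaction (Poly_Mapping.single \<alpha> 1))) = \<Lambda> (KL_grad (Poly_Mapping.single \<alpha> 1))" .
  qed
  then show ?thesis by (rule fun_cong)
qed

section \<open>Cocycles on the polynomials in the L_e\<close>

lemma subalg_KL_vars: "subalg (KL_vars E)"
  unfolding subalg_def
proof (intro conjI allI ballI)
  show "Poly_Mapping.single 0 c \<in> KL_vars E" for c :: 'b
    by (simp add: KL_vars_def)
  fix f g :: "('a \<Rightarrow>\<^sub>0 nat) \<Rightarrow>\<^sub>0 'b"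
  assume "f \<in> KL_vars E" "g \<in> KL_vars E"
  then have f: "\<forall>\<alpha>\<in>Poly_Mapping.keys f. Poly_Mapping.keys \<alpha> \<subseteq> E" and g: "\<forall>\<alpha>\<in>Poly_Mapping.keys g. Poly_Mapping.keys \<alpha> \<subseteq> E"
    by (simp_all add: KL_vars_def)
  show "f + g \<in> KL_vars E" "f * g \<in> KL_vars E"
    unfolding KL_vars_def mem_Collect_eq
  proof (safe del: subsetI)
    show "Poly_Mapping.keys \<alpha> \<subseteq> E" if "\<alpha> \<in> Poly_Mapping.keys (f + g)" for \<alpha>
      using f g keys_add[of f g] that by blast
    show "Poly_Mapping.keys \<alpha> \<subseteq> E" if \<alpha>: "\<alpha> \<in> Poly_Mapping.keys (f * g)" for \<alpha>
    proof -
      obtain \<beta> \<gamma> where "\<alpha> = \<beta> + \<gamma>" "\<beta> \<in> Poly_Mapping.keys f" "\<gamma> \<in> Poly_Mapping.keys g"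
        using keys_mult[of f g] \<alpha> by blast
      then show ?thesis
        using f g keys_add[of \<beta> \<gamma>] by blast
    qed
  qed
qed

lemma incl_in_KL_vars:
  assumes "e \<in> E"
  shows "incl e f \<in> KL_vars E"
proof -
  have "incl e f = (\<Sum>n\<in>Poly_Mapping.keys f. smul (Poly_Mapping.lookup f n) (Poly_Mapping.single (Poly_Mapping.single e n) 1))"
    by (simp add: incl_def lin_ext_def)
  also have "\<dots> \<in> KL_vars E"
    by (intro subalgD(8,6)[OF subalg_KL_vars]) (use assms in \<open>auto simp: KL_vars_def\<close>)
  finally show ?thesis .
qed

text \<open>A cocycle is linear only on the polynomials in the variables \<open>L\<^sub>e\<close> with \<open>e \<in> E\<close>.\<close>

lemma one_cocycle_linear_extension:
  fixes \<Lambda> :: "(('e \<Rightarrow>\<^sub>0 nat) \<Rightarrow>\<^sub>0 'k::comm_ring_1) \<Rightarrow> (nat \<Rightarrow>\<^sub>0 'k)"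
  assumes \<Lambda>: "one_cocycle E \<Lambda>"
  shows "\<exists>\<Lambda>'. lin \<Lambda>' \<and> (\<forall>f\<in>KL_vars E. \<Lambda> f = \<Lambda>' f \<and>
    KL_deriv (\<Lambda>' f) = Poly_Mapping.single 0 (Poly_Mapping.lookup (\<Lambda>' f) 1) + \<Lambda>' (KL_grad f))"
proof -
  define \<Lambda>' where "\<Lambda>' = lin_ext (\<lambda>\<alpha>. \<Lambda> (Poly_Mapping.single \<alpha> 1))"
  have lin: "lin \<Lambda>'"
    unfolding \<Lambda>'_def by (rule lin_lin_ext)
  have add: "\<Lambda> (f + g) = \<Lambda> f + \<Lambda> g" if "f \<in> KL_vars E" "g \<in> KL_vars E" for f g
    using \<Lambda> that by (simp add: one_cocycle_def)
  have smul: "\<Lambda> (smul c f) = smul c (\<Lambda> f)" if "f \<in> KL_vars E" for c f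
    using \<Lambda> that by (simp add: one_cocycle_def)
  note K = subalgD[OF subalg_KL_vars[of E]]
  have zero: "\<Lambda> 0 = 0"
    using add[of 0 0] K(2) by simp
  have agree: "\<Lambda> f = \<Lambda>' f" if f: "f \<in> KL_vars E" for f
  proof -
    have single: "Poly_Mapping.single \<alpha> c \<in> KL_vars E" if "\<alpha> \<in> Poly_Mapping.keys f" for \<alpha> c
      using f that by (auto simp: KL_vars_def)
    have sum: "\<Lambda> (\<Sum>\<alpha>\<in>A. smul (Poly_Mapping.lookup f \<alpha>) (Poly_Mapping.single \<alpha> 1)) = (\<Sum>\<alpha>\<in>A. smul (Poly_Mapping.lookup f \<alpha>) (\<Lambda> (Poly_Mapping.single \<alpha> 1)))"
      if "finite A" "A \<subseteq> Poly_Mapping.keys f" for A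
      using that
    proof (induction A rule: finite_induct)
      case (insert \<alpha> A)
      have "(\<Sum>\<alpha>\<in>A. smul (Poly_Mapping.lookup f \<alpha>) (Poly_Mapping.single \<alpha> 1)) \<in> KL_vars E"
        by (intro K(8,6) single) (use insert in auto)
      moreover have \<alpha>: "Poly_Mapping.single \<alpha> 1 \<in> KL_vars E"
        using insert by (intro single) simp
      then have "smul (Poly_Mapping.lookup f \<alpha>) (Poly_Mapping.single \<alpha> 1) \<in> KL_vars E"
        by (rule K(6))
      ultimately show ?case
        using insert by (simp add: add smul[OF \<alpha>] del: smul_single)
    qed (simp add: zero)
    have "\<Lambda> f = \<Lambda> (\<Sum>\<alpha>\<in>Poly_Mapping.keys f. smul (Poly_Mapping.lookup f \<alpha>) (Poly_Mapping.single \<alpha> 1))"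
      by (rule arg_cong[OF poly_mapping_expand])
    also have "\<dots> = \<Lambda>' f"
      by (subst sum) (simp_all add: \<Lambda>'_def lin_ext_def)
    finally show ?thesis .
  qed
  \<comment> \<open>\<open>tensor_map\<close> sees only values on basis vectors, and there \<Lambda>
    and its extension agree by construction.\<close>
  have "tensor_map (id :: _ \<Rightarrow> (nat \<Rightarrow>\<^sub>0 'k)) \<Lambda> = tensor_map id \<Lambda>'"
    unfolding tensor_map_def by (simp add: \<Lambda>'_def)
  then have "KL_coprod (\<Lambda> f) = tensor (\<Lambda> f) 1 + tensor_map id \<Lambda>' (KL_coaction f)" if "f \<in> KL_vars E" for f
    using \<Lambda> that by (simp add: one_cocycle_def)
  then have "KL_coprod (\<Lambda>' f) = tensor (\<Lambda>' f) 1 + tensor_map id \<Lambda>' (KL_coaction f)" if "f \<in> KL_vars E" for f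
    using that agree[OF that] by metis
  \<comment> \<open>The three terms become the derivative, the constant [L^1] \<Lambda>(f), and
    \<Lambda> of the gradient.\<close>
  then have "L1_part (KL_coprod (\<Lambda>' f)) = L1_part (tensor (\<Lambda>' f) 1) + L1_part (tensor_map id \<Lambda>' (KL_coaction f))" if "f \<in> KL_vars E" for f
    using that by (simp add: linD[OF lin_L1_part])
  then have "KL_deriv (\<Lambda>' f) = Poly_Mapping.single 0 (Poly_Mapping.lookup (\<Lambda>' f) 1) + \<Lambda>' (KL_grad f)" if "f \<in> KL_vars E" for f
    using that by (simp add: L1_part_KL_coprod L1_part_tensor L1_part_KL_coaction[OF lin] smul_conv_mult)
  with lin agree show ?thesis by blast
qed


section \<open>The renormalization group equations\<close>

abbreviation cst :: "'k::comm_ring_1 fps \<Rightarrow> ('m::comm_monoid_add \<Rightarrow>\<^sub>0 'k) fps" where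
  "cst \<equiv> fps_map (Poly_Mapping.single 0)"

lemma cst_mult:
  fixes a b :: "'k::comm_ring_1 fps"
  shows "(cst (a * b) :: ('m::comm_monoid_add \<Rightarrow>\<^sub>0 'k) fps) = cst a * cst b"
proof -
  have "Poly_Mapping.single (0::'m) (\<Sum>x\<in>A. h x) = (\<Sum>x\<in>A. Poly_Mapping.single 0 (h x))" for A :: "nat set" and h :: "nat \<Rightarrow> 'k"
    by (induction A rule: infinite_finite_induct) (simp_all add: single_add)
  then show ?thesis
    by (simp add: fps_eq_iff fps_mult_nth mult_single)
qed

lemma cst_add: "cst (a + b) = cst a + cst b"
  by (simp add: fps_eq_iff single_add)

lemma cst_sum: "cst (\<Sum>x\<in>A. h x) = (\<Sum>x\<in>A. cst (h x))"
  by (induction A rule: infinite_finite_induct) (simp_all add: cst_add, simp_all add: fps_eq_iff)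

lemma cst_const: "cst (fps_const c) = scal c"
  by (simp add: fps_eq_iff fps_const_def)

lemma fps_map_cst_mult:
  fixes \<phi> :: "('m::comm_monoid_add \<Rightarrow>\<^sub>0 'k::comm_ring_1) \<Rightarrow> ('n::comm_monoid_add \<Rightarrow>\<^sub>0 'k)"
  assumes "lin \<phi>"
  shows "fps_map \<phi> (cst c * f) = cst c * fps_map \<phi> f"
  by (simp add: fps_eq_iff fps_mult_nth linD[OF assms] flip: smul_conv_mult)

lemma fps_map_deriv:
  fixes \<phi> :: "('m::comm_monoid_add \<Rightarrow>\<^sub>0 'k::comm_ring_1) \<Rightarrow> ('n::comm_monoid_add \<Rightarrow>\<^sub>0 'k)"
  assumes "lin \<phi>"
  shows "fps_map \<phi> (fps_deriv f) = fps_deriv (fps_map \<phi> f)"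
proof -
  have "\<phi> (of_nat n * f) = of_nat n * \<phi> f" for n f
    using linD(2)[OF assms, of "of_nat n" f] by (simp only: smul_conv_mult single_of_nat)
  then show ?thesis
    by (simp add: fps_eq_iff del: of_nat_Suc)
qed

text \<open>Here \<open>b\<close> is \<open>\<beta>(x) / x\<close>, so that the operator is visibly order-preserving.\<close>

definition rg_op :: "(('m::comm_monoid_add \<Rightarrow>\<^sub>0 'k::comm_ring_1) \<Rightarrow> ('m \<Rightarrow>\<^sub>0 'k)) \<Rightarrow> 'k fps \<Rightarrow> ('m \<Rightarrow>\<^sub>0 'k) fps \<Rightarrow> ('m \<Rightarrow>\<^sub>0 'k) fps" where
  "rg_op D b f = fps_map D f - cst b * (fps_X * fps_deriv f)"

lemma derivation_fps_map:
  assumes D: "lin D" and mult: "\<And>f g. D (f * g) = D f * g + f * D g"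
  shows "derivation (fps_map D)"
  unfolding derivation_def
  by (auto simp: fps_map_lin[OF D] fps_eq_iff fps_mult_nth linD[OF D] mult sum.distrib intro: fps_cong_map)

text \<open>The last claim exhibits x^w as an eigenvector with eigenvalue - w \<beta>(x) / x, which
  will cancel the contribution of the \<alpha>_e.\<close>

lemma derivation_rg_op:
  assumes D: "lin D" and mult: "\<And>f g. D (f * g) = D f * g + f * D g"
  shows "derivation (rg_op D b)" "rg_op D b (scal c) = 0"
    "rg_op D b (fps_X ^ w) = - (of_nat w * cst b * fps_X ^ w)"
proof -
  have eq: "rg_op D b = (\<lambda>f. fps_map D f + (- cst b) * (fps_X * fps_deriv f))"
    by (simp add: rg_op_def fun_eq_iff)
  show deriv: "derivation (rg_op D b)"
    unfolding eq by (intro derivation_add_mult derivation_fps_map[OF D mult] derivation_X_deriv)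
  have one: "D 1 = 0"
    using mult[of 1 1] by simp
  then have const: "D (Poly_Mapping.single 0 c) = 0" for c
    using linD(2)[OF D, of c 1] by (simp add: smul_conv_mult)
  then have "fps_map D (scal c) = 0"
    by (simp add: fps_eq_iff linD[OF D])
  then show "rg_op D b (scal c) = 0"
    by (simp add: rg_op_def)
  have X: "rg_op D b fps_X = - (cst b * fps_X)"
  proof -
    have "fps_map D fps_X = 0"
      using one by (simp add: fps_eq_iff fps_X_def linD[OF D])
    then show ?thesis
      by (simp add: rg_op_def)
  qed
  show "rg_op D b (fps_X ^ w) = - (of_nat w * cst b * fps_X ^ w)"
    by (cases w) (simp_all only: derivationD(4,8)[OF deriv] X power_0, simp_all add: algebra_simps)
qed

text \<open>The eigenvalue t is itself a series. It adds under products and is scaled under powers,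
  the additive counterpart of the multiplier in \<open>twisted\<close>.\<close>

definition eigen :: "nat \<Rightarrow> ('a::comm_ring_1 fps \<Rightarrow> 'a fps) \<Rightarrow> 'a fps \<Rightarrow> 'a fps \<Rightarrow> bool" where
  "eigen n d t f \<longleftrightarrow> fps_cong n (d f) (t * f)"

lemma eigen_mult:
  assumes d: "derivation d" and "eigen n d t f" "eigen n d t' f'"
  shows "eigen n d (t + t') (f * f')"
proof -
  have "fps_cong n (d (f * f')) ((t * f) * f' + f * (t' * f'))"
    unfolding derivationD(2)[OF d] using assms(2,3)
    by (intro fps_cong_add fps_cong_mult) (simp_all add: eigen_def)
  then show ?thesis
    by (simp add: eigen_def algebra_simps)
qed

lemma eigen_prod:
  assumes d: "derivation d" and "\<And>x. x \<in> A \<Longrightarrow> eigen n d (t x) (f x)"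
  shows "eigen n d (\<Sum>x\<in>A. t x) (\<Prod>x\<in>A. f x)"
  using assms(2)
proof (induction A rule: infinite_finite_induct)
  case (insert x A)
  then show ?case
    by (simp add: eigen_mult[OF d])
qed (simp_all add: eigen_def derivationD[OF d])

text \<open>In f d(f^a) = a (d f) f^a one replaces d f by t f and cancels f by means of its inverse,
  the power with exponent -1.\<close>

lemma eigen_fps_pow:
  assumes d: "derivation d" and const: "\<And>c. d (scal c) = 0" and f: "f $ 0 = 1" and e: "eigen n d t f"
  shows "eigen n d (scal a * t) (fps_pow f a)"
proof -
  have inv: "f * fps_pow f (- 1) = 1"
    using fps_pow_add[OF f, of 1 "- 1"] by (simp add: fps_pow_1 fps_pow_0 f)
  have "fps_cong n (scal a * d f * fps_pow f a) (scal a * (t * f) * fps_pow f a)"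
    using e by (intro fps_cong_mult fps_cong_refl) (simp add: eigen_def)
  then have "fps_cong n (fps_pow f (- 1) * (f * d (fps_pow f a))) (fps_pow f (- 1) * (scal a * (t * f) * fps_pow f a))"
    unfolding fps_pow_derivation[OF d const f] by (rule fps_cong_mult[OF fps_cong_refl])
  moreover have "fps_pow f (- 1) * (f * d (fps_pow f a)) = (f * fps_pow f (- 1)) * d (fps_pow f a)"
    by (simp only: ac_simps)
  moreover have "fps_pow f (- 1) * (scal a * (t * f) * fps_pow f a) = (f * fps_pow f (- 1)) * (scal a * t * fps_pow f a)"
    by (simp only: ac_simps)
  ultimately show ?thesis
    unfolding eigen_def by (simp only: inv mult_1_left)
qed

lemma DSE_solution_constant_term:
  assumes w: "\<And>p. p \<in> P i \<Longrightarrow> w p \<ge> 1" and DSE: "DSE_solution I P w E s u \<alpha> \<Lambda> G" and i: "i \<in> I"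
  shows "G i $ 0 = 1"
proof -
  define W where "W p = fps_map (\<Lambda> p) (\<Prod>e\<in>E p. fps_pow (fps_map (incl e) (G i)) (u p e) *
                   (\<Prod>j\<in>I. fps_pow (fps_map (incl e) (G j)) (of_nat (\<alpha> p e) * s j)))" for p
  have "((\<lambda>p. fps_X ^ w p * W p) has_sum (G i - 1)) (P i)"
    using DSE i unfolding DSE_solution_def W_def by blast
  from has_sum_fps_cong[OF this, of 1] obtain F where F: "F \<subseteq> P i" "fps_cong 1 (\<Sum>p\<in>F. fps_X ^ w p * W p) (G i - 1)"
    by blast
  have "(\<Sum>p\<in>F. fps_X ^ w p * W p) $ 0 = 0"
    unfolding fps_sum_nth
  proof (intro sum.neutral ballI)
    fix p assume "p \<in> F"
    then show "(fps_X ^ w p * W p) $ 0 = 0"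
      using w[of p] F(1) by (auto simp: zero_power)
  qed
  then show ?thesis
    using F(2) by (simp add: fps_cong_def)
qed

theorem renormalization_group_equations:
  fixes s :: "'i \<Rightarrow> 'k::field_char_0" and E :: "'p \<Rightarrow> 'e set"
  assumes w: "\<And>p. p \<in> (\<Union>i\<in>I. P i) \<Longrightarrow> w p \<ge> 1"
    and u: "\<And>p. p \<in> (\<Union>i\<in>I. P i) \<Longrightarrow> (\<Sum>e\<in>E p. u p e) = 1"
    and \<alpha>: "\<And>p. p \<in> (\<Union>i\<in>I. P i) \<Longrightarrow> (\<Sum>e\<in>E p. \<alpha> p e) = w p"
    and \<Lambda>: "\<And>p. p \<in> (\<Union>i\<in>I. P i) \<Longrightarrow> one_cocycle (E p) (\<Lambda> p)"
    and DSE: "DSE_solution I P w E s u \<alpha> \<Lambda> G"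
    and i: "i \<in> I"
  shows "fps_map KL_deriv (G i) - beta_function I s G * fps_deriv (G i) - anomalous_dim (G i) * G i = 0"
proof -
  define g where "g i = fps_map (\<lambda>f. Poly_Mapping.lookup f 1) (G i)" for i
  \<comment> \<open>\<open>g i\<close> is \<gamma>_i with scalar coefficients, and \<open>b\<close>
    is \<beta>(x) / x.\<close>
  define b where "b = (\<Sum>j\<in>I. fps_const (s j) * g j)"
  have dim: "anomalous_dim (G i) = cst (g i)" for i
    by (simp add: anomalous_dim_def g_def fps_map_comp)
  have beta: "beta_function I s G = cst b * fps_X"
    by (simp add: beta_function_def dim b_def cst_sum cst_mult cst_const sum_distrib_left mult_ac)
  have G0: "G j $ 0 = 1" if "j \<in> I" for j
    using DSE_solution_constant_term[OF _ DSE that] w that by blast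
  define d where "d = rg_op KL_deriv b"
  define d' :: "(('e \<Rightarrow>\<^sub>0 nat) \<Rightarrow>\<^sub>0 'k) fps \<Rightarrow> (('e \<Rightarrow>\<^sub>0 nat) \<Rightarrow>\<^sub>0 'k) fps" where "d' = rg_op KL_grad b"
  have d: "derivation d" "d (scal c) = 0" for c
    unfolding d_def by (intro derivation_rg_op lin_KL_deriv KL_deriv_mult)+
  have d': "derivation d'" "d' (scal c) = 0" "d' (fps_X ^ m) = - (of_nat m * cst b * fps_X ^ m)" for c m
    unfolding d'_def by (intro derivation_rg_op lin_KL_grad KL_grad_mult)+
  have d'_incl: "d' (fps_map (incl e) f) = fps_map (incl e) (d f)" for e f
    by (simp add: d_def d'_def rg_op_def fps_map_ring_hom[OF alg_hom_incl] fps_map_comp alg_homD(5)[OF alg_hom_incl] KL_grad_incl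
      fps_map_cst_mult[OF lin_alg_hom[OF alg_hom_incl]] fps_map_deriv[OF lin_alg_hom[OF alg_hom_incl]])
  \<comment> \<open>For all n together, this is the renormalization group equation.\<close>
  have "eigen n d (cst (g i)) (G i)" if "i \<in> I" for i n
    using that
  proof (induction n arbitrary: i)
    case 0
    then show ?case by (simp add: eigen_def fps_cong_def)
  next
    case (Suc n)
    define W where "W p = (\<Prod>e\<in>E p. fps_pow (fps_map (incl e) (G i)) (u p e) *
                   (\<Prod>j\<in>I. fps_pow (fps_map (incl e) (G j)) (of_nat (\<alpha> p e) * s j)))" for p
    define Z where "Z p = fps_X ^ w p * W p" for p
    have incl: "eigen n d' (cst (g j)) (fps_map (incl e) (G j))" if "j \<in> I" for e j
      using fps_cong_map[OF Suc.IH[OF that, unfolded eigen_def], of "incl e"]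
      by (simp add: eigen_def d'_incl fps_map_cst_mult[OF lin_alg_hom[OF alg_hom_incl]])
    have incl0: "fps_map (incl e) (G j) $ 0 = 1" if "j \<in> I" for e j
      using G0[OF that] by (simp add: alg_homD(1)[OF alg_hom_incl])
    have Z: "fps_cong (Suc n) (d' (Z p)) (cst (g i) * Z p)" if p: "p \<in> P i" for p
    proof -
      have pU: "p \<in> (\<Union>i\<in>I. P i)"
        using p Suc.prems by blast
      let ?t = "\<Sum>e\<in>E p. scal (u p e) * cst (g i) + (\<Sum>j\<in>I. scal (of_nat (\<alpha> p e) * s j) * cst (g j)) :: (('e \<Rightarrow>\<^sub>0 nat) \<Rightarrow>\<^sub>0 'k) fps"
      have "eigen n d' ?t (W p)"
        unfolding W_def
        by (intro eigen_prod eigen_mult eigen_fps_pow d' incl incl0 Suc.prems)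
      have "?t = scal (\<Sum>e\<in>E p. u p e) * cst (g i) + scal (of_nat (\<Sum>e\<in>E p. \<alpha> p e)) * (\<Sum>j\<in>I. scal (s j) * cst (g j))"
        by (simp only: sum.distrib scal_sum scal_mult of_nat_sum sum_distrib_right sum_distrib_left mult.assoc)
          (subst sum.swap, rule refl)
      \<comment> \<open>The u_e leave one \<gamma>_i; the \<alpha>_e leave w copies of the sum of
        the s_j \<gamma>_j, which is \<beta>(x) / x.\<close>
      also have "\<dots> = cst (g i) + of_nat (w p) * cst b"
        by (simp add: u[OF pU] \<alpha>[OF pU] b_def cst_sum cst_mult cst_const fps_of_nat)
      finally have "fps_cong n (d' (W p)) ((cst (g i) + of_nat (w p) * cst b) * W p)"
        using \<open>eigen n d' ?t (W p)\<close> by (simp add: eigen_def)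
      then have "fps_cong (n + w p) (fps_X ^ w p * d' (W p)) (fps_X ^ w p * ((cst (g i) + of_nat (w p) * cst b) * W p))"
        by (rule fps_cong_X_power_mult)
      \<comment> \<open>In the Leibniz rule the eigenvalue of x^w cancels w \<beta>(x) / x, so that
        \<gamma>_i alone remains for \<open>Z p\<close>.\<close>
      then have "fps_cong (n + w p) (d' (fps_X ^ w p) * W p + fps_X ^ w p * d' (W p))
         (- (of_nat (w p) * cst b * fps_X ^ w p) * W p + fps_X ^ w p * ((cst (g i) + of_nat (w p) * cst b) * W p))"
        unfolding d'(3) by (rule fps_cong_add[OF fps_cong_refl])
      then have "fps_cong (n + w p) (d' (Z p)) (cst (g i) * Z p)"
        by (simp add: Z_def derivationD(2)[OF d'(1)] algebra_simps)
      then show ?thesis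
        by (rule fps_cong_mono) (use w[OF pU] in simp)
    qed
    have "\<exists>\<Lambda>'. lin \<Lambda>' \<and> (\<forall>f\<in>KL_vars (E p). \<Lambda> p f = \<Lambda>' f \<and>
      KL_deriv (\<Lambda>' f) = Poly_Mapping.single 0 (Poly_Mapping.lookup (\<Lambda>' f) 1) + \<Lambda>' (KL_grad f))" if "p \<in> P i" for p
      using one_cocycle_linear_extension[OF \<Lambda>] that Suc.prems by blast
    then obtain \<Lambda>' where lin: "\<And>p. p \<in> P i \<Longrightarrow> lin (\<Lambda>' p)"
      and ext: "\<And>p f. p \<in> P i \<Longrightarrow> f \<in> KL_vars (E p) \<Longrightarrow> \<Lambda> p f = \<Lambda>' p f"
      and cocycle: "\<And>p f. p \<in> P i \<Longrightarrow> f \<in> KL_vars (E p) \<Longrightarrow>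
        KL_deriv (\<Lambda>' p f) = Poly_Mapping.single 0 (Poly_Mapping.lookup (\<Lambda>' p f) 1) + \<Lambda>' p (KL_grad f)"
      by metis
    have W_over: "W p \<in> fps_over (KL_vars (E p))" for p
      unfolding W_def
      by (intro fps_overD[OF subalg_KL_vars]) (auto simp: fps_over_def intro: incl_in_KL_vars)
    then have Z_over: "Z p \<in> fps_over (KL_vars (E p))" for p
      unfolding Z_def by (intro fps_overD[OF subalg_KL_vars])
    define Y where "Y p = fps_map (\<Lambda>' p) (Z p)" for p
    define lin_part :: "(nat \<Rightarrow>\<^sub>0 'k) fps \<Rightarrow> (nat \<Rightarrow>\<^sub>0 'k) fps" where
      "lin_part h = cst (fps_map (\<lambda>f. Poly_Mapping.lookup f 1) h)" for h
    have lin_part_add: "lin_part (f + h) = lin_part f + lin_part h" for f h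
      by (simp add: lin_part_def fps_eq_iff lookup_add single_add)
    have lin_part_sum: "lin_part (\<Sum>p\<in>F. h p) = (\<Sum>p\<in>F. lin_part (h p))" for F and h :: "'p \<Rightarrow> _"
      by (induction F rule: infinite_finite_induct) (simp_all add: lin_part_add, simp_all add: lin_part_def fps_eq_iff)
    \<comment> \<open>A coefficientwise linear map commutes with x d/dx and with scalar series; only
      d/dL fails to pass through unchanged, and the cocycle identity supplies the correction
      \<open>lin_part\<close>.\<close>
    have dY: "d (Y p) = lin_part (Y p) + fps_map (\<Lambda>' p) (d' (Z p))" if p: "p \<in> P i" for p
    proof -
      have "fps_map KL_deriv (Y p) = lin_part (Y p) + fps_map (\<Lambda>' p) (fps_map KL_grad (Z p))"
        using Z_over[of p] by (simp add: fps_eq_iff Y_def lin_part_def fps_over_def cocycle[OF p])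
      then show ?thesis
        by (simp add: d_def d'_def rg_op_def fps_map_lin[OF lin[OF p]] fps_map_cst_mult[OF lin[OF p]]
          fps_map_deriv[OF lin[OF p]] fps_map_X_power[OF lin[OF p], of 1, simplified] Y_def)
    qed
    have "((\<lambda>p. fps_X ^ w p * fps_map (\<Lambda> p) (W p)) has_sum (G i - 1)) (P i)"
      using DSE Suc.prems unfolding DSE_solution_def W_def by blast
    from has_sum_fps_cong[OF this, of "Suc n"] obtain F where F: "finite F" "F \<subseteq> P i"
      and "fps_cong (Suc n) (\<Sum>p\<in>F. fps_X ^ w p * fps_map (\<Lambda> p) (W p)) (G i - 1)"
      by blast
    moreover have "(\<Sum>p\<in>F. fps_X ^ w p * fps_map (\<Lambda> p) (W p)) = (\<Sum>p\<in>F. Y p)"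
    proof (intro sum.cong refl)
      fix p assume "p \<in> F"
      then have p: "p \<in> P i" using F by blast
      have "fps_map (\<Lambda> p) (W p) = fps_map (\<Lambda>' p) (W p)"
        using W_over[of p] by (simp add: fps_eq_iff fps_over_def ext[OF p])
      then show "fps_X ^ w p * fps_map (\<Lambda> p) (W p) = Y p"
        by (simp add: Y_def Z_def fps_map_X_power[OF lin[OF p]])
    qed
    ultimately have Y: "fps_cong (Suc n) (\<Sum>p\<in>F. Y p) (G i - 1)"
      by simp
    have "d (G i) = d (G i - 1)"
      by (simp add: derivationD[OF d(1)])
    also have "fps_cong (Suc n) \<dots> (d (\<Sum>p\<in>F. Y p))"
      by (rule derivationD(6)[OF d(1) fps_cong_sym[OF Y]])
    also have "d (\<Sum>p\<in>F. Y p) = lin_part (\<Sum>p\<in>F. Y p) + (\<Sum>p\<in>F. fps_map (\<Lambda>' p) (d' (Z p)))"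
      unfolding derivationD(7)[OF d(1)] lin_part_sum sum.distrib[symmetric]
      by (intro sum.cong refl dY) (use F in blast)
    also have "fps_cong (Suc n) \<dots> (lin_part (G i - 1) + (\<Sum>p\<in>F. fps_map (\<Lambda>' p) (cst (g i) * Z p)))"
      using Z F unfolding lin_part_def by (intro fps_cong_add fps_cong_sum fps_cong_map Y) blast
    also have "(\<Sum>p\<in>F. fps_map (\<Lambda>' p) (cst (g i) * Z p)) = cst (g i) * (\<Sum>p\<in>F. Y p)"
      unfolding sum_distrib_left Y_def by (intro sum.cong refl fps_map_cst_mult lin) (use F in blast)
    \<comment> \<open>The constants left by the cocycle identity add up to \<gamma>_i itself, which
      turns \<gamma>_i (G_i - 1) into \<gamma>_i G_i.\<close>
    also have "lin_part (G i - 1) = cst (g i)"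
    proof -
      have "Poly_Mapping.lookup (1 :: nat \<Rightarrow>\<^sub>0 'k) (Suc 0) = 0"
        by (simp add: lookup_one when_def)
      then show ?thesis
        by (simp add: lin_part_def g_def fps_eq_iff lookup_minus)
    qed
    also have "fps_cong (Suc n) (cst (g i) + cst (g i) * (\<Sum>p\<in>F. Y p)) (cst (g i) + cst (g i) * (G i - 1))"
      by (intro fps_cong_add fps_cong_mult fps_cong_refl Y)
    also have "\<dots> = cst (g i) * G i"
      by (simp add: algebra_simps)
    finally show ?case
      unfolding eigen_def .
  qed
  then have "d (G i) = cst (g i) * G i"
    using i by (intro fps_eq_by_cong) (simp add: eigen_def)
  then show ?thesis
    by (simp add: dim beta d_def rg_op_def mult.assoc)
qed


theorem theorem3p11:
  fixes I :: "'i set"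
    and P :: "'i \<Rightarrow> 'p set"
    and w :: "'p \<Rightarrow> nat"
    and E :: "'p \<Rightarrow> 'e set"
    and s :: "'i \<Rightarrow> 'k::field_char_0"
    and u :: "'p \<Rightarrow> 'e \<Rightarrow> 'k"
    and \<alpha> :: "'p \<Rightarrow> 'e \<Rightarrow> nat"
  assumes "finite I"
    and "disjoint_family_on P I"
    and "\<And>p. p \<in> (\<Union>i\<in>I. P i) \<Longrightarrow> w p \<ge> 1"
    and "\<And>n. finite {p \<in> (\<Union>i\<in>I. P i). w p = n}"
    and "\<And>p. p \<in> (\<Union>i\<in>I. P i) \<Longrightarrow> finite (E p)"
    and "\<And>p. p \<in> (\<Union>i\<in>I. P i) \<Longrightarrow> (\<Sum>e\<in>E p. u p e) = 1"
    and "\<And>p. p \<in> (\<Union>i\<in>I. P i) \<Longrightarrow> (\<Sum>e\<in>E p. \<alpha> p e) = w p"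
  shows
    "(\<forall>T :: 'i \<Rightarrow> ('p, 'e, 'k) hforest fps. combinatorial_DSE_solution I P E s u \<alpha> T \<longrightarrow>
        (\<forall>i\<in>I.
           (\<exists>!\<phi> :: 'k rio \<Rightarrow> ('p, 'e, 'k) hforest.
              alg_hom \<phi> \<and> fps_map \<phi> rio_Y = T i \<and> fps_map \<phi> rio_Pi = invariant_charge I s T) \<and>
           (\<forall>\<phi> :: 'k rio \<Rightarrow> ('p, 'e, 'k) hforest.
              alg_hom \<phi> \<and> fps_map \<phi> rio_Y = T i \<and> fps_map \<phi> rio_Pi = invariant_charge I s T \<longrightarrow>
              range \<phi> \<subseteq> PE_space (\<Union>j\<in>I. P j) E \<and>
              bialg_hom rio_coprod rio_counit forest_coprod forest_counit \<phi>))) \<and>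
     (\<forall>\<Lambda> G. (\<forall>p\<in>(\<Union>i\<in>I. P i). one_cocycle (E p) (\<Lambda> p)) \<and> DSE_solution I P w E s u \<alpha> \<Lambda> G \<longrightarrow>
        (\<forall>i\<in>I. fps_map KL_deriv (G i) - beta_function I s G * fps_deriv (G i)
                 - anomalous_dim (G i) * G i = 0))"
proof (intro conjI allI impI ballI)
  fix T :: "'i \<Rightarrow> ('p, 'e, 'k) hforest fps" and i
  assume DSE: "combinatorial_DSE_solution I P E s u \<alpha> T" and i: "i \<in> I"
  note solution = assms(3,6,7) DSE i
  show "\<exists>!\<phi> :: 'k rio \<Rightarrow> ('p, 'e, 'k) hforest.
      alg_hom \<phi> \<and> fps_map \<phi> rio_Y = T i \<and> fps_map \<phi> rio_Pi = invariant_charge I s T"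
    by (rule rio_hom_exists_unique[OF solution])
  fix \<phi> :: "'k rio \<Rightarrow> ('p, 'e, 'k) hforest"
  assume \<phi>: "alg_hom \<phi> \<and> fps_map \<phi> rio_Y = T i \<and> fps_map \<phi> rio_Pi = invariant_charge I s T"
  show "range \<phi> \<subseteq> PE_space (\<Union>j\<in>I. P j) E"
    using \<phi> by (intro rio_hom_range[OF solution]) simp_all
  show "bialg_hom rio_coprod rio_counit forest_coprod forest_counit \<phi>"
    using \<phi> by (intro rio_hom_bialg_hom[OF solution]) simp_all
next
  fix \<Lambda> G i
  assume "(\<forall>p\<in>(\<Union>i\<in>I. P i). one_cocycle (E p) (\<Lambda> p)) \<and> DSE_solution I P w E s u \<alpha> \<Lambda> G" "i \<in> I"
  then show "fps_map KL_deriv (G i) - beta_function I s G * fps_deriv (G i) - anomalous_dim (G i) * G i = 0"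
    by (intro renormalization_group_equations[where P = P and w = w and E = E and u = u and \<alpha> = \<alpha> and \<Lambda> = \<Lambda>] assms(3,6,7)) auto
qed

end
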